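(* Run the Congestion-Aware Dual-Learning algorithm (CA-DL, described in the context) with learning rates $\eta=\Theta(1/\sqrt T)$ and $\zeta=\Theta(1/\sqrt T)$. Then for any service slack $\epsilon>0$, its regret is $\mathsf{Regret}_T^{\texttt{CA-DL}}=\mathcal O\big(\sqrt T+\gamma/\epsilon\big)$. In particular, in the stable regime ($\epsilon=\Omega(1)$) the regret is $\mathcal O(\sqrt T+\gamma)$.
   Context: Problem. There are $m$ affiliates and $T$ periods; one case arrives per period $t\in[T]$. Case $t$ has type $\mathbf A_t=(\mathbf w_t,i^\dagger_t)$, $\mathbf w_t\in[0,1]^m$ (reward of matching it to each affiliate), $i^\dagger_t\in\{0,1,\dots,m\}$ ($0$: free case; $i\in[m]$: case tied to affiliate $i$, which must be matched to $i$). Types are i.i.d. from a distribution $\mathcal F$ unknown to the algorithm. Let $\Delta_m=\{\mathbf z\in\mathbb R^m_+:\sum_i z_i\le1\}$, $\mathcal Z(0)=\Delta_m$, $\mathcal Z(i)=\{\mathbf e_i\}$ for $i\in[m]$. Affiliate $i$ has capacity $c_i$, ratio $\rho_i=c_i/T$, $\underline\rho=\min_i\rho_i$; assume $\sum_i\rho_i\le1$ and there is a constant $d>0$ with $\rho_i-\Pr[i^\dagger_t=i]\ge d$ for all $i$. A feasible matching profile has $\mathbf z_t\in\mathcal Z(i^\dagger_t)$ and, for all $t$ and $i$, $\sum_{\tau\le t}\mathbb 1[i^\dagger_\tau=0]z_{\tau,i}\le(c_i-\sum_{\tau\le t}\mathbb 1[i^\dagger_\tau=i]z_{\tau,i})_+$.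 Service availabilities $s_{t,i}\sim\mathrm{Bernoulli}(r_i)$ are i.i.d. over $t$, independent of everything else, with $r_i\in(0,1)$, $r_i\ge\rho_i+\epsilon$, where $\epsilon\ge0$ is the service slack. Backlog: $b_{0,i}=0$, $b_{t,i}=(b_{t-1,i}+z_{t,i}-s_{t,i})_+$. The decision $\mathbf z_t$ is made after observing $\mathbf A_t$ and the history (past types, services, decisions, hence $\mathbf b_{t-1}$) but not $\mathbf s_t$. With penalties $\alpha,\gamma\ge0$, an algorithm $\pi$ earns $\mathsf{ALG}^\pi(\alpha,\gamma)=\sum_{t,i}w_{t,i}z_{t,i}-\alpha\sum_i(\sum_t z_{t,i}-c_i)_+-\frac{\gamma}{T}\sum_{t,i}b_{t,i}$. The offline benchmark $\mathsf{OPT}(\alpha,\gamma)$ is, per sample path, the maximum of the same expression over $\mathbf z_t\in\mathcal Z(i^\dagger_t)$, $\mathbf b_t\ge\mathbf0$ subject to $\sum_t\mathbb 1[i^\dagger_t=0]z_{t,i}\le(c_i-\sum_t\mathbb 1[i^\dagger_t=i]z_{t,i})_+$ for all $i$ and $b_{t,i}\ge b_{t-1,i}+z_{t,i}-s_{t,i}$, $b_{0,i}=0$. Regret: $\mathsf{Regret}_T^\pi=\sup_{\mathcal I}\mathbb E[\mathsf{OPT}(\alpha,\gamma)-\mathsf{ALG}^\pi(\alpha,\gamma)]$, sup over instances $\mathcal I=(m,\boldsymbol\rho,\mathcal F)$, expectation over arrivals, services and the algorithm's randomness. Asymptotics are as $T\to\infty$; "constant" means independent of $T$; $m,\boldsymbol\rho,d,\alpha$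 are constants, $\gamma$ may depend on $T$. CA-DL (inputs $T,\boldsymbol\rho,\eta,\zeta$): initialize $\theta_{1,i}=\lambda_{1,i}=e^{-1}$, $c_{0,i}=\rho_iT$, $b_{0,i}=0$. For each $t$: if $i^\dagger_t\in[m]$ set $\mathbf z_t=\mathbf e_{i^\dagger_t}$; else if $\min_i c_{t-1,i}>0$ set $\mathbf z_t\in\arg\max_{\mathbf z\in\Delta_m}(\mathbf w_t-\boldsymbol\theta_t-\boldsymbol\lambda_t-\zeta\mathbf b_{t-1})\cdot\mathbf z$ (a vertex, ties broken arbitrarily); else $\mathbf z_t=\mathbf 0$. Then set $c_{t,i}=c_{t-1,i}-z_{t,i}$, $b_{t,i}=(b_{t-1,i}+z_{t,i}-s_{t,i})_+$, $\theta_{t+1,i}=\min\{\theta_{t,i}e^{\eta(z_{t,i}-\rho_i)},\alpha\}$, $\lambda_{t+1,i}=\min\{\lambda_{t,i}e^{\eta(z_{t,i}-\rho_i)},(1+2\alpha)/\underline\rho\}$. *)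

theory Defs
  imports "HOL-Probability.Probability" "HOL-Library.Landau_Symbols"
begin

text \<open>The affiliates are the elements of a finite type \<open>'n\<close>, so \<open>m = CARD('n)\<close>.
  A case type is a pair \<open>(w, j)\<close>; \<open>j = None\<close> is a free case and \<open>j = Some i\<close> a case
  tied to affiliate \<open>i\<close>. Periods are numbered \<open>1..T\<close>; \<open>s t i\<close> says whether affiliate \<open>i\<close>
  has service available in period \<open>t\<close>. The capacity of affiliate \<open>i\<close> is \<open>\<rho> $ i * T\<close>.\<close>

type_synonym 'n case_type = "(real^'n) \<times> 'n option"

definition case_space :: "('n::finite) case_type measure" where
  "case_space = borel \<Otimes>\<^sub>M count_space UNIV"

definition matching_simplex :: "(real^'n::finite) set" where
  "matching_simplex = {z. (\<forall>i. 0 \<le> z $ i) \<and> (\<Sum>i\<in>UNIV. z $ i) \<le> 1}"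

definition actions :: "'n::finite option \<Rightarrow> (real^'n) set" where
  "actions j = (case j of None \<Rightarrow> matching_simplex | Some i \<Rightarrow> {axis i 1})"

definition payoff ::
  "nat \<Rightarrow> real^'n::finite \<Rightarrow> real \<Rightarrow> real \<Rightarrow> (nat \<Rightarrow> 'n case_type) \<Rightarrow>
   (nat \<Rightarrow> real^'n) \<Rightarrow> (nat \<Rightarrow> real^'n) \<Rightarrow> real" where
  "payoff T \<rho> \<alpha> \<gamma> A z b =
     (\<Sum>t=1..T. \<Sum>i\<in>UNIV. fst (A t) $ i * z t $ i)
     - \<alpha> * (\<Sum>i\<in>UNIV. max 0 ((\<Sum>t=1..T. z t $ i) - \<rho> $ i * real T))
     - \<gamma> / real T * (\<Sum>t=1..T. \<Sum>i\<in>UNIV. b t $ i)"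

definition offline_feasible ::
  "nat \<Rightarrow> real^'n::finite \<Rightarrow> (nat \<Rightarrow> 'n case_type) \<Rightarrow> (nat \<Rightarrow> 'n \<Rightarrow> bool) \<Rightarrow>
   (nat \<Rightarrow> real^'n) \<Rightarrow> (nat \<Rightarrow> real^'n) \<Rightarrow> bool" where
  "offline_feasible T \<rho> A s z b \<longleftrightarrow>
     (\<forall>t\<in>{1..T}. z t \<in> actions (snd (A t))) \<and>
     (\<forall>i. (\<Sum>t=1..T. of_bool (snd (A t) = None) * z t $ i)
          \<le> max 0 (\<rho> $ i * real T - (\<Sum>t=1..T. of_bool (snd (A t) = Some i) * z t $ i))) \<and>
     b 0 = 0 \<and>
     (\<forall>t\<in>{1..T}. \<forall>i. 0 \<le> b t $ i \<and>
        b (t - 1) $ i + z t $ i - of_bool (s t i) \<le> b t $ i)"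

definition OPT ::
  "nat \<Rightarrow> real^'n::finite \<Rightarrow> real \<Rightarrow> real \<Rightarrow> (nat \<Rightarrow> 'n case_type) \<Rightarrow> (nat \<Rightarrow> 'n \<Rightarrow> bool) \<Rightarrow> real" where
  "OPT T \<rho> \<alpha> \<gamma> A s =
     (SUP (z, b)\<in>{(z, b). offline_feasible T \<rho> A s z b}. payoff T \<rho> \<alpha> \<gamma> A z b)"

text \<open>The maximizers of \<open>v \<bullet> z\<close> over the simplex that are vertices of it, that is, \<open>0\<close> or a
  unit vector.\<close>

definition best_vertices :: "real^'n::finite \<Rightarrow> (real^'n) set" where
  "best_vertices v =
     {z \<in> insert 0 (range (\<lambda>i. axis i 1)). \<forall>y\<in>matching_simplex. v \<bullet> y \<le> v \<bullet> z}"

text \<open>A tie-breaking rule may use internal randomness (a seed \<open>u\<close> drawn from \<open>U\<close>, independent of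
  arrivals and services), the period, the case types up to and including the current one, and the
  services of earlier periods; the earlier decisions are determined by these. Its last argument is
  the set of tied maximizers, from which it has to choose.\<close>

type_synonym 'n tie_rule =
  "nat \<Rightarrow> (nat \<Rightarrow> 'n case_type) \<Rightarrow> (nat \<Rightarrow> 'n \<Rightarrow> bool) \<Rightarrow> (real^'n) set \<Rightarrow> real^'n"

definition tie_breaking :: "'u measure \<Rightarrow> ('u \<Rightarrow> 'n::finite tie_rule) \<Rightarrow> bool" where
  "tie_breaking U \<kappa> \<longleftrightarrow>
     prob_space U \<and>
     (\<forall>u t A s S. S \<noteq> {} \<longrightarrow> S \<subseteq> insert 0 (range (\<lambda>i. axis i 1)) \<longrightarrow> \<kappa> u t A s S \<in> S) \<and>
     (\<forall>t S. (\<lambda>(u, A, s). \<kappa> u t A s S) \<in> borel_measurable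
        (U \<Otimes>\<^sub>M (PiM {1..t} (\<lambda>_. case_space) \<Otimes>\<^sub>M PiM {1..<t} (\<lambda>_. count_space UNIV))))"

text \<open>The state after period \<open>t\<close> consists of \<open>\<theta>\<^sub>t\<^sub>+\<^sub>1\<close>, \<open>\<lambda>\<^sub>t\<^sub>+\<^sub>1\<close>, \<open>c\<^sub>t\<close> and \<open>b\<^sub>t\<close>.\<close>

record 'n cadl_vars =
  theta :: "real^'n"
  lam :: "real^'n"
  cap :: "real^'n"
  backlog :: "real^'n"

definition cadl_init :: "nat \<Rightarrow> real^'n::finite \<Rightarrow> 'n cadl_vars" where
  "cadl_init T \<rho> =
     \<lparr>theta = (\<chi> i. exp (- 1)), lam = (\<chi> i. exp (- 1)), cap = (\<chi> i. \<rho> $ i * real T), backlog = 0\<rparr>"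

definition cadl_decide ::
  "real \<Rightarrow> ((real^'n) set \<Rightarrow> real^'n) \<Rightarrow> 'n::finite case_type \<Rightarrow> 'n cadl_vars \<Rightarrow> real^'n" where
  "cadl_decide \<zeta> pick a \<sigma> =
     (case snd a of
        Some i \<Rightarrow> axis i 1
      | None \<Rightarrow>
          if \<forall>i. 0 < cap \<sigma> $ i
          then pick (best_vertices (fst a - theta \<sigma> - lam \<sigma> - \<zeta> *\<^sub>R backlog \<sigma>))
          else 0)"

definition cadl_update ::
  "real^'n::finite \<Rightarrow> real \<Rightarrow> real \<Rightarrow> real^'n \<Rightarrow> ('n \<Rightarrow> bool) \<Rightarrow> 'n cadl_vars \<Rightarrow> 'n cadl_vars" where
  "cadl_update \<rho> \<alpha> \<eta> z sv \<sigma> =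
     \<lparr>theta = (\<chi> i. min (theta \<sigma> $ i * exp (\<eta> * (z $ i - \<rho> $ i))) \<alpha>),
      lam = (\<chi> i. min (lam \<sigma> $ i * exp (\<eta> * (z $ i - \<rho> $ i)))
                      ((1 + 2 * \<alpha>) / Min (range (\<lambda>j. \<rho> $ j)))),
      cap = cap \<sigma> - z,
      backlog = (\<chi> i. max 0 (backlog \<sigma> $ i + z $ i - of_bool (sv i)))\<rparr>"

context
  fixes T :: nat and \<rho> :: "real^'n::finite" and \<alpha> \<eta> \<zeta> :: real
    and k :: "'n tie_rule" and A :: "nat \<Rightarrow> 'n case_type" and s :: "nat \<Rightarrow> 'n \<Rightarrow> bool"
begin

definition cadl_choice :: "nat \<Rightarrow> 'n cadl_vars \<Rightarrow> real^'n" where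
  "cadl_choice t \<sigma> =
     cadl_decide \<zeta> (k t (restrict A {1..t}) (restrict s {1..<t})) (A t) \<sigma>"

primrec cadl_state :: "nat \<Rightarrow> 'n cadl_vars" where
  "cadl_state 0 = cadl_init T \<rho>"
| "cadl_state (Suc t) =
     cadl_update \<rho> \<alpha> \<eta> (cadl_choice (Suc t) (cadl_state t)) (s (Suc t)) (cadl_state t)"

definition cadl_match :: "nat \<Rightarrow> real^'n" where
  "cadl_match t = cadl_choice t (cadl_state (t - 1))"

definition ALG :: "real \<Rightarrow> real" where
  "ALG \<gamma> = payoff T \<rho> \<alpha> \<gamma> A cadl_match (\<lambda>t. backlog (cadl_state t))"

end

definition service_dist :: "real^'n::finite \<Rightarrow> ('n \<Rightarrow> bool) pmf" where
  "service_dist r = Pi_pmf UNIV False (\<lambda>i. bernoulli_pmf (r $ i))"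

text \<open>Seed, case types and services are independent; the latter two are i.i.d. over time.\<close>

definition sample_space ::
  "nat \<Rightarrow> 'u measure \<Rightarrow> 'n::finite case_type measure \<Rightarrow> real^'n \<Rightarrow>
   ('u \<times> (nat \<Rightarrow> 'n case_type) \<times> (nat \<Rightarrow> 'n \<Rightarrow> bool)) measure" where
  "sample_space T U F r =
     U \<Otimes>\<^sub>M (PiM {1..T} (\<lambda>_. F) \<Otimes>\<^sub>M PiM {1..T} (\<lambda>_. measure_pmf (service_dist r)))"

definition admissible :: "real^'n::finite \<Rightarrow> real \<Rightarrow> 'n case_type measure set" where
  "admissible \<rho> d =
     {F. prob_space F \<and> sets F = sets case_space \<and>
         (AE a in F. \<forall>i. 0 \<le> fst a $ i \<and> fst a $ i \<le> 1) \<and>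
         (\<forall>i. \<rho> $ i - measure F {a \<in> space F. snd a = Some i} \<ge> d)}"

text \<open>Since \<open>m\<close> and \<open>\<rho>\<close> are constants of the asymptotics, the supremum over instances is the
  supremum over the unknown distribution \<open>F\<close>. It is taken in the extended reals, where
  suprema always exist.\<close>

definition regret ::
  "nat \<Rightarrow> real^'n::finite \<Rightarrow> real \<Rightarrow> real^'n \<Rightarrow> real \<Rightarrow> real \<Rightarrow> real \<Rightarrow> real \<Rightarrow>
   'u measure \<Rightarrow> ('u \<Rightarrow> 'n tie_rule) \<Rightarrow> ereal" where
  "regret T \<rho> d r \<alpha> \<gamma> \<eta> \<zeta> U \<kappa> =
     (SUP F\<in>admissible \<rho> d.
        ereal (\<integral>(u, A, s). OPT T \<rho> \<alpha> \<gamma> A s - ALG T \<rho> \<alpha> \<eta> \<zeta> (\<kappa> u) A s \<gamma> \<partial>sample_space T U F r))"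

end

theory Submission
  imports Defs
begin

text \<open>Lagrangian duality for the fluid relaxation gives its value \<open>V\<close> per period, prices \<open>\<mu>\<close> in
  \<open>[0, 1]\<close> with \<open>\<mu> \<bullet> \<rho> \<le> 1\<close>, and near-optimal static policies. The prices bound the expected
  benchmark by \<open>V T + O(sqrt T)\<close>.

  Call a period active while all capacities are positive, and let \<open>N\<close> be the number of inactive
  periods. In an active period CA-DL maximizes \<open>(w - \<theta> - \<lambda> - \<zeta> b) \<bullet> z\<close>, so it does at least as well as
  the static policy, whose expected usage is at most \<open>\<rho>\<close>. Summing up, the collected reward is at
  least \<open>V (T - N)\<close> plus the dual terms \<open>(\<theta> + \<lambda>) \<bullet> (z - \<rho>)\<close> plus \<open>\<zeta> b \<bullet> (z - \<rho>)\<close>. By the regret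
  bound of multiplicative weights the dual terms are at least \<open>(1 + 2 \<alpha>) N - O(sqrt T)\<close>: if
  \<open>N > 0\<close> some capacity is exhausted, and \<open>\<lambda>\<close> competes with its cap at that affiliate. This pays for
  the lost reward and the overallocation of the inactive periods. The quadratic Lyapunov function
  of the backlog turns the last term into \<open>\<zeta> (\<epsilon> B - O(T))\<close>, where \<open>B\<close> is the expected total backlog.
  Finally, the prices also bound the collected reward from above by \<open>V (T - N) + N + O(1)\<close>;
  comparing the two bounds yields \<open>\<zeta> \<epsilon> B = O(sqrt T)\<close>, that is, \<open>B / T = O(1 / \<epsilon>)\<close>.\<close>

section \<open>Multiplicative weights and the action sets\<close>

text \<open>The obstacle is the backlog penalty: \<gamma> may grow with \<open>T\<close>, so the
  total backlog cannot be traded against reward and needs a bound of its own. This is why the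
  collected reward is bounded from both sides in terms of the same \<open>V\<close> and
  \<open>N\<close>: these terms cancel, and the backlog term is left against the errors. The
  learning rates balance the errors: multiplicative weights costs a multiple of
  \<open>1 / \<eta> + \<eta> T\<close>, the squared steps of the backlog cost a multiple of
  \<open>\<zeta> T\<close>, and both are of order \<open>sqrt T\<close>; dividing by
  \<open>\<zeta> \<epsilon>\<close> gives \<open>B = O(T / \<epsilon>)\<close>. The benchmark is
  bounded without its backlog penalty, which avoids a queueing analysis of the offline optimum.
  Comparisons with static policies are made one period at a time: prices and backlogs are fixed
  before the case arrives, hence uncorrelated with it, whereas the decision is correlated with it
  and is compared through its optimality on each path. Fluid optimality is used only up to an
  arbitrary \<delta>, because the supremum is not claimed to be attained.\<close>

text \<open>For negative \<open>x\<close> put \<open>y = - x\<close>: the product of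
  \<open>1 - y + y\<^sup>2\<close> with the quadratic Taylor polynomial of \<open>exp y\<close>,
  which lies below \<open>exp y\<close>, is at least 1.\<close>

lemma exp_quadratic_upper:
  fixes x :: real
  assumes "\<bar>x\<bar> \<le> 1"
  shows "exp x \<le> 1 + x + x\<^sup>2"
proof (cases "0 \<le> x")
  case True
  then show ?thesis using exp_bound[of x] assms by simp
next
  case False
  define y where "y = - x"
  have y: "0 \<le> y" "y \<le> 1" using False assms by (auto simp: y_def)
  have pos: "0 \<le> 1 - y + y\<^sup>2" using y by simp
  have "1 + 0 \<le> 1 + (y^2 + y^3 + y^4) / 2" using y by (intro add_mono) auto
  also have "\<dots> = (1 - y + y\<^sup>2) * (1 + y + y\<^sup>2 / 2)"
    by (simp add: field_simps power2_eq_square power3_eq_cube power4_eq_xxxx)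
  also have "\<dots> \<le> (1 - y + y\<^sup>2) * exp y"
    using exp_lower_Taylor_quadratic[OF y(1)] pos by (intro mult_left_mono) auto
  finally have "exp (- y) \<le> 1 - y + y\<^sup>2"
    by (simp add: exp_minus field_simps)
  then show ?thesis by (simp add: y_def)
qed

text \<open>The potential is \<open>x - \<nu> ln x\<close>, the generalized Kullback--Leibler divergence between \<open>\<nu>\<close>
  and \<open>x\<close> up to a constant; since it increases on \<open>{\<nu>..}\<close>, truncating at \<open>M \<ge> \<nu>\<close> only
  lowers it. For \<open>M = 0\<close> the only comparator is \<open>\<nu> = 0\<close>, and then \<open>ln 0\<close> is harmless.\<close>

lemma truncated_multiplicative_weights:
  fixes x g :: "nat \<Rightarrow> real"
  assumes x0: "x 0 = exp (- 1)"
    and x_Suc: "\<And>t. t < n \<Longrightarrow> x (Suc t) = min (x t * exp (\<eta> * g (Suc t))) M"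
    and g: "\<And>t. t < n \<Longrightarrow> \<bar>g (Suc t)\<bar> \<le> 1"
    and \<eta>: "0 < \<eta>" "\<eta> \<le> 1"
    and \<nu>: "0 \<le> \<nu>" "\<nu> \<le> M" "0 < M \<or> \<nu> = 0"
  shows "(\<Sum>t=1..n. (x (t - 1) - \<nu>) * g t)
           \<ge> - (\<nu> * ln (M + 1) + 1 + \<nu>) / \<eta> - \<eta> * real n * (M + 1)"
proof -
  define \<Phi> where "\<Phi> y = y - \<nu> * ln y" for y
  have M: "0 \<le> M" using \<nu> by linarith
  have e1: "exp (- 1) \<le> (1::real)" by simp
  \<comment> \<open>\<open>M + 1\<close> rather than \<open>M\<close>: the start
    \<open>exp (- 1)\<close> may exceed \<open>M\<close>, since truncation first acts on
    \<open>x 1\<close>. Positivity is claimed only for \<open>0 < M\<close>, as \<open>M = 0\<close>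
    truncates to 0.\<close>
  have inv: "0 \<le> x t \<and> x t \<le> M + 1 \<and> (0 < M \<longrightarrow> 0 < x t)" if "t \<le> n" for t
    using that
  proof (induction t)
    case 0
    then show ?case using x0 M e1 by (auto intro: order_trans[OF e1])
  next
    case (Suc t)
    then show ?case using x_Suc[of t] M by auto
  qed
  have clip: "\<Phi> (min y M) \<le> \<Phi> y" if "0 < y \<or> \<nu> = 0" for y
  proof (cases "y \<le> M")
    case False
    show ?thesis
    proof (cases "\<nu> = 0")
      case False
      with \<nu> that have "0 < \<nu>" "0 < M" "0 < y" by auto
      have "ln y - ln M = ln (y / M)" using \<open>0 < y\<close> \<open>0 < M\<close> by (simp add: ln_div)
      also have "\<dots> \<le> y / M - 1" using \<open>0 < y\<close> \<open>0 < M\<close> by (intro ln_le_minus_one) auto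
      finally have "\<nu> * (ln y - ln M) \<le> \<nu> * (y / M - 1)" using \<nu> by (intro mult_left_mono) auto
      also have "\<dots> \<le> M * (y / M - 1)"
        using \<nu> \<open>\<not> y \<le> M\<close> \<open>0 < M\<close> by (intro mult_right_mono) (auto simp: field_simps)
      also have "\<dots> = y - M" using \<open>0 < M\<close> by (simp add: field_simps)
      finally show ?thesis using \<open>\<not> y \<le> M\<close> by (simp add: \<Phi>_def min_def algebra_simps)
    qed (use \<open>\<not> y \<le> M\<close> in \<open>simp add: \<Phi>_def\<close>)
  qed simp
  \<comment> \<open>The logarithm changes by exactly \<open>u\<close>, while
    \<open>exp_quadratic_upper\<close> bounds the growth of \<open>x\<close> by
    \<open>x (u + u\<^sup>2)\<close>; the terms linear in \<open>u\<close> combine to the regret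
    term.\<close>
  have step: "\<Phi> (x (Suc t)) \<le> \<Phi> (x t) + \<eta> * ((x t - \<nu>) * g (Suc t)) + \<eta>\<^sup>2 * (M + 1)" if "t < n" for t
  proof -
    define u where "u = \<eta> * g (Suc t)"
    have u: "\<bar>u\<bar> \<le> \<eta>" using g[OF that] \<eta> by (simp add: u_def abs_mult mult_left_le)
    have "u\<^sup>2 \<le> \<eta>\<^sup>2" using u \<eta> by (metis abs_le_square_iff abs_of_pos)
    have xt: "0 \<le> x t" "x t \<le> M + 1" "0 < x t \<or> \<nu> = 0" using inv[of t] that \<nu> by auto
    have "\<Phi> (x (Suc t)) \<le> \<Phi> (x t * exp u)"
      using x_Suc[OF that] clip[of "x t * exp u"] xt by (auto simp: u_def)
    also have "\<Phi> (x t * exp u) = x t * exp u - \<nu> * ln (x t) - \<nu> * u"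
    proof (cases "\<nu> = 0")
      case False
      then have "0 < x t" using xt by auto
      then show ?thesis by (simp add: \<Phi>_def ln_mult algebra_simps)
    qed (simp add: \<Phi>_def)
    also have "\<dots> \<le> x t * (1 + u + u\<^sup>2) - \<nu> * ln (x t) - \<nu> * u"
      using mult_left_mono[OF exp_quadratic_upper[of u] xt(1)] u \<eta> by simp
    also have "\<dots> = \<Phi> (x t) + \<eta> * ((x t - \<nu>) * g (Suc t)) + x t * u\<^sup>2"
      by (simp add: \<Phi>_def u_def algebra_simps)
    also have "x t * u\<^sup>2 \<le> (M + 1) * \<eta>\<^sup>2"
      using xt \<open>u\<^sup>2 \<le> \<eta>\<^sup>2\<close> by (intro mult_mono) auto
    finally show ?thesis by (simp add: mult.commute)
  qed
  have tel: "\<Phi> (x k) \<le> \<Phi> (x 0) + \<eta> * (\<Sum>t=1..k. (x (t - 1) - \<nu>) * g t) + real k * \<eta>\<^sup>2 * (M + 1)"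
    if "k \<le> n" for k
    using that
  proof (induction k)
    case (Suc k)
    then show ?case using step[of k] by (simp add: algebra_simps)
  qed simp
  have "\<nu> * ln (x n) \<le> \<nu> * ln (M + 1)"
  proof (cases "\<nu> = 0")
    case False
    then have "0 < x n" "x n \<le> M + 1" using inv[of n] \<nu> by auto
    then show ?thesis using \<nu> by (intro mult_left_mono) auto
  qed simp
  then have "\<Phi> (x n) \<ge> - \<nu> * ln (M + 1)" using inv[of n] by (simp add: \<Phi>_def)
  \<comment> \<open>The start \<open>exp (- 1)\<close> has logarithm -1, so the initial potential is
    \<open>exp (- 1) + \<nu>\<close>.\<close>
  moreover have "\<Phi> (x 0) \<le> 1 + \<nu>" using x0 e1 by (simp add: \<Phi>_def)
  ultimately have "- (\<nu> * ln (M + 1) + 1 + \<nu>) - real n * \<eta>\<^sup>2 * (M + 1)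
      \<le> \<eta> * (\<Sum>t=1..n. (x (t - 1) - \<nu>) * g t)"
    using tel[of n] by simp
  then have "(- (\<nu> * ln (M + 1) + 1 + \<nu>) - real n * \<eta>\<^sup>2 * (M + 1)) / \<eta>
      \<le> (\<Sum>t=1..n. (x (t - 1) - \<nu>) * g t)"
    using \<eta> by (simp add: field_simps)
  then show ?thesis using \<eta> by (simp add: field_simps power2_eq_square)
qed

section \<open>The simplex and its vertices\<close>

abbreviation vertices :: "(real^'n::finite) set" where
  "vertices \<equiv> insert 0 (range (\<lambda>i. axis i 1))"

lemma vertices_component:
  assumes "z \<in> vertices"
  shows "0 \<le> z $ i" "z $ i \<le> 1"
  using assms by (auto simp: axis_def)

lemma vertices_subset_simplex: "vertices \<subseteq> matching_simplex"
proof
  fix z :: "real^'n"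
  assume z: "z \<in> vertices"
  then have "(\<Sum>i\<in>UNIV. z $ i) \<le> 1" by (auto simp: axis_def)
  with vertices_component(1)[OF z] show "z \<in> matching_simplex" by (auto simp: matching_simplex_def)
qed

lemma inner_simplex_le:
  fixes v :: "real^'n::finite"
  assumes y: "y \<in> matching_simplex" and "0 \<le> M" "\<And>i. v $ i \<le> M"
  shows "v \<bullet> y \<le> M"
proof -
  have "v \<bullet> y = (\<Sum>i\<in>UNIV. v $ i * y $ i)" by (simp add: inner_vec_def)
  also have "\<dots> \<le> (\<Sum>i\<in>UNIV. M * y $ i)"
    using y assms(3) by (intro sum_mono mult_right_mono) (auto simp: matching_simplex_def)
  also have "\<dots> = M * (\<Sum>i\<in>UNIV. y $ i)" by (simp add: sum_distrib_left)
  also have "\<dots> \<le> M * 1"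
    using y assms(2) by (intro mult_left_mono) (auto simp: matching_simplex_def)
  finally show ?thesis by simp
qed

text \<open>A linear functional that is nonnegative at the best vertex is bounded on the simplex by
  its value there, so testing the finitely many vertices suffices. Finiteness gives the existence of
  maximizers and measurability below.\<close>

lemma best_vertices_eq:
  "best_vertices v = {z \<in> vertices. \<forall>y\<in>vertices. v \<bullet> y \<le> v \<bullet> z}"
proof (intro set_eqI iffI)
  fix z assume "z \<in> best_vertices v"
  then show "z \<in> {z \<in> vertices. \<forall>y\<in>vertices. v \<bullet> y \<le> v \<bullet> z}"
    using vertices_subset_simplex by (auto simp: best_vertices_def)
next
  fix z assume z: "z \<in> {z \<in> vertices. \<forall>y\<in>vertices. v \<bullet> y \<le> v \<bullet> z}"
  then have "0 \<le> v \<bullet> z" by auto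
  moreover have "v $ i \<le> v \<bullet> z" for i
    using z inner_axis[of v i 1] by (metis (mono_tags, lifting) inner_real_def insertCI mem_Collect_eq mult.right_neutral rangeI)
  ultimately show "z \<in> best_vertices v"
    using z inner_simplex_le by (fastforce simp: best_vertices_def)
qed

lemma best_vertices_nonempty:
  fixes v :: "real^'n::finite"
  shows "best_vertices v \<noteq> {}"
proof -
  obtain z where "z \<in> vertices" "\<forall>y\<in>vertices. v \<bullet> y \<le> v \<bullet> z"
  proof (rule obtains_MAX[of "vertices :: (real^'n) set" "\<lambda>y. v \<bullet> y"])
    fix z assume "z \<in> vertices" "Max ((\<bullet>) v ` vertices) = v \<bullet> z"
    moreover have "\<forall>y\<in>vertices. v \<bullet> y \<le> Max ((\<bullet>) v ` vertices)" by (intro ballI Max_ge) auto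
    ultimately show ?thesis using that by simp
  qed auto
  then show ?thesis by (auto simp: best_vertices_eq)
qed

lemma best_vertices_subset: "best_vertices v \<subseteq> vertices"
  by (auto simp: best_vertices_def)

lemma actions_component:
  assumes "z \<in> actions j"
  shows "0 \<le> z $ i" "z $ i \<le> 1" "(\<Sum>i\<in>UNIV. z $ i) \<le> 1"
proof -
  have "actions j \<subseteq> matching_simplex"
    using vertices_subset_simplex by (auto simp: actions_def split: option.splits)
  then have z: "z \<in> matching_simplex" using assms by auto
  then show "0 \<le> z $ i" "(\<Sum>i\<in>UNIV. z $ i) \<le> 1" by (auto simp: matching_simplex_def)
  have "z $ i \<le> (\<Sum>i\<in>UNIV. z $ i)"
    using z by (intro member_le_sum) (auto simp: matching_simplex_def)
  then show "z $ i \<le> 1" using \<open>(\<Sum>i\<in>UNIV. z $ i) \<le> 1\<close> by simp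
qed

section \<open>Sample paths of CA-DL\<close>

locale cadl_path =
  fixes T :: nat and \<rho> :: "real^'n::finite" and \<alpha> \<eta> \<zeta> :: real
    and k :: "'n tie_rule" and A :: "nat \<Rightarrow> 'n case_type" and s :: "nat \<Rightarrow> 'n \<Rightarrow> bool"
  assumes pick: "\<And>t A s S. S \<noteq> {} \<Longrightarrow> S \<subseteq> vertices \<Longrightarrow> k t A s S \<in> S"
    and \<rho>_pos: "\<And>i. 0 < \<rho> $ i" and \<rho>_le: "\<And>i. \<rho> $ i \<le> 1"
    and \<alpha>_nonneg: "0 \<le> \<alpha>" and \<eta>: "0 < \<eta>" "\<eta> \<le> 1" and \<zeta>_nonneg: "0 \<le> \<zeta>"
begin

abbreviation "st \<equiv> cadl_state T \<rho> \<alpha> \<eta> \<zeta> k A s"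
abbreviation "z \<equiv> cadl_match T \<rho> \<alpha> \<eta> \<zeta> k A s"

definition active :: "nat \<Rightarrow> bool" where
  "active t \<longleftrightarrow> (\<forall>i. 0 < cap (st (t - 1)) $ i)"

abbreviation act :: "nat \<Rightarrow> real" where
  "act t \<equiv> of_bool (active t)"

definition lam_max :: real where
  "lam_max = (1 + 2 * \<alpha>) / Min (range (\<lambda>j. \<rho> $ j))"

text \<open>This calibrates the cap: excess use of \<open>\<rho> $ i\<close> at an exhausted
  affiliate, priced at \<open>lam_max\<close>, covers the reward (at most 1) and the overallocation
  penalty (at most \<alpha>) of an inactive period.\<close>

lemma lam_max_\<rho>: "1 + 2 * \<alpha> \<le> lam_max * \<rho> $ i"
proof -
  have "Min (range (\<lambda>j. \<rho> $ j)) \<in> range (\<lambda>j. \<rho> $ j)" by (intro Min_in) auto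
  then have "0 < Min (range (\<lambda>j. \<rho> $ j))" using \<rho>_pos by auto
  moreover have "Min (range (\<lambda>j. \<rho> $ j)) \<le> \<rho> $ i" by simp
  ultimately have "(1 + 2 * \<alpha>) * Min (range (\<lambda>j. \<rho> $ j)) \<le> (1 + 2 * \<alpha>) * \<rho> $ i"
    using \<alpha>_nonneg by (intro mult_left_mono) auto
  with \<open>0 < Min _\<close> show ?thesis by (simp add: lam_max_def pos_le_divide_eq)
qed

lemma lam_max_ge_1: "1 \<le> lam_max"
proof -
  have *: "1 \<le> lam_max * \<rho> $ i" for i using lam_max_\<rho>[of i] \<alpha>_nonneg by linarith
  then have "0 < lam_max * \<rho> $ undefined" using less_le_trans[OF zero_less_one] by blast
  then have "0 < lam_max" using \<rho>_pos zero_less_mult_pos2 by blast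
  then have "lam_max * \<rho> $ undefined \<le> lam_max * 1" using \<rho>_le by (intro mult_left_mono) auto
  with * show ?thesis by (metis mult.right_neutral order_trans)
qed

lemma st_Suc: "st (Suc t) = cadl_update \<rho> \<alpha> \<eta> (z (Suc t)) (s (Suc t)) (st t)"
  by (simp add: cadl_match_def)

lemma match_tied: "snd (A t) = Some i \<Longrightarrow> z t = axis i 1"
  by (simp add: cadl_match_def cadl_choice_def cadl_decide_def)

lemma match_inactive: "snd (A t) = None \<Longrightarrow> \<not> active t \<Longrightarrow> z t = 0"
  by (auto simp add: cadl_match_def cadl_choice_def cadl_decide_def active_def)

lemma match_free_active:
  assumes "snd (A t) = None" "active t"
  shows "z t \<in> best_vertices (fst (A t) - theta (st (t - 1)) - lam (st (t - 1))
                             - \<zeta> *\<^sub>R backlog (st (t - 1)))"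
  using assms pick[OF best_vertices_nonempty best_vertices_subset]
  by (simp add: cadl_match_def cadl_choice_def cadl_decide_def active_def)

lemma match_vertex: "z t \<in> vertices"
proof (cases "snd (A t)")
  case None
  then show ?thesis
    using match_inactive[of t] match_free_active[of t] best_vertices_subset by (cases "active t") blast+
qed (simp add: match_tied)

lemma match_action: "z t \<in> actions (snd (A t))"
  using match_tied[of t] match_vertex[of t] vertices_subset_simplex
  by (auto simp: actions_def split: option.splits)

lemma match_bounds: "0 \<le> z t $ i" "z t $ i \<le> 1" "(\<Sum>i\<in>UNIV. z t $ i) \<le> 1"
  using actions_component[OF match_action] by auto

lemma drift_bound: "\<bar>z t $ i - \<rho> $ i\<bar> \<le> 1"
  using match_bounds(1,2)[of t i] \<rho>_pos[of i] \<rho>_le[of i] by linarith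

section \<open>Capacity use and active periods\<close>

lemma cap_eq: "cap (st n) $ i = \<rho> $ i * real T - (\<Sum>t=1..n. z t $ i)"
proof (induction n)
  case (Suc n)
  have "cap (st (Suc n)) = cap (st n) - z (Suc n)" by (simp only: st_Suc cadl_update_def cadl_vars.simps)
  with Suc show ?case by simp
qed (simp add: cadl_init_def)

lemma active_antimono:
  assumes "active t" "t' \<le> t"
  shows "active t'"
proof -
  have "cap (st (t - 1)) $ i \<le> cap (st (t' - 1)) $ i" for i
    unfolding cap_eq using assms match_bounds(1) by (intro diff_mono sum_mono2) auto
  then show ?thesis using assms unfolding active_def by (meson less_le_trans)
qed

text \<open>Capacities never grow, so activity ends once and for all. Sums weighted by
  \<open>act\<close> thus become sums over an initial segment, to which the multiplicative weights
  bound applies.\<close>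

lemma active_prefix: "\<exists>\<tau>\<le>n. \<forall>t\<in>{1..n}. active t \<longleftrightarrow> t \<le> \<tau>"
proof (induction n)
  case (Suc n)
  then obtain \<tau> where \<tau>: "\<tau> \<le> n" "\<forall>t\<in>{1..n}. active t \<longleftrightarrow> t \<le> \<tau>" by auto
  show ?case
  proof (cases "active (Suc n)")
    case True
    then show ?thesis using active_antimono[OF True] by (intro exI[of _ "Suc n"]) auto
  next
    case False
    then show ?thesis using \<tau> by (intro exI[of _ \<tau>]) (auto simp: le_Suc_eq)
  qed
qed auto

text \<open>The path version of \<open>N\<close> in the overview.\<close>

definition idle :: real where
  "idle = (\<Sum>t=1..T. 1 - act t)"

lemma idle_nonneg: "0 \<le> idle"
  unfolding idle_def by (intro sum_nonneg) auto

text \<open>The 1 is the overshoot of the last active period: the capacity is positive before it,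
  but possibly less than the one unit then matched.\<close>

lemma active_consumption: "(\<Sum>t=1..n. act t * z t $ i) \<le> \<rho> $ i * real T + 1"
proof (induction n)
  case 0
  then show ?case using \<rho>_pos[of i] by (simp add: add_nonneg_nonneg)
next
  case (Suc n)
  show ?case
  proof (cases "active (Suc n)")
    case True
    have "(\<Sum>t=1..n. act t * z t $ i) \<le> (\<Sum>t=1..n. z t $ i)"
      using match_bounds(1) by (intro sum_mono) (auto simp: of_bool_def)
    also have "\<dots> \<le> \<rho> $ i * real T"
      using True[unfolded active_def, rule_format, of i] cap_eq[of n i] by simp
    finally show ?thesis using match_bounds(2)[of "Suc n" i] True by simp
  qed (use Suc in simp)
qed

text \<open>Active periods overshoot by at most 1 per affiliate, and an inactive period adds at most
  one unit over all affiliates together.\<close>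

lemma overallocation_le:
  "(\<Sum>i\<in>UNIV. max 0 ((\<Sum>t=1..T. z t $ i) - \<rho> $ i * real T)) \<le> real CARD('n) + idle"
proof -
  have "(\<Sum>i\<in>UNIV. max 0 ((\<Sum>t=1..T. z t $ i) - \<rho> $ i * real T))
      \<le> (\<Sum>i\<in>UNIV. 1 + (\<Sum>t=1..T. (1 - act t) * z t $ i))"
  proof (intro sum_mono max.boundedI)
    fix i
    show "0 \<le> 1 + (\<Sum>t=1..T. (1 - act t) * z t $ i)"
      using match_bounds(1) by (intro add_nonneg_nonneg sum_nonneg mult_nonneg_nonneg) auto
    show "(\<Sum>t=1..T. z t $ i) - \<rho> $ i * real T \<le> 1 + (\<Sum>t=1..T. (1 - act t) * z t $ i)"
      using active_consumption[of i T] by (simp add: left_diff_distrib sum_subtractf)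
  qed
  also have "\<dots> = real CARD('n) + (\<Sum>t=1..T. (1 - act t) * (\<Sum>i\<in>UNIV. z t $ i))"
    by (simp add: sum.distrib sum_distrib_left) (rule sum.swap)
  also have "(\<Sum>t=1..T. (1 - act t) * (\<Sum>i\<in>UNIV. z t $ i)) \<le> idle"
    unfolding idle_def using match_bounds(3) by (intro sum_mono mult_left_le) auto
  finally show ?thesis by simp
qed

text \<open>\<open>\<alpha> + 1\<close> accommodates the initial value \<open>exp (- 1)\<close>,
  which is not truncated and may exceed \<alpha>. For \<open>lam\<close> the cap itself covers the
  start, being at least 1.\<close>

lemma theta_bounds: "0 \<le> theta (st t) $ i" "theta (st t) $ i \<le> \<alpha> + 1"
proof -
  have "0 \<le> theta (st t) $ i \<and> theta (st t) $ i \<le> \<alpha> + 1"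
  proof (cases t)
    case 0
    have "exp (- 1) \<le> (1::real)" by simp
    then have "exp (- 1) \<le> \<alpha> + 1" using \<alpha>_nonneg by linarith
    then show ?thesis using 0 by (simp add: cadl_init_def)
  next
    case (Suc t')
    have "0 \<le> theta (st t) $ i" for t
      by (induction t) (use \<alpha>_nonneg in \<open>auto simp: cadl_init_def cadl_update_def\<close>)
    moreover have "theta (st t) $ i \<le> \<alpha>" using Suc by (simp add: cadl_update_def)
    ultimately show ?thesis by (metis add_increasing2 zero_le_one)
  qed
  then show "0 \<le> theta (st t) $ i" "theta (st t) $ i \<le> \<alpha> + 1" by auto
qed

lemma lam_bounds: "0 \<le> lam (st t) $ i" "lam (st t) $ i \<le> lam_max"
proof -
  show "0 \<le> lam (st t) $ i"
    using lam_max_ge_1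
    by (induction t) (auto simp: cadl_init_def cadl_update_def lam_max_def[symmetric])
  show "lam (st t) $ i \<le> lam_max"
  proof (cases t)
    case 0
    have "exp (- 1) \<le> (1::real)" by simp
    then have "exp (- 1) \<le> lam_max" using lam_max_ge_1 by linarith
    then show ?thesis using 0 by (simp add: cadl_init_def)
  qed (simp add: cadl_update_def lam_max_def[symmetric])
qed

section \<open>Backlog dynamics\<close>

lemma backlog_Suc:
  "backlog (st (Suc t)) $ i = max 0 (backlog (st t) $ i + z (Suc t) $ i - of_bool (s (Suc t) i))"
  by (simp add: st_Suc cadl_update_def del: cadl_state.simps)

lemma backlog_bounds: "0 \<le> backlog (st t) $ i" "backlog (st t) $ i \<le> real t"
proof -
  have "0 \<le> backlog (st t) $ i \<and> backlog (st t) $ i \<le> real t"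
  proof (induction t)
    case (Suc t)
    then show ?case using match_bounds(2)[of "Suc t" i] by (auto simp: backlog_Suc simp del: cadl_state.simps)
  qed (simp add: cadl_init_def)
  then show "0 \<le> backlog (st t) $ i" "backlog (st t) $ i \<le> real t" by auto
qed

text \<open>The payoff charges the backlog after a period, while the analysis weighs decisions by
  the backlog before it; this bounds the difference.\<close>

lemma backlog_step: "backlog (st t) $ i \<le> backlog (st (t - 1)) $ i + 1"
proof (cases t)
  case (Suc t')
  then show ?thesis using match_bounds(2)[of "Suc t'" i] backlog_bounds(1)[of t' i]
    by (auto simp: backlog_Suc simp del: cadl_state.simps)
qed simp

text \<open>Truncation at 0 can only lower the square of the backlog, so one step adds at most twice
  the drift term plus the squared increment, which is at most 1. The telescoped sum is nonnegative
  because it bounds a square.\<close>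

lemma backlog_drift:
  "(\<Sum>t=1..n. backlog (st (t - 1)) $ i * (z t $ i - of_bool (s t i))) \<ge> - real n / 2"
proof -
  have "(backlog (st n) $ i)\<^sup>2
      \<le> 2 * (\<Sum>t=1..n. backlog (st (t - 1)) $ i * (z t $ i - of_bool (s t i))) + real n"
  proof (induction n)
    case (Suc n)
    define b where "b = backlog (st n) $ i"
    define x where "x = z (Suc n) $ i - of_bool (s (Suc n) i)"
    have "\<bar>x\<bar> \<le> 1" using match_bounds(1,2)[of "Suc n" i] by (auto simp: x_def)
    then have "x\<^sup>2 \<le> 1" by (simp add: abs_square_le_1)
    have "backlog (st (Suc n)) $ i = max 0 (b + x)" by (simp only: backlog_Suc b_def x_def add_diff_eq)
    then have "(backlog (st (Suc n)) $ i)\<^sup>2 \<le> (b + x)\<^sup>2" by (auto simp: max_def)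
    also have "\<dots> = b\<^sup>2 + 2 * (b * x) + x\<^sup>2" by (simp add: power2_eq_square algebra_simps)
    finally show ?case using Suc \<open>x\<^sup>2 \<le> 1\<close> by (simp add: b_def x_def del: cadl_state.simps)
  qed (simp add: cadl_init_def)
  then show ?thesis using zero_le_power2[of "backlog (st n) $ i"] by linarith
qed

text \<open>With a tied case the only action is the match itself; with a free case in an active
  period the decision maximizes over the whole simplex. The backlog acts as a further price, scaled
  by \<zeta>.\<close>

lemma match_optimal:
  assumes y: "y \<in> actions (snd (A t))"
  defines "p \<equiv> theta (st (t - 1)) + lam (st (t - 1)) + \<zeta> *\<^sub>R backlog (st (t - 1))"
  shows "act t * ((fst (A t) - p) \<bullet> y) \<le> act t * ((fst (A t) - p) \<bullet> z t)"
proof (cases "active t")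
  case True
  show ?thesis
  proof (cases "snd (A t)")
    case None
    with y have "y \<in> matching_simplex" by (simp add: actions_def)
    then show ?thesis using match_free_active[OF None True] True
      by (simp add: best_vertices_def p_def diff_diff_eq add.assoc)
  next
    case (Some i)
    with y match_tied[OF Some] show ?thesis by (simp add: actions_def)
  qed
qed simp

text \<open>It dominates, for each affiliate, the coefficients left by the two runs of
  multiplicative weights: at most \<open>2 + lam_max + lam_max ln (lam_max + 1)\<close> for
  \<open>1 / \<eta>\<close>, and \<open>\<alpha> + lam_max + 2\<close> for \<open>\<eta> T\<close>.
  It depends only on \<rho> and \<alpha>.\<close>

definition dual_const :: real where
  "dual_const = real CARD('n) * (\<alpha> + lam_max + 2 + lam_max * ln (lam_max + 1))"

lemma dual_regret:
  "(\<Sum>t=1..T. act t * ((theta (st (t - 1)) + lam (st (t - 1))) \<bullet> (z t - \<rho>)))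
     \<ge> (1 + 2 * \<alpha>) * idle - dual_const * (1 / \<eta> + \<eta> * real T)"
proof -
  obtain \<tau> where \<tau>: "\<tau> \<le> T" "\<And>t. t \<in> {1..T} \<Longrightarrow> active t \<longleftrightarrow> t \<le> \<tau>"
    using active_prefix[of T] by auto
  have prefix: "(\<Sum>t=1..T. act t * f t) = (\<Sum>t=1..\<tau>. f t)" for f
  proof -
    have "(\<Sum>t=1..T. act t * f t) = (\<Sum>t\<in>{1..T}. if t \<in> {1..\<tau>} then f t else 0)"
      using \<tau>(2) by (intro sum.cong) auto
    also have "\<dots> = (\<Sum>t=1..\<tau>. f t)" using \<tau>(1) by (intro sum.mono_neutral_cong_right) auto
    finally show ?thesis .
  qed
  have idle: "idle = real T - real \<tau>"
    using prefix[of "\<lambda>_. 1"] by (simp add: idle_def sum_subtractf)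
  define c where "c = 2 + lam_max + lam_max * ln (lam_max + 1)"
  define g where "g i t = z t $ i - \<rho> $ i" for i t
  have ln0: "0 \<le> lam_max * ln (lam_max + 1)" using lam_max_ge_1 by simp
  \<comment> \<open>\<open>theta\<close> competes with 0, so it contributes only an error; the gain
    comes from \<open>lam\<close>.\<close>
  have \<theta>: "(\<Sum>t=1..\<tau>. theta (st (t - 1)) $ i * g i t) \<ge> - 1 / \<eta> - \<eta> * real \<tau> * (\<alpha> + 1)" for i
    using truncated_multiplicative_weights[of "\<lambda>t. theta (st t) $ i" \<tau> \<eta> "g i" \<alpha> 0]
      \<eta> \<alpha>_nonneg drift_bound
    by (simp add: g_def st_Suc cadl_update_def cadl_init_def del: cadl_state.simps(2))
  have \<lambda>: "(\<Sum>t=1..\<tau>. (lam (st (t - 1)) $ i - \<nu>) * g i t)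
      \<ge> - (\<nu> * ln (lam_max + 1) + 1 + \<nu>) / \<eta> - \<eta> * real \<tau> * (lam_max + 1)"
    if "0 \<le> \<nu>" "\<nu> \<le> lam_max" for i \<nu>
    using truncated_multiplicative_weights[of "\<lambda>t. lam (st t) $ i" \<tau> \<eta> "g i" lam_max \<nu>]
      \<eta> lam_max_ge_1 drift_bound that
    by (simp add: g_def st_Suc cadl_update_def cadl_init_def lam_max_def[symmetric] del: cadl_state.simps(2))
  obtain \<nu> :: "'n \<Rightarrow> real" where \<nu>: "\<And>i. \<nu> i = 0 \<or> \<nu> i = lam_max"
    and gain: "(\<Sum>i\<in>UNIV. \<nu> i * (\<Sum>t=1..\<tau>. g i t)) \<ge> (1 + 2 * \<alpha>) * idle"
  proof (cases "\<tau> = T")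
    case True
    then show ?thesis using that[of "\<lambda>_. 0"] idle by simp
  next
    case False
    \<comment> \<open>Activity in period \<open>\<tau> + 1\<close> is decided by the capacities
      after period \<tau>.\<close>
    then have "\<not> active (Suc \<tau>)" using \<tau> by auto
    then obtain j where j: "cap (st \<tau>) $ j \<le> 0" by (auto simp: active_def not_less)
    \<comment> \<open>Affiliate \<open>j\<close> has used its whole capacity within \<tau> periods,
      although its ratio allots only \<open>\<rho> $ j\<close> per period; the excess is the share
      of the inactive periods.\<close>
    have "(\<Sum>t=1..\<tau>. g j t) = (\<Sum>t=1..\<tau>. z t $ j) - real \<tau> * \<rho> $ j" by (simp add: g_def sum_subtractf)
    also have "\<dots> \<ge> \<rho> $ j * idle" using j by (simp add: cap_eq idle algebra_simps)
    finally have "lam_max * (\<Sum>t=1..\<tau>. g j t) \<ge> lam_max * (\<rho> $ j * idle)"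
      using lam_max_ge_1 by (intro mult_left_mono) auto
    moreover have "(1 + 2 * \<alpha>) * idle \<le> lam_max * \<rho> $ j * idle"
      using lam_max_\<rho> idle_nonneg by (intro mult_right_mono) auto
    moreover have "(\<Sum>i\<in>UNIV. (if i = j then lam_max else 0) * (\<Sum>t=1..\<tau>. g i t))
        = lam_max * (\<Sum>t=1..\<tau>. g j t)"
      by (simp add: if_distrib[of "\<lambda>x. x * _"] cong: if_cong)
    ultimately show ?thesis using that[of "\<lambda>i. if i = j then lam_max else 0"] by simp
  qed
  have each: "(\<Sum>t=1..\<tau>. (theta (st (t - 1)) $ i + lam (st (t - 1)) $ i) * g i t)
      \<ge> \<nu> i * (\<Sum>t=1..\<tau>. g i t) - (\<alpha> + c) * (1 / \<eta> + \<eta> * real T)" for i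
  proof -
    have \<nu>i: "0 \<le> \<nu> i" "\<nu> i \<le> lam_max" using \<nu>[of i] lam_max_ge_1 by auto
    have "\<nu> i * ln (lam_max + 1) + 1 + \<nu> i \<le> lam_max * ln (lam_max + 1) + 1 + lam_max"
      using \<nu>i lam_max_ge_1 by (intro add_mono mult_right_mono) auto
    then have 1: "(\<nu> i * ln (lam_max + 1) + 1 + \<nu> i) / \<eta> \<le> (c - 1) / \<eta>"
      using \<eta> by (intro divide_right_mono) (auto simp: c_def)
    have 2: "\<eta> * real \<tau> * (\<alpha> + lam_max + 2) \<le> \<eta> * real T * (\<alpha> + c)"
      using \<eta> \<tau> \<alpha>_nonneg lam_max_ge_1 ln0 by (intro mult_mono) (auto simp: c_def)
    have 3: "c / \<eta> \<le> (\<alpha> + c) / \<eta>" using \<eta> \<alpha>_nonneg by (intro divide_right_mono) auto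
    have "(\<Sum>t=1..\<tau>. (theta (st (t - 1)) $ i + lam (st (t - 1)) $ i) * g i t)
        = (\<Sum>t=1..\<tau>. theta (st (t - 1)) $ i * g i t)
          + (\<Sum>t=1..\<tau>. (lam (st (t - 1)) $ i - \<nu> i) * g i t) + \<nu> i * (\<Sum>t=1..\<tau>. g i t)"
      by (simp add: sum.distrib sum_subtractf sum_distrib_left algebra_simps)
    then show ?thesis using \<theta>[of i] \<lambda>[OF \<nu>i, of i] 1 2 3
      by (simp add: algebra_simps add_divide_distrib diff_divide_distrib)
  qed
  have "(\<Sum>t=1..T. act t * ((theta (st (t - 1)) + lam (st (t - 1))) \<bullet> (z t - \<rho>)))
      = (\<Sum>t=1..\<tau>. \<Sum>i\<in>UNIV. (theta (st (t - 1)) $ i + lam (st (t - 1)) $ i) * g i t)"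
    unfolding prefix by (simp add: inner_vec_def g_def)
  also have "\<dots> = (\<Sum>i\<in>UNIV. \<Sum>t=1..\<tau>. (theta (st (t - 1)) $ i + lam (st (t - 1)) $ i) * g i t)"
    by (rule sum.swap)
  also have "\<dots> \<ge> (\<Sum>i\<in>UNIV. \<nu> i * (\<Sum>t=1..\<tau>. g i t) - (\<alpha> + c) * (1 / \<eta> + \<eta> * real T))"
    by (intro sum_mono each)
  also have "(\<Sum>i\<in>UNIV. \<nu> i * (\<Sum>t=1..\<tau>. g i t) - (\<alpha> + c) * (1 / \<eta> + \<eta> * real T))
      = (\<Sum>i\<in>UNIV. \<nu> i * (\<Sum>t=1..\<tau>. g i t)) - dual_const * (1 / \<eta> + \<eta> * real T)"
    by (simp add: sum_subtractf dual_const_def c_def algebra_simps)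
  finally show ?thesis using gain by linarith
qed

end

text \<open>Nonanticipation: the tie rule sees only restricted sequences, and the service of a
  period is read after its decision.\<close>

lemma cadl_state_cong:
  assumes "\<And>t. t \<in> {1..n} \<Longrightarrow> A t = A' t" "\<And>t. t \<in> {1..n} \<Longrightarrow> s t = s' t"
  shows "cadl_state T \<rho> \<alpha> \<eta> \<zeta> k A s n = cadl_state T \<rho> \<alpha> \<eta> \<zeta> k A' s' n"
  using assms
proof (induction n)
  case (Suc n)
  have "restrict A {1..Suc n} = restrict A' {1..Suc n}" "restrict s {1..<Suc n} = restrict s' {1..<Suc n}"
    using Suc.prems by (auto simp: restrict_def fun_eq_iff)
  moreover have "cadl_state T \<rho> \<alpha> \<eta> \<zeta> k A s n = cadl_state T \<rho> \<alpha> \<eta> \<zeta> k A' s' n"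
    using Suc by auto
  ultimately show ?case using Suc.prems by (simp add: cadl_choice_def)
qed simp

section \<open>The fluid relaxation\<close>

lemma borel_measurable_vec_iff:
  fixes f :: "'a \<Rightarrow> real^'n::finite"
  shows "f \<in> borel_measurable M \<longleftrightarrow> (\<forall>i. (\<lambda>x. f x $ i) \<in> borel_measurable M)"
proof
  assume f: "f \<in> borel_measurable M"
  show "\<forall>i. (\<lambda>x. f x $ i) \<in> borel_measurable M"
  proof
    fix i
    have "(\<lambda>x. f x \<bullet> axis i 1) \<in> borel_measurable M" using f by measurable
    then show "(\<lambda>x. f x $ i) \<in> borel_measurable M" by (simp add: inner_axis)
  qed
next
  assume "\<forall>i. (\<lambda>x. f x $ i) \<in> borel_measurable M"
  then show "f \<in> borel_measurable M"
    by (subst borel_measurable_euclidean_space) (auto simp: Basis_vec_def inner_axis)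
qed

lemma borel_measurable_vec_nth:
  fixes f :: "'a \<Rightarrow> real^'n::finite"
  shows "f \<in> borel_measurable M \<Longrightarrow> (\<lambda>x. f x $ i) \<in> borel_measurable M"
  using borel_measurable_vec_iff by blast

text \<open>There are finitely many candidate sets of maximizers, and each occurs on a finite
  intersection of closed sets, cut out by inequalities
  \<open>v \<bullet> y \<le> v \<bullet> z\<close>, and complements of such sets.\<close>

lemma best_vertices_measurable:
  "(best_vertices :: real^'n::finite \<Rightarrow> _) \<in> measurable borel (count_space (Pow vertices))"
proof (subst measurable_count_space_eq2)
  show "finite (Pow (vertices :: (real^'n) set))" by simp
  show "(best_vertices :: real^'n \<Rightarrow> _) \<in> space borel \<rightarrow> Pow vertices \<and>
    (\<forall>S\<in>Pow vertices. best_vertices -` {S} \<inter> space (borel :: (real^'n) measure) \<in> sets borel)"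
  proof (intro conjI ballI)
    show "(best_vertices :: real^'n \<Rightarrow> _) \<in> space borel \<rightarrow> Pow vertices" using best_vertices_subset by auto
    fix S :: "(real^'n) set"
    assume S: "S \<in> Pow vertices"
    define H :: "real^'n \<Rightarrow> (real^'n) set" where "H z = (\<Inter>y\<in>vertices. {v. v \<bullet> y \<le> v \<bullet> z})" for z
    have H: "H z \<in> sets borel" for z
      unfolding H_def by (intro borel_closed closed_INT ballI closed_Collect_le continuous_intros)
    define W :: "(real^'n) set" where "W = vertices"
    have W: "finite W" "W \<noteq> {}" by (auto simp: W_def)
    have best: "best_vertices v = {z \<in> W. v \<in> H z}" for v by (simp add: best_vertices_eq H_def W_def)
    have "best_vertices -` {S} \<inter> space borel = (\<Inter>z\<in>W. if z \<in> S then H z else - H z)" (is "_ = ?R")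
    proof (rule set_eqI)
      fix v
      have "best_vertices v = S \<longleftrightarrow> (\<forall>z\<in>W. z \<in> S \<longleftrightarrow> v \<in> H z)"
        using S unfolding best W_def[symmetric] by blast
      then show "v \<in> best_vertices -` {S} \<inter> space borel \<longleftrightarrow> v \<in> ?R" by auto
    qed
    also have "\<dots> \<in> sets borel" using H W by (intro sets.finite_INT) auto
    finally show "best_vertices -` {S} \<inter> space borel \<in> sets borel" .
  qed
qed

text \<open>A tie rule is measurable for each fixed set of tied maximizers; since only finitely many
  sets occur, the set may itself be random.\<close>

lemma measurable_best_vertices_select:
  fixes v :: "'a \<Rightarrow> real^'n::finite"
  assumes v: "v \<in> borel_measurable M" and f: "\<And>S. f S \<in> measurable M N"
  shows "(\<lambda>x. f (best_vertices (v x)) x) \<in> measurable M N"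
proof (rule measurable_compose_countable'[where I = "Pow vertices" and f = f and g = "\<lambda>x. best_vertices (v x)"])
  show "(\<lambda>x. best_vertices (v x)) \<in> measurable M (count_space (Pow vertices))"
    by (rule measurable_compose[OF v best_vertices_measurable])
  show "countable (Pow (vertices :: (real^'n) set))" by (intro countable_finite) simp
qed (rule f)

lemma measurable_case_free:
  fixes f g :: "'a \<Rightarrow> real^'n::finite" and j :: "'a \<Rightarrow> 'n option"
  assumes j: "j \<in> measurable M (count_space UNIV)" and g: "g \<in> borel_measurable M"
  shows "(\<lambda>x. case j x of None \<Rightarrow> g x | Some i \<Rightarrow> axis i 1) \<in> borel_measurable M"
proof (rule measurable_compose_countable'[where I = UNIV and f = "\<lambda>p x. case p of None \<Rightarrow> g x | Some i \<Rightarrow> axis i 1"])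
  show "(\<lambda>x. case p of None \<Rightarrow> g x | Some i \<Rightarrow> axis i 1) \<in> borel_measurable M" for p :: "'n option"
    using g by (cases p) auto
qed (use j in \<open>auto intro: countable_finite\<close>)

lemma abs_inner_action_le:
  fixes v :: "real^'n::finite"
  assumes y: "y \<in> actions j" and "\<And>i. \<bar>v $ i\<bar> \<le> M"
  shows "\<bar>v \<bullet> y\<bar> \<le> M"
proof -
  have M: "0 \<le> M" using assms(2) by (meson abs_ge_zero order_trans)
  have "y \<in> matching_simplex" using actions_component[OF y] by (auto simp: matching_simplex_def)
  from inner_simplex_le[OF this M, of v] inner_simplex_le[OF this M, of "- v"]
  show ?thesis using assms(2) by (auto simp: abs_le_iff)
qed

lemma convex_actions: "convex (actions j)"
proof (cases j)
  case None
  have "convex (matching_simplex :: (real^'n) set)"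
  proof (rule convexI)
    fix x y :: "real^'n" and u v :: real
    assume xy: "x \<in> matching_simplex" "y \<in> matching_simplex" and uv: "0 \<le> u" "0 \<le> v" "u + v = 1"
    have "(\<Sum>i\<in>UNIV. (u *\<^sub>R x + v *\<^sub>R y) $ i) = u * (\<Sum>i\<in>UNIV. x $ i) + v * (\<Sum>i\<in>UNIV. y $ i)"
      by (simp add: sum.distrib sum_distrib_left)
    also have "\<dots> \<le> u * 1 + v * 1"
      using xy uv by (intro add_mono mult_left_mono) (auto simp: matching_simplex_def)
    finally show "u *\<^sub>R x + v *\<^sub>R y \<in> matching_simplex"
      using xy uv by (auto simp: matching_simplex_def)
  qed
  with None show ?thesis by (simp add: actions_def)
qed (simp add: actions_def)

section \<open>Static policies under a case distribution\<close>

locale case_distribution = prob_space F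
  for F :: "('n::finite) case_type measure" +
  fixes \<rho> :: "real^'n" and d :: real
  assumes sets_F: "sets F = sets case_space"
    and rewards: "AE a in F. \<forall>i. 0 \<le> fst a $ i \<and> fst a $ i \<le> 1"
    and slack: "\<And>i. d \<le> \<rho> $ i - measure F {a \<in> space F. snd a = Some i}"
    and d_pos: "0 < d" and sum_\<rho>: "(\<Sum>i\<in>UNIV. \<rho> $ i) \<le> 1"
begin

definition tied :: "'n \<Rightarrow> real" where
  "tied i = measure F {a \<in> space F. snd a = Some i}"

lemma tied_bounds: "0 \<le> tied i" "tied i + d \<le> \<rho> $ i"
  using slack[of i] by (auto simp: tied_def)

lemma \<rho>_pos: "0 < \<rho> $ i" and \<rho>_le_1: "\<rho> $ i \<le> 1"
proof -
  show pos: "0 < \<rho> $ i" for i using tied_bounds[of i] d_pos by linarith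
  have "\<rho> $ i \<le> (\<Sum>i\<in>UNIV. \<rho> $ i)" using pos by (intro member_le_sum) (auto intro: less_imp_le)
  then show "\<rho> $ i \<le> 1" using sum_\<rho> by linarith
qed

lemma space_F: "space F = UNIV"
  using sets_eq_imp_space_eq[OF sets_F] by (simp add: case_space_def space_pair_measure)

lemma fst_measurable [measurable]: "fst \<in> measurable F borel"
  by (subst measurable_cong_sets[OF sets_F refl]) (simp add: case_space_def)

lemma snd_measurable [measurable]: "snd \<in> measurable F (count_space UNIV)"
  by (subst measurable_cong_sets[OF sets_F refl]) (simp add: case_space_def)

lemma reward_measurable [measurable]: "(\<lambda>a. fst a $ i) \<in> borel_measurable F"
  using fst_measurable borel_measurable_vec_iff by blast

text \<open>Static policies: the action depends on the case alone. Fractional actions stand in for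
  randomization, so that mixtures of policies are policies.\<close>

definition policies :: "('n case_type \<Rightarrow> real^'n) set" where
  "policies = {y \<in> borel_measurable F. \<forall>a. y a \<in> actions (snd a)}"

lemma policy_measurable: "y \<in> policies \<Longrightarrow> y \<in> borel_measurable F"
  and policy_action: "y \<in> policies \<Longrightarrow> y a \<in> actions (snd a)"
  unfolding policies_def by blast+

lemma policiesI: "y \<in> borel_measurable F \<Longrightarrow> (\<And>a. y a \<in> actions (snd a)) \<Longrightarrow> y \<in> policies"
  by (simp add: policies_def del: split_paired_All)

lemma policy_component_measurable: "y \<in> policies \<Longrightarrow> (\<lambda>a. y a $ i) \<in> borel_measurable F"
  using policy_measurable borel_measurable_vec_iff by blast

lemma integrable_policy_component:
  assumes "y \<in> policies"
  shows "integrable F (\<lambda>a. y a $ i)"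
  using actions_component[OF policy_action[OF assms]] policy_component_measurable[OF assms]
  by (intro integrable_const_bound[where B = 1]) auto

lemma AE_profit_bound:
  assumes "y \<in> policies"
  shows "AE a in F. \<bar>(fst a - \<mu>) \<bullet> y a\<bar> \<le> 1 + (\<Sum>i\<in>UNIV. \<bar>\<mu> $ i\<bar>)"
  using rewards
proof eventually_elim
  case (elim a)
  have "\<bar>\<mu> $ i\<bar> \<le> (\<Sum>i\<in>UNIV. \<bar>\<mu> $ i\<bar>)" for i by (intro member_le_sum) auto
  then have "\<bar>(fst a - \<mu>) $ i\<bar> \<le> 1 + (\<Sum>i\<in>UNIV. \<bar>\<mu> $ i\<bar>)" for i
    using elim by (smt (verit) vector_minus_component)
  then show ?case by (intro abs_inner_action_le[OF policy_action[OF assms]])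
qed

lemma integrable_profit:
  assumes "y \<in> policies"
  shows "integrable F (\<lambda>a. (fst a - \<mu>) \<bullet> y a)"
  using AE_profit_bound[OF assms, of \<mu>] policy_measurable[OF assms]
  by (intro integrable_const_bound[where B = "1 + (\<Sum>i\<in>UNIV. \<bar>\<mu> $ i\<bar>)"]) auto

lemma integrable_reward: "y \<in> policies \<Longrightarrow> integrable F (\<lambda>a. fst a \<bullet> y a)"
  using integrable_profit[of y 0] by simp

lemma expected_profit:
  assumes "y \<in> policies"
  shows "(\<integral>a. (fst a - \<mu>) \<bullet> y a \<partial>F) = (\<integral>a. fst a \<bullet> y a \<partial>F) - (\<Sum>i\<in>UNIV. \<mu> $ i * (\<integral>a. y a $ i \<partial>F))"
proof -
  have "(\<integral>a. (fst a - \<mu>) \<bullet> y a \<partial>F) = (\<integral>a. fst a \<bullet> y a - (\<Sum>i\<in>UNIV. \<mu> $ i * y a $ i) \<partial>F)"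
    by (simp add: inner_diff_left) (simp add: inner_vec_def)
  then show ?thesis
    using integrable_reward[OF assms] integrable_policy_component[OF assms] by simp
qed

lemma expected_reward_le_1:
  assumes "y \<in> policies"
  shows "(\<integral>a. fst a \<bullet> y a \<partial>F) \<le> 1"
proof -
  have "(\<integral>a. fst a \<bullet> y a \<partial>F) \<le> (\<integral>a. 1 \<partial>F)"
    using AE_profit_bound[OF assms, of 0] integrable_reward[OF assms]
    by (intro integral_mono_AE) auto
  then show ?thesis by (simp add: prob_space)
qed

text \<open>One fixed choice for each set of tied maximizers, so that measurability reduces to
  \<open>best_vertices_measurable\<close>.\<close>

definition best_policy :: "real^'n \<Rightarrow> 'n case_type \<Rightarrow> real^'n" where
  "best_policy \<mu> a = (case snd a of None \<Rightarrow> SOME z. z \<in> best_vertices (fst a - \<mu>) | Some i \<Rightarrow> axis i 1)"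

text \<open>The largest reward net of prices over the actions for the case; its expectation plus
  \<open>\<mu> \<bullet> \<rho>\<close> is the Lagrangian dual function of the fluid
  relaxation.\<close>

definition profit :: "real^'n \<Rightarrow> 'n case_type \<Rightarrow> real" where
  "profit \<mu> a = (fst a - \<mu>) \<bullet> best_policy \<mu> a"

lemma best_policy_free: "snd a = None \<Longrightarrow> best_policy \<mu> a \<in> best_vertices (fst a - \<mu>)"
  by (simp add: best_policy_def some_in_eq best_vertices_nonempty)

lemma best_policy_policies: "best_policy \<mu> \<in> policies"
proof -
  have "best_policy \<mu> a \<in> actions (snd a)" for a
  proof (cases "snd a")
    case None
    with best_policy_free[OF this, of \<mu>] show ?thesis
      using subsetD[OF vertices_subset_simplex subsetD[OF best_vertices_subset]] by (simp add: actions_def)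
  qed (simp add: actions_def best_policy_def)
  moreover have "(\<lambda>a. SOME z. z \<in> best_vertices (fst a - \<mu>)) \<in> borel_measurable F"
  proof (rule measurable_best_vertices_select[where f = "\<lambda>S _. SOME z. z \<in> S"])
    show "(\<lambda>a. fst a - \<mu>) \<in> borel_measurable F" by measurable
    show "(\<lambda>_. SOME z. z \<in> S) \<in> borel_measurable F" for S :: "(real^'n) set" by (rule measurable_const) simp
  qed
  then have "best_policy \<mu> \<in> borel_measurable F"
    unfolding best_policy_def by (intro measurable_case_free snd_measurable)
  ultimately show ?thesis by (rule policiesI[rotated])
qed

lemma profit_ge:
  assumes "y \<in> actions (snd a)"
  shows "(fst a - \<mu>) \<bullet> y \<le> profit \<mu> a"
  using assms best_policy_free[of a \<mu>]
  by (cases "snd a") (auto simp: actions_def best_vertices_def profit_def best_policy_def)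

lemma profit_tied: "snd a = Some i \<Longrightarrow> profit \<mu> a = fst a $ i - \<mu> $ i"
  by (simp add: profit_def best_policy_def inner_axis)

lemma integrable_profit_best: "integrable F (profit \<mu>)"
  unfolding profit_def by (intro integrable_profit best_policy_policies)

lemma tied_integrable: "integrable F (\<lambda>a. of_bool (snd a = Some i) :: real)"
  by (intro integrable_const_bound[where B = 1]) auto

lemma tied_eq: "(\<integral>a. of_bool (snd a = Some i) \<partial>F) = tied i"
proof -
  have "(\<integral>a. of_bool (snd a = Some i) \<partial>F) = (\<integral>a. indicat_real {a \<in> space F. snd a = Some i} a \<partial>F)"
    by (intro Bochner_Integration.integral_cong) (auto simp: indicator_def)
  also have "\<dots> = measure F ({a \<in> space F. snd a = Some i} \<inter> space F)" by (rule Bochner_Integration.integral_indicator)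
  also have "{a \<in> space F. snd a = Some i} \<inter> space F = {a \<in> space F. snd a = Some i}" by blast
  finally show ?thesis by (simp only: tied_def)
qed

definition tied_policy :: "'n case_type \<Rightarrow> real^'n" where
  "tied_policy a = (case snd a of None \<Rightarrow> 0 | Some i \<Rightarrow> axis i 1)"

lemma tied_policy_policies: "tied_policy \<in> policies"
proof -
  have "tied_policy a \<in> actions (snd a)" for a
    using vertices_subset_simplex by (auto simp: tied_policy_def actions_def split: option.splits)
  moreover have "tied_policy \<in> borel_measurable F"
    unfolding tied_policy_def by (intro measurable_case_free snd_measurable measurable_const) simp
  ultimately show ?thesis by (rule policiesI[rotated])
qed

lemma tied_policy_usage: "(\<integral>a. tied_policy a $ i \<partial>F) = tied i"
proof -
  have "tied_policy a $ i = of_bool (snd a = Some i)" for a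
    by (auto simp: tied_policy_def axis_def split: option.splits)
  then show ?thesis by (simp add: tied_eq)
qed

text \<open>Rewards are at most 1 almost everywhere, so at a free case an affiliate priced above 1
  earns a nonpositive net reward before and after truncation. Tied cases have no choice and save the
  price cut; they arrive at rate \<open>tied i\<close>.\<close>

lemma profit_truncate_prices:
  defines "trunc \<equiv> \<lambda>\<mu>::real^'n. \<chi> i. min (\<mu> $ i) 1"
  shows "(\<integral>a. profit (trunc \<mu>) a \<partial>F)
           \<le> (\<integral>a. profit \<mu> a \<partial>F) + (\<Sum>i\<in>UNIV. tied i * (\<mu> $ i - trunc \<mu> $ i))"
proof -
  have "(\<integral>a. profit (trunc \<mu>) a \<partial>F)
      \<le> (\<integral>a. profit \<mu> a + (\<Sum>i\<in>UNIV. of_bool (snd a = Some i) * (\<mu> $ i - trunc \<mu> $ i)) \<partial>F)"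
  proof (intro integral_mono_AE)
    show "AE a in F. profit (trunc \<mu>) a
        \<le> profit \<mu> a + (\<Sum>i\<in>UNIV. of_bool (snd a = Some i) * (\<mu> $ i - trunc \<mu> $ i))"
      using rewards
    proof eventually_elim
      case (elim a)
      show ?case
      proof (cases "snd a")
        case (Some i)
        then have "(\<Sum>j\<in>UNIV. of_bool (snd a = Some j) * (\<mu> $ j - trunc \<mu> $ j)) = \<mu> $ i - trunc \<mu> $ i"
          by (simp add: of_bool_def if_distrib[of "\<lambda>x. x * _"] cong: if_cong)
        then show ?thesis using Some by (simp add: profit_tied)
      next
        case None
        have ge: "(fst a - \<mu>) \<bullet> y \<le> profit \<mu> a" if "y \<in> vertices" for y
          using that vertices_subset_simplex None by (intro profit_ge) (auto simp: actions_def)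
        have ge_i: "fst a $ i - \<mu> $ i \<le> profit \<mu> a" for i
          using ge[of "axis i 1"] by (simp add: inner_axis)
        have ge_0: "0 \<le> profit \<mu> a" using ge[of 0] by simp
        have "fst a $ i - trunc \<mu> $ i \<le> profit \<mu> a" for i
        proof (cases "\<mu> $ i \<le> 1")
          case True
          then show ?thesis using ge_i[of i] by (simp add: trunc_def)
        next
          case False
          have "fst a $ i \<le> 1" using elim by simp
          with False ge_0 show ?thesis by (simp add: trunc_def)
        qed
        moreover have "best_policy (trunc \<mu>) a \<in> matching_simplex"
          using policy_action[OF best_policy_policies, of "trunc \<mu>" a] None by (simp add: actions_def)
        ultimately have "profit (trunc \<mu>) a \<le> profit \<mu> a"
          unfolding profit_def[of "trunc \<mu>"] using ge_0 by (intro inner_simplex_le) auto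
        then show ?thesis using None by simp
      qed
    qed
  qed (use integrable_profit_best tied_integrable in
      \<open>auto simp del: sum_of_bool_mult_eq sum_mult_of_bool_eq\<close>)
  also have "\<dots> = (\<integral>a. profit \<mu> a \<partial>F) + (\<Sum>i\<in>UNIV. tied i * (\<mu> $ i - trunc \<mu> $ i))"
    using integrable_profit_best tied_integrable
    by (simp add: tied_eq del: sum_of_bool_mult_eq sum_mult_of_bool_eq)
  finally show ?thesis .
qed

text \<open>Lagrangian duality for the fluid relaxation. The pairs (expected reward, expected usage) of
  policies form a convex set; the hyperplane separating it from the pairs that beat the fluid value
  \<open>V\<close> within the capacities yields the prices, and the policy serving only tied cases is the
  Slater point that makes the hyperplane non-vertical. Prices above \<open>1\<close> are pointless for free
  cases, so they can be truncated.\<close>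

lemma fluid_duality:
  obtains V :: real and \<mu> :: "real^'n" where
    "V \<le> 1" "\<And>i. 0 \<le> \<mu> $ i" "\<And>i. \<mu> $ i \<le> 1"
    "(\<integral>a. profit \<mu> a \<partial>F) \<le> V - \<mu> \<bullet> \<rho>"
    "\<And>\<delta>. 0 < \<delta> \<Longrightarrow> \<exists>y\<in>policies. (\<forall>i. (\<integral>a. y a $ i \<partial>F) \<le> \<rho> $ i) \<and> V - \<delta> < (\<integral>a. fst a \<bullet> y a \<partial>F)"
proof -
  define R where "R y = (\<integral>a. fst a \<bullet> y a \<partial>F)" for y
  define G :: "_ \<Rightarrow> real^'n" where "G y = (\<chi> i. \<integral>a. y a $ i \<partial>F)" for y
  define fluid where "fluid = {y \<in> policies. \<forall>i. G y $ i \<le> \<rho> $ i}"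
  define V where "V = Sup (R ` fluid)"
  have "tied_policy \<in> fluid"
    using tied_policy_policies tied_policy_usage tied_bounds d_pos
    by (auto simp: fluid_def G_def) (smt (verit))
  then have ne: "R ` fluid \<noteq> {}" by auto
  have R1: "R y \<le> 1" if "y \<in> policies" for y using expected_reward_le_1[OF that] by (simp add: R_def)
  then have bdd: "bdd_above (R ` fluid)" by (intro bdd_aboveI[of _ 1]) (auto simp: fluid_def)
  have V1: "V \<le> 1" unfolding V_def using R1 ne by (intro cSup_least) (auto simp: fluid_def)
  have R_le_V: "R y \<le> V" if "y \<in> fluid" for y unfolding V_def using that bdd by (intro cSup_upper) auto
  define P where "P = (\<lambda>y. (R y, G y)) ` policies"
  define Q :: "(real \<times> (real^'n)) set" where "Q = {(v, q). V < v \<and> (\<forall>i. q $ i \<le> \<rho> $ i)}"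
  have "convex P"
  proof (rule convexI)
    fix x x' u v assume x: "x \<in> P" "x' \<in> P" and uv: "0 \<le> u" "0 \<le> v" "u + v = (1::real)"
    from x obtain y y' where y: "y \<in> policies" "x = (R y, G y)" and y': "y' \<in> policies" "x' = (R y', G y')"
      by (auto simp: P_def)
    define yy where "yy a = u *\<^sub>R y a + v *\<^sub>R y' a" for a
    have "yy \<in> policies"
      unfolding yy_def
      using policy_measurable[OF y(1)] policy_measurable[OF y'(1)] uv
        convexD[OF convex_actions policy_action[OF y(1)] policy_action[OF y'(1)]]
      by (intro policiesI) auto
    moreover have "R yy = u * R y + v * R y'"
      using integrable_reward[OF y(1)] integrable_reward[OF y'(1)]
      by (simp add: R_def yy_def inner_add_right)
    moreover have "G yy = u *\<^sub>R G y + v *\<^sub>R G y'"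
      using integrable_policy_component[OF y(1)] integrable_policy_component[OF y'(1)]
      by (simp add: G_def yy_def vec_eq_iff)
    ultimately show "u *\<^sub>R x + v *\<^sub>R x' \<in> P" using y y' by (simp add: P_def image_iff) metis
  qed
  moreover have "convex Q"
  proof (rule convexI)
    fix x x' u v assume x: "x \<in> Q" "x' \<in> Q" and uv: "0 \<le> u" "0 \<le> v" "u + v = (1::real)"
    have "V < u * fst x + v * fst x'"
      using convexD[of "{V<..}" "fst x" "fst x'" u v] x uv by (auto simp: Q_def)
    moreover have "u * snd x $ i + v * snd x' $ i \<le> \<rho> $ i" for i
      using convexD[of "{..\<rho> $ i}" "snd x $ i" "snd x' $ i" u v] x uv by (auto simp: Q_def)
    ultimately show "u *\<^sub>R x + v *\<^sub>R x' \<in> Q" by (auto simp: Q_def case_prod_unfold)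
  qed
  moreover have "P \<noteq> {}" using tied_policy_policies by (auto simp: P_def)
  moreover have "(V + 1, \<rho>) \<in> Q" by (simp add: Q_def)
  then have "Q \<noteq> {}" by auto
  moreover have "P \<inter> Q = {}" using R_le_V by (fastforce simp: P_def Q_def fluid_def)
  ultimately obtain c \<beta> where c: "c \<noteq> 0" "\<forall>x\<in>P. c \<bullet> x \<le> \<beta>" "\<forall>x\<in>Q. \<beta> \<le> c \<bullet> x"
    using separating_hyperplane_sets by metis
  obtain c0 c1 where c01: "c = (c0, c1)" by (cases c)
  have cP: "c0 * R y + c1 \<bullet> G y \<le> \<beta>" if "y \<in> policies" for y
    using c(2) that by (auto simp: P_def c01)
  have cQ: "\<beta> \<le> c0 * v + c1 \<bullet> q" if "V < v" "\<And>i. q $ i \<le> \<rho> $ i" for v q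
    using c(3) that by (auto simp: Q_def c01)
  \<comment> \<open>A linear function bounded below on a ray cannot decrease along it. Applied to
    the directions in which \<open>Q\<close> is unbounded, larger value and smaller usage, this
    fixes the signs of \<open>c0\<close> and \<open>c1\<close>.\<close>
  have unbounded: "0 \<le> e" if "\<And>K::real. 0 \<le> K \<Longrightarrow> \<beta>' \<le> f + K * e" for \<beta>' e f :: real
  proof (rule ccontr)
    assume "\<not> 0 \<le> e"
    then have "e < 0" by simp
    have "\<beta>' \<le> f + ((\<bar>f\<bar> + \<bar>\<beta>'\<bar> + 1) / (- e)) * e"
      using \<open>e < 0\<close> by (intro that divide_nonneg_pos) auto
    then show False using \<open>e < 0\<close> by simp
  qed
  have c0: "0 \<le> c0"
  proof (rule unbounded)
    fix K :: real assume "0 \<le> K"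
    then show "\<beta> \<le> (c0 * (V + 1) + c1 \<bullet> \<rho>) + K * c0" using cQ[of "V + 1 + K" \<rho>] by (simp add: algebra_simps)
  qed
  have c1: "c1 $ i \<le> 0" for i
  proof -
    have "0 \<le> - c1 $ i"
    proof (rule unbounded)
      fix K :: real assume "0 \<le> K"
      then have "\<beta> \<le> c0 * (V + 1) + c1 \<bullet> (\<rho> - K *\<^sub>R axis i 1)"
        by (intro cQ) (auto simp: axis_def)
      then show "\<beta> \<le> (c0 * (V + 1) + c1 \<bullet> \<rho>) + K * (- c1 $ i)" by (simp add: inner_diff_right inner_axis)
    qed
    then show ?thesis by simp
  qed
  \<comment> \<open>A vertical hyperplane would give
    \<open>c1 \<bullet> G tied_policy \<le> c1 \<bullet> \<rho>\<close>; as no component of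
    \<open>c1\<close> is positive and the tied policy stays strictly below every
    \<open>\<rho> $ i\<close>, this forces \<open>c1 = 0\<close>.\<close>
  have "c0 \<noteq> 0"
  proof
    assume "c0 = 0"
    have "c1 \<bullet> G tied_policy \<le> c1 \<bullet> \<rho>"
      using cP[OF tied_policy_policies] cQ[of "V + 1" \<rho>] \<open>c0 = 0\<close> by simp
    then have "(\<Sum>i\<in>UNIV. - c1 $ i * (\<rho> $ i - tied i)) \<le> 0"
      by (simp add: inner_vec_def G_def tied_policy_usage algebra_simps sum_subtractf)
    moreover have nonneg: "0 \<le> - c1 $ i * (\<rho> $ i - tied i)" for i
      using c1[of i] tied_bounds[of i] d_pos by (intro mult_nonneg_nonneg) auto
    ultimately have "(\<Sum>i\<in>UNIV. - c1 $ i * (\<rho> $ i - tied i)) = 0"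
      by (intro antisym sum_nonneg) auto
    then have "\<forall>i\<in>UNIV. - c1 $ i * (\<rho> $ i - tied i) = 0"
      using nonneg by (subst (asm) sum_nonneg_eq_0_iff) auto
    moreover have "\<rho> $ i - tied i \<noteq> 0" for i using tied_bounds[of i] d_pos by linarith
    ultimately have "c1 = 0" by (auto simp: vec_eq_iff)
    with \<open>c0 = 0\<close> c(1) c01 show False by (simp add: zero_prod_def)
  qed
  with c0 have c0_pos: "0 < c0" by simp
  define \<nu> where "\<nu> = - (1 / c0) *\<^sub>R c1"
  have \<nu>_nonneg: "0 \<le> \<nu> $ i" for i using c1[of i] c0_pos by (simp add: \<nu>_def divide_nonpos_pos)
  have dual: "R y - \<nu> \<bullet> G y \<le> V - \<nu> \<bullet> \<rho>" if y: "y \<in> policies" for y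
  \<comment> \<open>\<open>Q\<close> excludes the value \<open>V\<close> itself, so the bound is
    first proved with \<open>V + e\<close>.\<close>
  proof (rule field_le_epsilon)
    fix e :: real assume "0 < e"
    then have "c0 * R y + c1 \<bullet> G y \<le> c0 * (V + e) + c1 \<bullet> \<rho>" using cP[OF y] cQ[of "V + e" \<rho>] by simp
    then have "(c0 * R y + c1 \<bullet> G y) / c0 \<le> (c0 * (V + e) + c1 \<bullet> \<rho>) / c0"
      using c0_pos by (intro divide_right_mono) auto
    then show "R y - \<nu> \<bullet> G y \<le> V - \<nu> \<bullet> \<rho> + e" using c0_pos by (simp add: \<nu>_def add_divide_distrib)
  qed
  define \<mu> :: "real^'n" where "\<mu> = (\<chi> i. min (\<nu> $ i) 1)"
  have "(\<integral>a. profit \<nu> a \<partial>F) = R (best_policy \<nu>) - \<nu> \<bullet> G (best_policy \<nu>)"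
    unfolding profit_def expected_profit[OF best_policy_policies] by (simp add: R_def G_def inner_vec_def)
  also have "\<dots> \<le> V - \<nu> \<bullet> \<rho>" by (rule dual[OF best_policy_policies])
  finally have "(\<integral>a. profit \<mu> a \<partial>F) \<le> V - \<nu> \<bullet> \<rho> + (\<Sum>i\<in>UNIV. tied i * (\<nu> $ i - \<mu> $ i))"
    using profit_truncate_prices[of \<nu>] by (simp add: \<mu>_def)
  \<comment> \<open>Per unit of price cut, truncation adds at most \<open>tied i\<close> to the
    profit but takes \<open>\<rho> $ i \<ge> tied i\<close> off the price of the capacities, so the
    dual bound survives.\<close>
  also have "(\<Sum>i\<in>UNIV. tied i * (\<nu> $ i - \<mu> $ i)) \<le> (\<Sum>i\<in>UNIV. \<rho> $ i * (\<nu> $ i - \<mu> $ i))"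
  proof (intro sum_mono mult_right_mono)
    show "tied i \<le> \<rho> $ i" for i using tied_bounds(2)[of i] d_pos by linarith
  qed (simp add: \<mu>_def)
  finally have profit_\<mu>: "(\<integral>a. profit \<mu> a \<partial>F) \<le> V - \<mu> \<bullet> \<rho>"
    by (simp add: inner_vec_def algebra_simps sum_subtractf)
  have attained: "\<exists>y\<in>policies. (\<forall>i. (\<integral>a. y a $ i \<partial>F) \<le> \<rho> $ i) \<and> V - \<delta> < (\<integral>a. fst a \<bullet> y a \<partial>F)"
    if "0 < \<delta>" for \<delta>
  proof -
    have "V - \<delta> < Sup (R ` fluid)" using that by (simp add: V_def)
    then obtain y where "y \<in> fluid" "V - \<delta> < R y" using less_cSup_iff[OF ne bdd] by auto
    then show ?thesis by (auto simp: fluid_def G_def R_def)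
  qed
  show ?thesis by (rule that[of V \<mu>]) (use V1 profit_\<mu> attained \<nu>_nonneg in \<open>auto simp: \<mu>_def\<close>)
qed

end

section \<open>Resampling a coordinate\<close>

text \<open>Redrawing part of the outcome by \<open>\<Phi>\<close> preserves the distribution. A variable that ignores
  the redrawn part is then uncorrelated with one that depends on nothing else; this replaces
  independence of the past and the current period throughout.\<close>

definition resamples :: "'a measure \<Rightarrow> 'b measure \<Rightarrow> ('a \<Rightarrow> 'b \<Rightarrow> 'a) \<Rightarrow> bool" where
  "resamples M N \<Phi> \<longleftrightarrow>
     case_prod \<Phi> \<in> measurable (M \<Otimes>\<^sub>M N) M \<and>
     (\<forall>f\<in>borel_measurable M. (\<integral>\<^sup>+x. f x \<partial>M) = (\<integral>\<^sup>+x. \<integral>\<^sup>+y. (f (\<Phi> x y) :: ennreal) \<partial>N \<partial>M))"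

lemma resamples_measurable: "resamples M N \<Phi> \<Longrightarrow> case_prod \<Phi> \<in> measurable (M \<Otimes>\<^sub>M N) M"
  and resamples_nn_integral: "resamples M N \<Phi> \<Longrightarrow> f \<in> borel_measurable M \<Longrightarrow>
    (\<integral>\<^sup>+x. \<integral>\<^sup>+y. (f (\<Phi> x y) :: ennreal) \<partial>N \<partial>M) = (\<integral>\<^sup>+x. f x \<partial>M)"
  by (auto simp: resamples_def)

text \<open>The coordinate \<open>t\<close> is split off the product; the value it had before the
  redraw integrates out with total mass 1.\<close>

lemma resamples_PiM:
  assumes N: "\<And>i. prob_space (N i)" and I: "finite I" "t \<in> I"
  shows "resamples (PiM I N) (N t) (\<lambda>x y. x(t := y))"
proof -
  interpret product_sigma_finite N
    using N by (simp add: product_sigma_finite_def prob_space_imp_sigma_finite)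
  define J where "J = I - {t}"
  have J: "finite J" "t \<notin> J" "I = insert t J" using I by (auto simp: J_def)
  have meas: "(\<lambda>(x, y). x(t := y)) \<in> measurable (PiM I N \<Otimes>\<^sub>M N t) (PiM I N)"
  proof -
    have "(\<lambda>p. (fst p)(t := snd p)) \<in> measurable (PiM I N \<Otimes>\<^sub>M N t) (PiM I N)"
      by (rule measurable_fun_upd[where J = I]) (use I in auto)
    then show ?thesis by (simp add: case_prod_unfold)
  qed
  have "(\<integral>\<^sup>+x. f x \<partial>PiM I N) = (\<integral>\<^sup>+x. \<integral>\<^sup>+y. f (x(t := y)) \<partial>N t \<partial>PiM I N)"
    if f: "f \<in> borel_measurable (PiM I N)" for f :: "_ \<Rightarrow> ennreal"
  proof -
    have "(\<lambda>p. f ((fst p)(t := snd p))) \<in> borel_measurable (PiM I N \<Otimes>\<^sub>M N t)"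
      using measurable_compose[OF meas f] by (simp add: case_prod_unfold)
    then have g: "(\<lambda>x. \<integral>\<^sup>+y. f (x(t := y)) \<partial>N t) \<in> borel_measurable (PiM I N)"
      using sigma_finite_measure.borel_measurable_nn_integral_fst[OF prob_space_imp_sigma_finite[OF N],
          of "\<lambda>p. f ((fst p)(t := snd p))" "PiM I N"] by simp
    have "(\<integral>\<^sup>+x. \<integral>\<^sup>+y. f (x(t := y)) \<partial>N t \<partial>PiM I N)
        = (\<integral>\<^sup>+x. \<integral>\<^sup>+y'. \<integral>\<^sup>+y. f (x(t := y', t := y)) \<partial>N t \<partial>N t \<partial>PiM J N)"
      using product_nn_integral_insert[OF J(1,2) g[unfolded J(3)]] by (simp add: J(3))
    also have "\<dots> = (\<integral>\<^sup>+x. \<integral>\<^sup>+y. f (x(t := y)) \<partial>N t \<partial>PiM J N)"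
      by (simp add: prob_space.emeasure_space_1[OF N])
    also have "\<dots> = (\<integral>\<^sup>+x. f x \<partial>PiM I N)"
      using product_nn_integral_insert[OF J(1,2) f[unfolded J(3)]] by (simp add: J(3))
    finally show ?thesis by simp
  qed
  with meas show ?thesis unfolding resamples_def by blast
qed

lemma resamples_snd:
  assumes L: "sigma_finite_measure L" and M: "sigma_finite_measure M" and N: "sigma_finite_measure N"
    and \<Phi>: "resamples M N \<Phi>"
  shows "resamples (L \<Otimes>\<^sub>M M) N (\<lambda>x y. (fst x, \<Phi> (snd x) y))"
proof -
  interpret M: sigma_finite_measure M by fact
  interpret N: sigma_finite_measure N by fact
  have [measurable]: "case_prod \<Phi> \<in> measurable (M \<Otimes>\<^sub>M N) M" using \<Phi> by (rule resamples_measurable)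
  have "(\<lambda>p. (fst (fst p), case_prod \<Phi> (snd (fst p), snd p))) \<in> measurable ((L \<Otimes>\<^sub>M M) \<Otimes>\<^sub>M N) (L \<Otimes>\<^sub>M M)"
    by measurable
  then have meas: "case_prod (\<lambda>x y. (fst x, \<Phi> (snd x) y)) \<in> measurable ((L \<Otimes>\<^sub>M M) \<Otimes>\<^sub>M N) (L \<Otimes>\<^sub>M M)"
    by (simp add: case_prod_unfold)
  have "(\<integral>\<^sup>+x. f x \<partial>(L \<Otimes>\<^sub>M M)) = (\<integral>\<^sup>+x. \<integral>\<^sup>+y. f (fst x, \<Phi> (snd x) y) \<partial>N \<partial>(L \<Otimes>\<^sub>M M))"
    if f [measurable]: "f \<in> borel_measurable (L \<Otimes>\<^sub>M M)" for f :: "_ \<Rightarrow> ennreal"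
  proof -
    have "(\<lambda>p. f (fst (fst p), \<Phi> (snd (fst p)) (snd p))) \<in> borel_measurable ((L \<Otimes>\<^sub>M M) \<Otimes>\<^sub>M N)"
      using measurable_compose[OF meas f] by (simp add: case_prod_unfold)
    from N.borel_measurable_nn_integral_fst[OF this]
    have g: "(\<lambda>x. \<integral>\<^sup>+y. f (fst x, \<Phi> (snd x) y) \<partial>N) \<in> borel_measurable (L \<Otimes>\<^sub>M M)" by simp
    have "(\<integral>\<^sup>+x. \<integral>\<^sup>+y. f (fst x, \<Phi> (snd x) y) \<partial>N \<partial>(L \<Otimes>\<^sub>M M))
        = (\<integral>\<^sup>+v. \<integral>\<^sup>+x. \<integral>\<^sup>+y. f (v, \<Phi> x y) \<partial>N \<partial>M \<partial>L)"
      by (subst M.nn_integral_fst[OF g, symmetric]) simp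
    also have "\<dots> = (\<integral>\<^sup>+v. \<integral>\<^sup>+x. f (v, x) \<partial>M \<partial>L)"
      by (intro nn_integral_cong resamples_nn_integral[OF \<Phi>, of "\<lambda>x. f (_, x)"]) measurable
    also have "\<dots> = (\<integral>\<^sup>+x. f x \<partial>(L \<Otimes>\<^sub>M M))" by (rule M.nn_integral_fst[OF f])
    finally show ?thesis by simp
  qed
  with meas show ?thesis unfolding resamples_def by blast
qed

text \<open>Here the redraw is nested inside the integral over the other factor \<open>L\<close>, so
  the two are exchanged by Fubini before the resampling property of \<open>M\<close>
  applies.\<close>

lemma resamples_fst:
  assumes L: "sigma_finite_measure L" and M: "sigma_finite_measure M" and N: "sigma_finite_measure N"
    and \<Phi>: "resamples M N \<Phi>"
  shows "resamples (M \<Otimes>\<^sub>M L) N (\<lambda>x y. (\<Phi> (fst x) y, snd x))"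
proof -
  interpret L: sigma_finite_measure L by fact
  interpret N: sigma_finite_measure N by fact
  interpret LN: pair_sigma_finite L N by (simp add: pair_sigma_finite_def L N)
  have [measurable]: "case_prod \<Phi> \<in> measurable (M \<Otimes>\<^sub>M N) M" using \<Phi> by (rule resamples_measurable)
  have "(\<lambda>p. (case_prod \<Phi> (fst (fst p), snd p), snd (fst p))) \<in> measurable ((M \<Otimes>\<^sub>M L) \<Otimes>\<^sub>M N) (M \<Otimes>\<^sub>M L)"
    by measurable
  then have meas: "case_prod (\<lambda>x y. (\<Phi> (fst x) y, snd x)) \<in> measurable ((M \<Otimes>\<^sub>M L) \<Otimes>\<^sub>M N) (M \<Otimes>\<^sub>M L)"
    by (simp add: case_prod_unfold)
  have "(\<integral>\<^sup>+x. f x \<partial>(M \<Otimes>\<^sub>M L)) = (\<integral>\<^sup>+x. \<integral>\<^sup>+y. f (\<Phi> (fst x) y, snd x) \<partial>N \<partial>(M \<Otimes>\<^sub>M L))"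
    if f [measurable]: "f \<in> borel_measurable (M \<Otimes>\<^sub>M L)" for f :: "_ \<Rightarrow> ennreal"
  proof -
    have F: "(\<lambda>p. f (\<Phi> (fst (fst p)) (snd p), snd (fst p))) \<in> borel_measurable ((M \<Otimes>\<^sub>M L) \<Otimes>\<^sub>M N)"
      using measurable_compose[OF meas f] by (simp add: case_prod_unfold)
    from N.borel_measurable_nn_integral_fst[OF this]
    have g: "(\<lambda>x. \<integral>\<^sup>+y. f (\<Phi> (fst x) y, snd x) \<partial>N) \<in> borel_measurable (M \<Otimes>\<^sub>M L)" by simp
    have h: "(\<lambda>x. \<integral>\<^sup>+v. f (x, v) \<partial>L) \<in> borel_measurable M"
      by (rule L.borel_measurable_nn_integral_fst[OF f])
    have "(\<integral>\<^sup>+x. \<integral>\<^sup>+y. f (\<Phi> (fst x) y, snd x) \<partial>N \<partial>(M \<Otimes>\<^sub>M L))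
        = (\<integral>\<^sup>+x. \<integral>\<^sup>+v. \<integral>\<^sup>+y. f (\<Phi> x y, v) \<partial>N \<partial>L \<partial>M)"
      by (subst L.nn_integral_fst[OF g, symmetric]) simp
    also have "\<dots> = (\<integral>\<^sup>+x. \<integral>\<^sup>+y. \<integral>\<^sup>+v. f (\<Phi> x y, v) \<partial>L \<partial>N \<partial>M)"
    proof (intro nn_integral_cong)
      fix x assume x: "x \<in> space M"
      have "(\<lambda>q. ((x, fst q), snd q)) \<in> measurable (L \<Otimes>\<^sub>M N) ((M \<Otimes>\<^sub>M L) \<Otimes>\<^sub>M N)"
        using x by measurable
      from measurable_compose[OF this F]
      have "(\<lambda>(v, y). f (\<Phi> x y, v)) \<in> borel_measurable (L \<Otimes>\<^sub>M N)" by (simp add: case_prod_unfold)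
      from LN.Fubini'[OF this]
      show "(\<integral>\<^sup>+v. \<integral>\<^sup>+y. f (\<Phi> x y, v) \<partial>N \<partial>L) = (\<integral>\<^sup>+y. \<integral>\<^sup>+v. f (\<Phi> x y, v) \<partial>L \<partial>N)" by simp
    qed
    also have "\<dots> = (\<integral>\<^sup>+x. \<integral>\<^sup>+v. f (x, v) \<partial>L \<partial>M)"
      by (rule resamples_nn_integral[OF \<Phi> h])
    also have "\<dots> = (\<integral>\<^sup>+x. f x \<partial>(M \<Otimes>\<^sub>M L))" by (rule L.nn_integral_fst[OF f])
    finally show ?thesis by simp
  qed
  with meas show ?thesis unfolding resamples_def by blast
qed

text \<open>\<open>M\<close> is the image of the product of \<open>M\<close> and \<open>N\<close>
  under \<Phi>, and there the integrand becomes \<open>X\<close> of the first component times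
  \<open>h\<close> of the second. \<open>h\<close> is integrable rather than bounded because rewards
  are bounded only almost everywhere.\<close>

lemma expectation_mult_resample:
  fixes X Y :: "'a \<Rightarrow> real" and h :: "'b \<Rightarrow> real"
  assumes M: "prob_space M" and N: "prob_space N" and \<Phi>: "resamples M N \<Phi>"
    and X: "X \<in> borel_measurable M" "\<And>x. \<bar>X x\<bar> \<le> B"
    and X_inv: "\<And>x y. X (\<Phi> x y) = X x"
    and Y: "Y \<in> borel_measurable M" "\<And>x y. Y (\<Phi> x y) = h y"
    and h: "integrable N h"
  shows "(\<integral>x. X x * Y x \<partial>M) = (\<integral>x. X x \<partial>M) * (\<integral>y. h y \<partial>N)" "integrable M (\<lambda>x. X x * Y x)"
proof -
  interpret M: prob_space M by fact
  interpret N: prob_space N by fact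
  interpret MN: pair_sigma_finite M N
    by (simp add: pair_sigma_finite_def M.sigma_finite_measure_axioms N.sigma_finite_measure_axioms)
  note \<Phi>_meas = resamples_measurable[OF \<Phi>]
  have distr: "distr (M \<Otimes>\<^sub>M N) M (case_prod \<Phi>) = M"
  proof (rule measure_eqI)
    fix S assume "S \<in> sets (distr (M \<Otimes>\<^sub>M N) M (case_prod \<Phi>))"
    then have S: "S \<in> sets M" by simp
    have "emeasure (distr (M \<Otimes>\<^sub>M N) M (case_prod \<Phi>)) S
        = (\<integral>\<^sup>+p. indicator S p \<partial>distr (M \<Otimes>\<^sub>M N) M (case_prod \<Phi>))" using S by simp
    also have "\<dots> = (\<integral>\<^sup>+p. indicator S (case_prod \<Phi> p) \<partial>(M \<Otimes>\<^sub>M N))"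
      using S by (intro nn_integral_distr[OF \<Phi>_meas]) simp
    also have "\<dots> = (\<integral>\<^sup>+x. \<integral>\<^sup>+y. indicator S (\<Phi> x y) \<partial>N \<partial>M)"
    proof -
      have "(\<lambda>p. indicator S (case_prod \<Phi> p) :: ennreal) \<in> borel_measurable (M \<Otimes>\<^sub>M N)"
        using S by (intro measurable_compose[OF \<Phi>_meas]) simp
      from N.nn_integral_fst[OF this] show ?thesis by simp
    qed
    also have "\<dots> = (\<integral>\<^sup>+x. indicator S x \<partial>M)" using S by (intro resamples_nn_integral[OF \<Phi>]) simp
    finally show "emeasure (distr (M \<Otimes>\<^sub>M N) M (case_prod \<Phi>)) S = emeasure M S" using S by simp
  qed simp
  have [measurable]: "X \<in> borel_measurable M" "h \<in> borel_measurable N" using X h by auto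
  have bound: "norm (X x * h y) \<le> B * norm (h y)" for x y
    using X(2)[of x] by (simp add: abs_mult mult_right_mono)
  have int: "integrable (M \<Otimes>\<^sub>M N) (\<lambda>p. X (fst p) * h (snd p))"
  proof (rule MN.Fubini_integrable)
    show "(\<lambda>p. X (fst p) * h (snd p)) \<in> borel_measurable (M \<Otimes>\<^sub>M N)" by measurable
    have "(\<lambda>x. \<bar>X x\<bar> * (\<integral>y. \<bar>h y\<bar> \<partial>N)) \<in> borel_measurable M" by measurable
    then show "integrable M (\<lambda>x. \<integral>y. norm (X (fst (x, y)) * h (snd (x, y))) \<partial>N)"
      using X(2) by (intro M.integrable_const_bound[where B = "B * (\<integral>y. \<bar>h y\<bar> \<partial>N)"])
        (auto simp: abs_mult intro!: mult_right_mono integral_nonneg_AE)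
    show "AE x in M. integrable N (\<lambda>y. X (fst (x, y)) * h (snd (x, y)))" using h by simp
  qed
  have eq: "(\<lambda>p. X (case_prod \<Phi> p) * Y (case_prod \<Phi> p)) = (\<lambda>p. X (fst p) * h (snd p))"
    by (auto simp: X_inv Y)
  have XY: "(\<lambda>x. X x * Y x) \<in> borel_measurable M" using X(1) Y(1) by measurable
  have "(\<integral>x. X x * Y x \<partial>M) = (\<integral>p. X (case_prod \<Phi> p) * Y (case_prod \<Phi> p) \<partial>(M \<Otimes>\<^sub>M N))"
    using integral_distr[OF \<Phi>_meas XY] by (simp add: distr)
  also have "\<dots> = (\<integral>p. X (fst p) * h (snd p) \<partial>(M \<Otimes>\<^sub>M N))" by (simp add: eq)
  also have "\<dots> = (\<integral>x. \<integral>y. X x * h y \<partial>N \<partial>M)"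
    using MN.integral_fst'[OF int] by simp
  also have "\<dots> = (\<integral>x. X x \<partial>M) * (\<integral>y. h y \<partial>N)" by simp
  finally show "(\<integral>x. X x * Y x \<partial>M) = (\<integral>x. X x \<partial>M) * (\<integral>y. h y \<partial>N)" .
  show "integrable M (\<lambda>x. X x * Y x)"
    using integrable_distr_eq[OF \<Phi>_meas XY] int by (simp add: distr eq)
qed

lemma service_expectation:
  fixes r :: "real^'n::finite"
  assumes "0 < r $ i" "r $ i < 1"
  shows "(\<integral>v. (of_bool (v i) :: real) \<partial>measure_pmf (service_dist r)) = r $ i"
proof -
  have "(\<integral>v. (of_bool (v i) :: real) \<partial>measure_pmf (service_dist r))
      = (\<integral>x. of_bool x \<partial>measure_pmf (map_pmf (\<lambda>v. v i) (service_dist r)))"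
    by (simp only: integral_map_pmf)
  also have "\<dots> = r $ i" using assms by (simp add: service_dist_def Pi_pmf_component)
  finally show ?thesis .
qed

section \<open>Expected performance\<close>

locale cadl_instance = case_distribution F \<rho> d
  for F :: "('n::finite) case_type measure" and \<rho> :: "real^'n" and d :: real +
  fixes T :: nat and \<alpha> \<gamma> \<eta> \<zeta> \<epsilon> :: real and r :: "real^'n"
    and U :: "'u measure" and \<kappa> :: "'u \<Rightarrow> 'n tie_rule"
  assumes T_pos: "0 < T"
    and \<alpha>_nonneg: "0 \<le> \<alpha>" and \<gamma>_nonneg: "0 \<le> \<gamma>" and \<epsilon>_pos: "0 < \<epsilon>"
    and \<eta>: "0 < \<eta>" "\<eta> \<le> 1" and \<zeta>_pos: "0 < \<zeta>"
    and r: "\<And>i. 0 < r $ i" "\<And>i. r $ i < 1" "\<And>i. \<rho> $ i + \<epsilon> \<le> r $ i"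
    and tie: "tie_breaking U \<kappa>"
begin

abbreviation arrivals :: "'u \<times> (nat \<Rightarrow> 'n case_type) \<times> (nat \<Rightarrow> 'n \<Rightarrow> bool) \<Rightarrow> nat \<Rightarrow> 'n case_type" where
  "arrivals \<omega> \<equiv> fst (snd \<omega>)"

abbreviation services :: "'u \<times> (nat \<Rightarrow> 'n case_type) \<times> (nat \<Rightarrow> 'n \<Rightarrow> bool) \<Rightarrow> nat \<Rightarrow> 'n \<Rightarrow> bool" where
  "services \<omega> \<equiv> snd (snd \<omega>)"

sublocale P: cadl_path T \<rho> \<alpha> \<eta> \<zeta> "\<kappa> (fst \<omega>)" "arrivals \<omega>" "services \<omega>" for \<omega>
proof
  show "S \<noteq> {} \<Longrightarrow> S \<subseteq> vertices \<Longrightarrow> \<kappa> (fst \<omega>) t A s S \<in> S" for t A s S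
    using tie by (simp add: tie_breaking_def)
qed (use \<rho>_pos \<rho>_le_1 \<alpha>_nonneg \<eta> \<zeta>_pos in auto)

definition runs :: "('u \<times> (nat \<Rightarrow> 'n case_type) \<times> (nat \<Rightarrow> 'n \<Rightarrow> bool)) measure" where
  "runs = sample_space T U F r"

abbreviation mean :: "('u \<times> (nat \<Rightarrow> 'n case_type) \<times> (nat \<Rightarrow> 'n \<Rightarrow> bool) \<Rightarrow> real) \<Rightarrow> real" where
  "mean f \<equiv> integral\<^sup>L runs f"

lemma prob_space_U: "prob_space U"
  using tie by (simp add: tie_breaking_def)

lemma prob_space_cases: "prob_space (PiM {1..T} (\<lambda>_. F))"
  by (intro prob_space_PiM) (rule prob_space_axioms)

lemma prob_space_services: "prob_space (PiM {1..T} (\<lambda>_. measure_pmf (service_dist r)))"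
  by (intro prob_space_PiM) (rule measure_pmf.prob_space_axioms)

sublocale O: prob_space runs
  unfolding runs_def sample_space_def
  by (intro prob_space_pair prob_space_U prob_space_cases prob_space_services)

section \<open>Measurability of states and decisions\<close>

lemma case_measurable: "t \<in> {1..T} \<Longrightarrow> (\<lambda>\<omega>. arrivals \<omega> t) \<in> measurable runs F"
  unfolding runs_def sample_space_def
  by (rule measurable_compose[OF _ measurable_component_singleton]) measurable

lemma service_measurable: "t \<in> {1..T} \<Longrightarrow> (\<lambda>\<omega>. services \<omega> t) \<in> measurable runs (count_space UNIV)"
proof -
  assume t: "t \<in> {1..T}"
  have "(\<lambda>\<omega>. services \<omega> t) \<in> measurable runs (measure_pmf (service_dist r))"
    unfolding runs_def sample_space_def
    by (rule measurable_compose[OF _ measurable_component_singleton[OF t]]) measurable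
  then show ?thesis by (simp cong: measurable_cong_sets)
qed

lemma service_component_measurable:
  "t \<in> {1..T} \<Longrightarrow> (\<lambda>\<omega>. of_bool (services \<omega> t i) :: real) \<in> borel_measurable runs"
  by (rule measurable_compose[OF service_measurable, where g = "\<lambda>v. of_bool (v i) :: real"]) auto

lemma tie_measurable:
  assumes "t \<le> T"
  shows "(\<lambda>\<omega>. \<kappa> (fst \<omega>) t (restrict (arrivals \<omega>) {1..t}) (restrict (services \<omega>) {1..<t}) S)
           \<in> borel_measurable runs"
proof -
  have 1: "(\<lambda>\<omega>. restrict (arrivals \<omega>) {1..t}) \<in> measurable runs (PiM {1..t} (\<lambda>_. case_space))"
  proof (rule measurable_restrict)
    fix i assume "i \<in> {1..t}"
    then have "(\<lambda>\<omega>. arrivals \<omega> i) \<in> measurable runs F" using assms by (intro case_measurable) auto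
    then show "(\<lambda>\<omega>. arrivals \<omega> i) \<in> measurable runs case_space"
      using measurable_cong_sets[OF refl sets_F] by blast
  qed
  have 2: "(\<lambda>\<omega>. restrict (services \<omega>) {1..<t}) \<in> measurable runs (PiM {1..<t} (\<lambda>_. count_space UNIV))"
    using assms by (intro measurable_restrict service_measurable) auto
  have 3: "fst \<in> measurable runs U" unfolding runs_def sample_space_def by measurable
  have "(\<lambda>(u, A, s). \<kappa> u t A s S) \<in> borel_measurable
        (U \<Otimes>\<^sub>M (PiM {1..t} (\<lambda>_. case_space) \<Otimes>\<^sub>M PiM {1..<t} (\<lambda>_. count_space UNIV)))"
    using tie by (simp add: tie_breaking_def)
  from measurable_compose[OF measurable_Pair[OF 3 measurable_Pair[OF 1 2]] this]
  show ?thesis by simp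
qed

text \<open>Stated relative to the measurability of the preceding state, so that the induction in
  \<open>state_measurable\<close> can use it.\<close>

lemma match_measurable_aux:
  assumes t: "t \<in> {1..T}"
    and "(\<lambda>\<omega>. theta (P.st \<omega> (t - 1))) \<in> borel_measurable runs"
    and "(\<lambda>\<omega>. lam (P.st \<omega> (t - 1))) \<in> borel_measurable runs"
    and "(\<lambda>\<omega>. cap (P.st \<omega> (t - 1))) \<in> borel_measurable runs"
    and "(\<lambda>\<omega>. backlog (P.st \<omega> (t - 1))) \<in> borel_measurable runs"
  shows "(\<lambda>\<omega>. P.z \<omega> t) \<in> borel_measurable runs"
proof -
  note [measurable] = case_measurable[OF t] assms(2-5)
  define v where "v \<omega> = fst (arrivals \<omega> t) - theta (P.st \<omega> (t - 1)) - lam (P.st \<omega> (t - 1))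
      - \<zeta> *\<^sub>R backlog (P.st \<omega> (t - 1))" for \<omega>
  have v: "v \<in> borel_measurable runs" unfolding v_def by measurable
  define k where "k \<omega> S = \<kappa> (fst \<omega>) t (restrict (arrivals \<omega>) {1..t}) (restrict (services \<omega>) {1..<t}) S" for \<omega> S
  have sel: "(\<lambda>\<omega>. k \<omega> (best_vertices (v \<omega>))) \<in> borel_measurable runs"
  proof (rule measurable_best_vertices_select[where f = "\<lambda>S \<omega>. k \<omega> S", OF v])
    show "(\<lambda>\<omega>. k \<omega> S) \<in> borel_measurable runs" for S unfolding k_def using t by (intro tie_measurable) simp
  qed
  have cap: "(\<lambda>\<omega>. cap (P.st \<omega> (t - 1)) $ i) \<in> borel_measurable runs" for i
    using assms(4) by (rule borel_measurable_vec_nth)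
  have "Measurable.pred runs (\<lambda>\<omega>. \<forall>i. 0 < cap (P.st \<omega> (t - 1)) $ i)"
    using cap by measurable
  then have "(\<lambda>\<omega>. if \<forall>i. 0 < cap (P.st \<omega> (t - 1)) $ i then k \<omega> (best_vertices (v \<omega>)) else 0) \<in> borel_measurable runs"
    by (intro measurable_If sel) auto
  moreover have "(\<lambda>\<omega>. snd (arrivals \<omega> t)) \<in> measurable runs (count_space UNIV)"
    by (rule measurable_compose[OF case_measurable[OF t] snd_measurable])
  ultimately have "(\<lambda>\<omega>. case snd (arrivals \<omega> t) of
      None \<Rightarrow> (if \<forall>i. 0 < cap (P.st \<omega> (t - 1)) $ i then k \<omega> (best_vertices (v \<omega>)) else 0)
    | Some i \<Rightarrow> axis i 1) \<in> borel_measurable runs"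
    by (intro measurable_case_free)
  also have "(\<lambda>\<omega>. case snd (arrivals \<omega> t) of
      None \<Rightarrow> (if \<forall>i. 0 < cap (P.st \<omega> (t - 1)) $ i then k \<omega> (best_vertices (v \<omega>)) else 0)
    | Some i \<Rightarrow> axis i 1) = (\<lambda>\<omega>. P.z \<omega> t)"
    by (intro ext) (auto simp: cadl_match_def cadl_choice_def cadl_decide_def k_def v_def split: option.split)
  finally show ?thesis .
qed

lemma state_measurable:
  assumes "n \<le> T"
  shows "(\<lambda>\<omega>. theta (P.st \<omega> n)) \<in> borel_measurable runs \<and> (\<lambda>\<omega>. lam (P.st \<omega> n)) \<in> borel_measurable runs
    \<and> (\<lambda>\<omega>. cap (P.st \<omega> n)) \<in> borel_measurable runs \<and> (\<lambda>\<omega>. backlog (P.st \<omega> n)) \<in> borel_measurable runs"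
  using assms
proof (induction n)
  case (Suc n)
  then have IH: "(\<lambda>\<omega>. theta (P.st \<omega> n)) \<in> borel_measurable runs" "(\<lambda>\<omega>. lam (P.st \<omega> n)) \<in> borel_measurable runs"
    "(\<lambda>\<omega>. cap (P.st \<omega> n)) \<in> borel_measurable runs" "(\<lambda>\<omega>. backlog (P.st \<omega> n)) \<in> borel_measurable runs" by auto
  from Suc.prems have t: "Suc n \<in> {1..T}" by auto
  have z: "(\<lambda>\<omega>. P.z \<omega> (Suc n)) \<in> borel_measurable runs"
    using match_measurable_aux[OF t] IH by (simp del: cadl_state.simps)
  have IHi: "(\<lambda>\<omega>. theta (P.st \<omega> n) $ i) \<in> borel_measurable runs" "(\<lambda>\<omega>. lam (P.st \<omega> n) $ i) \<in> borel_measurable runs"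
    "(\<lambda>\<omega>. backlog (P.st \<omega> n) $ i) \<in> borel_measurable runs" "(\<lambda>\<omega>. P.z \<omega> (Suc n) $ i) \<in> borel_measurable runs" for i
    using IH z by - (rule borel_measurable_vec_nth, assumption)+
  note [measurable] = IHi IH z service_component_measurable[OF t]
  have "(\<lambda>\<omega>. theta (P.st \<omega> (Suc n)) $ i) \<in> borel_measurable runs" for i
    unfolding P.st_Suc cadl_update_def cadl_vars.simps vec_lambda_beta by measurable
  moreover have "(\<lambda>\<omega>. lam (P.st \<omega> (Suc n)) $ i) \<in> borel_measurable runs" for i
    unfolding P.st_Suc cadl_update_def cadl_vars.simps vec_lambda_beta by measurable
  moreover have "(\<lambda>\<omega>. cap (P.st \<omega> (Suc n))) \<in> borel_measurable runs"
    unfolding P.st_Suc cadl_update_def cadl_vars.simps by measurable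
  moreover have "(\<lambda>\<omega>. backlog (P.st \<omega> (Suc n)) $ i) \<in> borel_measurable runs" for i
    unfolding P.st_Suc cadl_update_def cadl_vars.simps vec_lambda_beta by measurable
  ultimately show ?case using borel_measurable_vec_iff by blast
qed (simp add: cadl_init_def)

lemma match_measurable: "t \<in> {1..T} \<Longrightarrow> (\<lambda>\<omega>. P.z \<omega> t) \<in> borel_measurable runs"
  using state_measurable[of "t - 1"] by (intro match_measurable_aux) auto

lemma component_measurable:
  assumes "t \<in> {1..T}"
  shows "(\<lambda>\<omega>. theta (P.st \<omega> (t - 1)) $ i) \<in> borel_measurable runs"
    "(\<lambda>\<omega>. lam (P.st \<omega> (t - 1)) $ i) \<in> borel_measurable runs"
    "(\<lambda>\<omega>. cap (P.st \<omega> (t - 1)) $ i) \<in> borel_measurable runs"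
    "(\<lambda>\<omega>. backlog (P.st \<omega> (t - 1)) $ i) \<in> borel_measurable runs"
    "(\<lambda>\<omega>. P.z \<omega> t $ i) \<in> borel_measurable runs"
proof -
  have "t - 1 \<le> T" using assms by auto
  from state_measurable[OF this] match_measurable[OF assms]
  show "(\<lambda>\<omega>. theta (P.st \<omega> (t - 1)) $ i) \<in> borel_measurable runs"
    "(\<lambda>\<omega>. lam (P.st \<omega> (t - 1)) $ i) \<in> borel_measurable runs"
    "(\<lambda>\<omega>. cap (P.st \<omega> (t - 1)) $ i) \<in> borel_measurable runs"
    "(\<lambda>\<omega>. backlog (P.st \<omega> (t - 1)) $ i) \<in> borel_measurable runs"
    "(\<lambda>\<omega>. P.z \<omega> t $ i) \<in> borel_measurable runs"
    by - (rule borel_measurable_vec_nth, blast)+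
qed

lemma active_measurable:
  assumes "t \<in> {1..T}"
  shows "(\<lambda>\<omega>. P.act \<omega> t) \<in> borel_measurable runs"
proof -
  note [measurable] = component_measurable(3)[OF assms]
  have "Measurable.pred runs (\<lambda>\<omega>. P.active \<omega> t)" unfolding P.active_def by measurable
  then show ?thesis by measurable
qed

section \<open>Variables determined by the past\<close>

lemma integrable_bounded:
  fixes X :: "_ \<Rightarrow> real"
  assumes "X \<in> borel_measurable runs" "\<And>\<omega>. \<bar>X \<omega>\<bar> \<le> B"
  shows "integrable runs X"
  using assms by (intro O.integrable_const_bound[where B = B]) auto

text \<open>Measurability with respect to the past is stated pointwise rather than through a
  sigma-algebra, which makes invariance under redrawing period \<open>t\<close> immediate. The bound
  holds everywhere, as \<open>expectation_mult_resample\<close> requires.\<close>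

definition past :: "nat \<Rightarrow> ('u \<times> (nat \<Rightarrow> 'n case_type) \<times> (nat \<Rightarrow> 'n \<Rightarrow> bool) \<Rightarrow> real) \<Rightarrow> bool" where
  "past t X \<longleftrightarrow> X \<in> borel_measurable runs \<and> (\<exists>B. \<forall>\<omega>. \<bar>X \<omega>\<bar> \<le> B) \<and>
     (\<forall>\<omega> \<omega>'. fst \<omega> = fst \<omega>' \<longrightarrow>
        (\<forall>\<tau>\<in>{1..<t}. arrivals \<omega> \<tau> = arrivals \<omega>' \<tau> \<and> services \<omega> \<tau> = services \<omega>' \<tau>) \<longrightarrow> X \<omega> = X \<omega>')"

lemma pastI:
  assumes "X \<in> borel_measurable runs" "\<And>\<omega>. \<bar>X \<omega>\<bar> \<le> B"
    and "\<And>\<omega> \<omega>'. fst \<omega> = fst \<omega>' \<Longrightarrow> (\<And>\<tau>. \<tau> \<in> {1..<t} \<Longrightarrow> arrivals \<omega> \<tau> = arrivals \<omega>' \<tau>) \<Longrightarrow>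
      (\<And>\<tau>. \<tau> \<in> {1..<t} \<Longrightarrow> services \<omega> \<tau> = services \<omega>' \<tau>) \<Longrightarrow> X \<omega> = X \<omega>'"
  shows "past t X"
  unfolding past_def
proof (intro conjI exI[of _ B] allI impI)
  fix \<omega> \<omega>'
  assume "fst \<omega> = fst \<omega>'"
    "\<forall>\<tau>\<in>{1..<t}. arrivals \<omega> \<tau> = arrivals \<omega>' \<tau> \<and> services \<omega> \<tau> = services \<omega>' \<tau>"
  then show "X \<omega> = X \<omega>'" by (intro assms(3)) auto
qed (use assms in blast)+

lemma past_measurable: "past t X \<Longrightarrow> X \<in> borel_measurable runs"
  unfolding past_def by blast

lemma past_bounded:
  assumes "past t X"
  obtains B where "0 \<le> B" "\<And>\<omega>. \<bar>X \<omega>\<bar> \<le> B"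
proof -
  from assms obtain B where B: "\<And>\<omega>. \<bar>X \<omega>\<bar> \<le> B" unfolding past_def by blast
  have "0 \<le> B" using B[of undefined] by linarith
  with B show ?thesis using that by blast
qed

lemma past_eq:
  assumes "past t X" "fst \<omega> = fst \<omega>'" "\<And>\<tau>. \<tau> \<in> {1..<t} \<Longrightarrow> arrivals \<omega> \<tau> = arrivals \<omega>' \<tau>"
    "\<And>\<tau>. \<tau> \<in> {1..<t} \<Longrightarrow> services \<omega> \<tau> = services \<omega>' \<tau>"
  shows "X \<omega> = X \<omega>'"
  using assms unfolding past_def by blast

lemma past_integrable: "past t X \<Longrightarrow> integrable runs X"
  by (metis past_bounded past_measurable integrable_bounded)

lemma past_mult:
  assumes "past t X" "past t Y"
  shows "past t (\<lambda>\<omega>. X \<omega> * Y \<omega>)"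
proof -
  obtain B where B: "0 \<le> B" "\<And>\<omega>. \<bar>X \<omega>\<bar> \<le> B" using past_bounded[OF assms(1)] by blast
  obtain C where C: "0 \<le> C" "\<And>\<omega>. \<bar>Y \<omega>\<bar> \<le> C" using past_bounded[OF assms(2)] by blast
  show ?thesis
  proof (rule pastI[where B = "B * C"])
    show "(\<lambda>\<omega>. X \<omega> * Y \<omega>) \<in> borel_measurable runs" 
      using assms by (intro borel_measurable_times past_measurable)
    show "\<bar>X \<omega> * Y \<omega>\<bar> \<le> B * C" for \<omega>
      using B C by (simp add: abs_mult mult_mono)
  next
    fix \<omega> \<omega>'
    assume eq: "fst \<omega> = fst \<omega>'" "\<And>\<tau>. \<tau> \<in> {1..<t} \<Longrightarrow> arrivals \<omega> \<tau> = arrivals \<omega>' \<tau>"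
      "\<And>\<tau>. \<tau> \<in> {1..<t} \<Longrightarrow> services \<omega> \<tau> = services \<omega>' \<tau>"
    from past_eq[OF assms(1) eq] past_eq[OF assms(2) eq] show "X \<omega> * Y \<omega> = X \<omega>' * Y \<omega>'" by simp
  qed
qed

lemma past_state_eq:
  assumes "fst \<omega> = fst \<omega>'" "\<And>\<tau>. \<tau> \<in> {1..<t} \<Longrightarrow> arrivals \<omega> \<tau> = arrivals \<omega>' \<tau>"
    "\<And>\<tau>. \<tau> \<in> {1..<t} \<Longrightarrow> services \<omega> \<tau> = services \<omega>' \<tau>" "0 < t"
  shows "P.st \<omega> (t - 1) = P.st \<omega>' (t - 1)"
  unfolding assms(1) using assms(2-4) by (intro cadl_state_cong) auto

lemma past_stateI:
  assumes "t \<in> {1..T}" "(\<lambda>\<omega>. g (P.st \<omega> (t - 1))) \<in> borel_measurable runs"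
    and "\<And>\<omega>. \<bar>g (P.st \<omega> (t - 1))\<bar> \<le> B"
  shows "past t (\<lambda>\<omega>. g (P.st \<omega> (t - 1)))"
proof (rule pastI[OF assms(2,3)])
  fix \<omega> \<omega>'
  assume "fst \<omega> = fst \<omega>'" "\<And>\<tau>. \<tau> \<in> {1..<t} \<Longrightarrow> arrivals \<omega> \<tau> = arrivals \<omega>' \<tau>"
    "\<And>\<tau>. \<tau> \<in> {1..<t} \<Longrightarrow> services \<omega> \<tau> = services \<omega>' \<tau>"
  then have "P.st \<omega> (t - 1) = P.st \<omega>' (t - 1)" using assms(1) by (intro past_state_eq) auto
  then show "g (P.st \<omega> (t - 1)) = g (P.st \<omega>' (t - 1))" by (rule arg_cong)
qed

lemma past_state:
  assumes t: "t \<in> {1..T}"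
  shows "past t (\<lambda>\<omega>. P.act \<omega> t)" "past t (\<lambda>\<omega>. 1 - P.act \<omega> t)"
    "past t (\<lambda>\<omega>. theta (P.st \<omega> (t - 1)) $ i)" "past t (\<lambda>\<omega>. lam (P.st \<omega> (t - 1)) $ i)"
    "past t (\<lambda>\<omega>. backlog (P.st \<omega> (t - 1)) $ i)"
proof -
  show "past t (\<lambda>\<omega>. P.act \<omega> t)"
    using past_stateI[OF t, where g = "\<lambda>\<sigma>. of_bool (\<forall>i. 0 < cap \<sigma> $ i)" and B = 1] active_measurable[OF t]
    unfolding P.active_def by simp
  show "past t (\<lambda>\<omega>. 1 - P.act \<omega> t)"
    using past_stateI[OF t, where g = "\<lambda>\<sigma>. 1 - of_bool (\<forall>i. 0 < cap \<sigma> $ i)" and B = 1] active_measurable[OF t]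
    unfolding P.active_def by simp
  show "past t (\<lambda>\<omega>. theta (P.st \<omega> (t - 1)) $ i)"
    by (rule past_stateI[OF t, where g = "\<lambda>\<sigma>. theta \<sigma> $ i" and B = "\<alpha> + 1"])
      (use component_measurable[OF t] P.theta_bounds in \<open>simp_all\<close>)
  show "past t (\<lambda>\<omega>. lam (P.st \<omega> (t - 1)) $ i)"
    by (rule past_stateI[OF t, where g = "\<lambda>\<sigma>. lam \<sigma> $ i" and B = "P.lam_max"])
      (use component_measurable[OF t] P.lam_bounds in \<open>simp_all\<close>)
  show "past t (\<lambda>\<omega>. backlog (P.st \<omega> (t - 1)) $ i)"
    by (rule past_stateI[OF t, where g = "\<lambda>\<sigma>. backlog \<sigma> $ i" and B = "real (t - 1)"])
      (use component_measurable[OF t] P.backlog_bounds[of _ "t - 1" i] in \<open>simp_all\<close>)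
qed

section \<open>Independence of the current period from the past\<close>

lemma resamples_case:
  assumes "t \<in> {1..T}"
  shows "resamples runs F (\<lambda>\<omega> a. (fst \<omega>, (arrivals \<omega>)(t := a), services \<omega>))"
  unfolding runs_def sample_space_def
proof (rule resamples_snd, goal_cases)
  case 4
  show ?case
  proof (rule resamples_fst, goal_cases)
    case 4
    show ?case by (rule resamples_PiM) (use assms prob_space_axioms in auto)
  qed (intro prob_space_imp_sigma_finite prob_space_cases prob_space_services prob_space_axioms)+
qed (intro prob_space_imp_sigma_finite prob_space_pair prob_space_U prob_space_cases
      prob_space_services prob_space_axioms)+

lemma resamples_service:
  assumes "t \<in> {1..T}"
  shows "resamples runs (measure_pmf (service_dist r)) (\<lambda>\<omega> v. (fst \<omega>, arrivals \<omega>, (services \<omega>)(t := v)))"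
  unfolding runs_def sample_space_def
proof (rule resamples_snd, goal_cases)
  case 4
  show ?case
  proof (rule resamples_snd, goal_cases)
    case 4
    show ?case by (rule resamples_PiM) (use assms measure_pmf.prob_space_axioms in auto)
  qed (intro prob_space_imp_sigma_finite prob_space_cases prob_space_services measure_pmf.prob_space_axioms)+
qed (intro prob_space_imp_sigma_finite prob_space_pair prob_space_U prob_space_cases
      prob_space_services measure_pmf.prob_space_axioms)+

lemma case_independent:
  assumes t: "t \<in> {1..T}" and X: "past t X" and h: "integrable F h"
  shows "mean (\<lambda>\<omega>. X \<omega> * h (arrivals \<omega> t)) = mean X * (\<integral>a. h a \<partial>F)"
    "integrable runs (\<lambda>\<omega>. X \<omega> * h (arrivals \<omega> t))"
proof -
  obtain B where B: "\<And>\<omega>. \<bar>X \<omega>\<bar> \<le> B" using past_bounded[OF X] by blast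
  note m = past_measurable[OF X]
  have Y: "(\<lambda>\<omega>. h (arrivals \<omega> t)) \<in> borel_measurable runs"
    using h by (intro measurable_compose[OF case_measurable[OF t]]) auto
  have inv: "X (fst \<omega>, (arrivals \<omega>)(t := a), services \<omega>) = X \<omega>" for \<omega> a
    by (rule past_eq[OF X]) auto
  have hh: "h (arrivals (fst \<omega>, (arrivals \<omega>)(t := a), services \<omega>) t) = h a" for \<omega> a by simp
  note * = expectation_mult_resample[OF O.prob_space_axioms prob_space_axioms resamples_case[OF t]
      m B inv Y hh h]
  from *(1) show "mean (\<lambda>\<omega>. X \<omega> * h (arrivals \<omega> t)) = mean X * (\<integral>a. h a \<partial>F)" .
  from *(2) show "integrable runs (\<lambda>\<omega>. X \<omega> * h (arrivals \<omega> t))" .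
qed

lemma service_independent:
  assumes t: "t \<in> {1..T}" and X: "past t X"
  shows "mean (\<lambda>\<omega>. X \<omega> * of_bool (services \<omega> t i)) = mean X * r $ i"
    "integrable runs (\<lambda>\<omega>. X \<omega> * of_bool (services \<omega> t i))"
proof -
  obtain B where B: "\<And>\<omega>. \<bar>X \<omega>\<bar> \<le> B" using past_bounded[OF X] by blast
  note m = past_measurable[OF X]
  have inv: "X (fst \<omega>, arrivals \<omega>, (services \<omega>)(t := v)) = X \<omega>" for \<omega> v
    by (rule past_eq[OF X]) auto
  have hh: "(of_bool (services (fst \<omega>, arrivals \<omega>, (services \<omega>)(t := v)) t i) :: real) = of_bool (v i)" for \<omega> v
    by simp
  have h: "integrable (measure_pmf (service_dist r)) (\<lambda>v. of_bool (v i) :: real)"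
    by (intro measure_pmf.integrable_const_bound[where B = 1]) auto
  note * = expectation_mult_resample[OF O.prob_space_axioms measure_pmf.prob_space_axioms
      resamples_service[OF t] m B inv service_component_measurable[OF t] hh h]
  from *(1) show "mean (\<lambda>\<omega>. X \<omega> * of_bool (services \<omega> t i)) = mean X * r $ i"
    unfolding service_expectation[OF r(1) r(2)] .
  from *(2) show "integrable runs (\<lambda>\<omega>. X \<omega> * of_bool (services \<omega> t i))" .
qed

text \<open>Redrawing period \<open>t\<close> turns the mean of the indicator of bad cases into its
  mean under \<open>F\<close>, which is 0.\<close>

lemma AE_rewards: "AE \<omega> in runs. \<forall>t\<in>{1..T}. \<forall>i. 0 \<le> fst (arrivals \<omega> t) $ i \<and> fst (arrivals \<omega> t) $ i \<le> 1"
proof (rule AE_finite_allI)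
  fix t assume t: "t \<in> {1..T}"
  define bad where "bad = {a \<in> space F. \<not> (\<forall>i. 0 \<le> fst a $ i \<and> fst a $ i \<le> 1)}"
  have bad: "bad \<in> sets F" unfolding bad_def by measurable
  have f: "(\<lambda>\<omega>. indicator bad (arrivals \<omega> t) :: ennreal) \<in> borel_measurable runs"
    using bad by (intro measurable_compose[OF case_measurable[OF t]]) auto
  have "emeasure F bad = 0" using rewards bad by (subst AE_iff_measurable[symmetric]) (auto simp: bad_def)
  have "(\<integral>\<^sup>+\<omega>. indicator bad (arrivals \<omega> t) \<partial>runs)
      = (\<integral>\<^sup>+\<omega>. \<integral>\<^sup>+a. indicator bad (arrivals (fst \<omega>, (arrivals \<omega>)(t := a), services \<omega>) t) \<partial>F \<partial>runs)"
    by (rule resamples_nn_integral[OF resamples_case[OF t] f, symmetric])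
  also have "\<dots> = 0" using bad \<open>emeasure F bad = 0\<close> by simp
  finally have "(\<integral>\<^sup>+\<omega>. indicator bad (arrivals \<omega> t) \<partial>runs) = 0" .
  then have "AE \<omega> in runs. (indicator bad (arrivals \<omega> t) :: ennreal) = 0"
    using nn_integral_0_iff_AE[OF f] by simp
  then show "AE \<omega> in runs. \<forall>i. 0 \<le> fst (arrivals \<omega> t) $ i \<and> fst (arrivals \<omega> t) $ i \<le> 1"
    by eventually_elim (auto simp: bad_def space_F indicator_def split: if_splits)
qed simp

section \<open>One-period comparisons in expectation\<close>

abbreviation wt :: "'u \<times> (nat \<Rightarrow> 'n case_type) \<times> (nat \<Rightarrow> 'n \<Rightarrow> bool) \<Rightarrow> nat \<Rightarrow> real^'n" where
  "wt \<omega> t \<equiv> fst (arrivals \<omega> t)"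

abbreviation bl :: "'u \<times> (nat \<Rightarrow> 'n case_type) \<times> (nat \<Rightarrow> 'n \<Rightarrow> bool) \<Rightarrow> nat \<Rightarrow> real^'n" where
  "bl \<omega> t \<equiv> backlog (P.st \<omega> (t - 1))"

abbreviation duals :: "'u \<times> (nat \<Rightarrow> 'n case_type) \<times> (nat \<Rightarrow> 'n \<Rightarrow> bool) \<Rightarrow> nat \<Rightarrow> real^'n" where
  "duals \<omega> t \<equiv> theta (P.st \<omega> (t - 1)) + lam (P.st \<omega> (t - 1))"

lemma integrable_match_mult:
  assumes t: "t \<in> {1..T}" and X: "past t X"
  shows "integrable runs (\<lambda>\<omega>. X \<omega> * P.z \<omega> t $ i)"
proof -
  obtain B where B: "0 \<le> B" "\<And>\<omega>. \<bar>X \<omega>\<bar> \<le> B" using past_bounded[OF X] by blast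
  show ?thesis
  proof (rule integrable_bounded[where B = B])
    show "(\<lambda>\<omega>. X \<omega> * P.z \<omega> t $ i) \<in> borel_measurable runs"
      using component_measurable(5)[OF t] past_measurable[OF X] by (rule borel_measurable_times[rotated])
    show "\<bar>X \<omega> * P.z \<omega> t $ i\<bar> \<le> B" for \<omega>
      using B(2)[of \<omega>] P.match_bounds(1,2)[of \<omega> t i] B(1) mult_mono[of "\<bar>X \<omega>\<bar>" B "P.z \<omega> t $ i" 1]
      by (simp add: abs_mult)
  qed
qed

lemma integrable_active_inner:
  assumes t: "t \<in> {1..T}" and v: "\<And>i. past t (\<lambda>\<omega>. v \<omega> $ i)"
  shows "integrable runs (\<lambda>\<omega>. P.act \<omega> t * (v \<omega> \<bullet> (P.z \<omega> t - \<rho>)))"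
proof -
  have eq: "(\<lambda>\<omega>. P.act \<omega> t * (v \<omega> \<bullet> (P.z \<omega> t - \<rho>)))
      = (\<lambda>\<omega>. \<Sum>i\<in>UNIV. P.act \<omega> t * v \<omega> $ i * P.z \<omega> t $ i - P.act \<omega> t * v \<omega> $ i * \<rho> $ i)"
    by (auto simp: inner_vec_def sum_distrib_left algebra_simps)
  show ?thesis
    unfolding eq using past_mult[OF past_state(1)[OF t] v] past_integrable[OF past_mult[OF past_state(1)[OF t] v]]
    by (intro Bochner_Integration.integrable_sum Bochner_Integration.integrable_diff integrable_match_mult t
        integrable_mult_left)
qed

lemma past_duals: "t \<in> {1..T} \<Longrightarrow> past t (\<lambda>\<omega>. duals \<omega> t $ i)"
proof -
  assume t: "t \<in> {1..T}"
  have m: "(\<lambda>\<omega>. duals \<omega> t $ i) \<in> borel_measurable runs"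
    using component_measurable(1,2)[OF t] by simp
  have "\<bar>duals \<omega> t $ i\<bar> \<le> \<alpha> + 1 + P.lam_max" for \<omega>
    using P.theta_bounds[of \<omega> "t - 1" i] P.lam_bounds[of \<omega> "t - 1" i] by simp
  from past_stateI[OF t, where g = "\<lambda>\<sigma>. (theta \<sigma> + lam \<sigma>) $ i", OF m this] show ?thesis .
qed

lemma integrable_active_reward:
  assumes t: "t \<in> {1..T}"
  shows "integrable runs (\<lambda>\<omega>. P.act \<omega> t * (wt \<omega> t \<bullet> P.z \<omega> t))"
proof (rule O.integrable_const_bound[where B = 1])
  have "(\<lambda>\<omega>. wt \<omega> t) \<in> borel_measurable runs" by (rule measurable_compose[OF case_measurable[OF t] fst_measurable])
  then show "(\<lambda>\<omega>. P.act \<omega> t * (wt \<omega> t \<bullet> P.z \<omega> t)) \<in> borel_measurable runs"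
    using active_measurable[OF t] match_measurable[OF t] by (intro borel_measurable_times borel_measurable_inner)
  show "AE \<omega> in runs. norm (P.act \<omega> t * (wt \<omega> t \<bullet> P.z \<omega> t)) \<le> 1"
    using AE_rewards
  proof eventually_elim
    case (elim \<omega>)
    have "\<bar>wt \<omega> t \<bullet> P.z \<omega> t\<bar> \<le> 1"
      using elim t by (intro abs_inner_action_le[OF P.match_action]) auto
    then show ?case by (auto simp: of_bool_def)
  qed
qed

text \<open>The static policy is run on the current case as a comparator. The price \<open>p\<close>
  is nonnegative and known before the case, so in the mean the comparator costs at most
  \<open>p \<bullet> \<rho>\<close>; the actual decision stays coupled with
  \<open>p\<close>.\<close>

lemma mean_active_reward_ge:
  assumes t: "t \<in> {1..T}" and y: "y \<in> policies" "\<And>i. (\<integral>a. y a $ i \<partial>F) \<le> \<rho> $ i"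
    and v: "v \<le> (\<integral>a. fst a \<bullet> y a \<partial>F)"
  shows "mean (\<lambda>\<omega>. P.act \<omega> t * (wt \<omega> t \<bullet> P.z \<omega> t))
    \<ge> v * mean (\<lambda>\<omega>. P.act \<omega> t) + mean (\<lambda>\<omega>. P.act \<omega> t * (duals \<omega> t \<bullet> (P.z \<omega> t - \<rho>)))
      + \<zeta> * mean (\<lambda>\<omega>. P.act \<omega> t * (bl \<omega> t \<bullet> (P.z \<omega> t - \<rho>)))"
proof -
  define p where "p \<omega> = duals \<omega> t + \<zeta> *\<^sub>R bl \<omega> t" for \<omega>
  have past_p: "past t (\<lambda>\<omega>. p \<omega> $ i)" for i
  proof -
    have m: "(\<lambda>\<omega>. p \<omega> $ i) \<in> borel_measurable runs"
      unfolding p_def using component_measurable(1,2,4)[OF t] by simp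
    have "\<bar>p \<omega> $ i\<bar> \<le> \<alpha> + 1 + P.lam_max + \<zeta> * real (t - 1)" for \<omega>
    proof -
      have "\<zeta> * bl \<omega> t $ i \<le> \<zeta> * real (t - 1)" "0 \<le> \<zeta> * bl \<omega> t $ i"
        using P.backlog_bounds[of \<omega> "t - 1" i] \<zeta>_pos by (auto intro: mult_left_mono)
      then show ?thesis
        using P.theta_bounds[of \<omega> "t - 1" i] P.lam_bounds[of \<omega> "t - 1" i] by (simp add: p_def)
    qed
    from past_stateI[OF t, where g = "\<lambda>\<sigma>. (theta \<sigma> + lam \<sigma> + \<zeta> *\<^sub>R backlog \<sigma>) $ i", OF m[unfolded p_def] this[unfolded p_def]]
    show ?thesis unfolding p_def .
  qed
  have p_nonneg: "0 \<le> p \<omega> $ i" for \<omega> i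
    using P.theta_bounds P.lam_bounds P.backlog_bounds \<zeta>_pos by (simp add: p_def)
  note act = past_state(1)[OF t]
  note actp = past_mult[OF act past_p]
  note int1 = case_independent(2)[OF t act integrable_reward[OF y(1)]]
  note int2 = case_independent(2)[OF t actp integrable_policy_component[OF y(1)]]
  note int3 = integrable_match_mult[OF t actp]
  have path: "P.act \<omega> t * (wt \<omega> t \<bullet> y (arrivals \<omega> t)) - (\<Sum>i\<in>UNIV. P.act \<omega> t * p \<omega> $ i * y (arrivals \<omega> t) $ i)
      + (\<Sum>i\<in>UNIV. P.act \<omega> t * p \<omega> $ i * P.z \<omega> t $ i) \<le> P.act \<omega> t * (wt \<omega> t \<bullet> P.z \<omega> t)" for \<omega>
  proof -
    have inner: "(\<Sum>i\<in>UNIV. P.act \<omega> t * p \<omega> $ i * x $ i) = P.act \<omega> t * (p \<omega> \<bullet> x)" for x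
      by (simp only: inner_vec_def inner_real_def sum_distrib_left mult.assoc)
    have "P.act \<omega> t * ((wt \<omega> t - p \<omega>) \<bullet> y (arrivals \<omega> t)) \<le> P.act \<omega> t * ((wt \<omega> t - p \<omega>) \<bullet> P.z \<omega> t)"
      unfolding p_def by (rule P.match_optimal[OF policy_action[OF y(1)]])
    then show ?thesis unfolding inner by (simp only: inner_diff_left right_diff_distrib)
  qed
  have "mean (\<lambda>\<omega>. P.act \<omega> t * (wt \<omega> t \<bullet> P.z \<omega> t))
      \<ge> mean (\<lambda>\<omega>. P.act \<omega> t * (wt \<omega> t \<bullet> y (arrivals \<omega> t)) - (\<Sum>i\<in>UNIV. P.act \<omega> t * p \<omega> $ i * y (arrivals \<omega> t) $ i)
      + (\<Sum>i\<in>UNIV. P.act \<omega> t * p \<omega> $ i * P.z \<omega> t $ i))"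
    using int1 int2 int3 by (intro integral_mono integrable_active_reward t path) auto
  also have "mean (\<lambda>\<omega>. P.act \<omega> t * (wt \<omega> t \<bullet> y (arrivals \<omega> t)) - (\<Sum>i\<in>UNIV. P.act \<omega> t * p \<omega> $ i * y (arrivals \<omega> t) $ i)
      + (\<Sum>i\<in>UNIV. P.act \<omega> t * p \<omega> $ i * P.z \<omega> t $ i))
    = mean (\<lambda>\<omega>. P.act \<omega> t * (wt \<omega> t \<bullet> y (arrivals \<omega> t)))
      - (\<Sum>i\<in>UNIV. mean (\<lambda>\<omega>. P.act \<omega> t * p \<omega> $ i * y (arrivals \<omega> t) $ i))
      + (\<Sum>i\<in>UNIV. mean (\<lambda>\<omega>. P.act \<omega> t * p \<omega> $ i * P.z \<omega> t $ i))"
    using int1 int2 int3 by simp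
  also have "mean (\<lambda>\<omega>. P.act \<omega> t * (wt \<omega> t \<bullet> y (arrivals \<omega> t)))
      = mean (\<lambda>\<omega>. P.act \<omega> t) * (\<integral>a. fst a \<bullet> y a \<partial>F)"
    by (rule case_independent(1)[OF t act integrable_reward[OF y(1)]])
  finally have 1: "mean (\<lambda>\<omega>. P.act \<omega> t * (wt \<omega> t \<bullet> P.z \<omega> t)) \<ge> mean (\<lambda>\<omega>. P.act \<omega> t) * (\<integral>a. fst a \<bullet> y a \<partial>F)
      - (\<Sum>i\<in>UNIV. mean (\<lambda>\<omega>. P.act \<omega> t * p \<omega> $ i * y (arrivals \<omega> t) $ i))
      + (\<Sum>i\<in>UNIV. mean (\<lambda>\<omega>. P.act \<omega> t * p \<omega> $ i * P.z \<omega> t $ i))" .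
  have "(\<Sum>i\<in>UNIV. mean (\<lambda>\<omega>. P.act \<omega> t * p \<omega> $ i * y (arrivals \<omega> t) $ i))
      \<le> (\<Sum>i\<in>UNIV. mean (\<lambda>\<omega>. P.act \<omega> t * p \<omega> $ i) * \<rho> $ i)"
  proof (rule sum_mono)
    fix i
    have "mean (\<lambda>\<omega>. P.act \<omega> t * p \<omega> $ i * y (arrivals \<omega> t) $ i)
        = mean (\<lambda>\<omega>. P.act \<omega> t * p \<omega> $ i) * (\<integral>a. y a $ i \<partial>F)"
      by (rule case_independent(1)[OF t actp integrable_policy_component[OF y(1)]])
    also have "\<dots> \<le> mean (\<lambda>\<omega>. P.act \<omega> t * p \<omega> $ i) * \<rho> $ i"
      using p_nonneg y(2) by (intro mult_left_mono integral_nonneg_AE) auto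
    finally show "mean (\<lambda>\<omega>. P.act \<omega> t * p \<omega> $ i * y (arrivals \<omega> t) $ i)
        \<le> mean (\<lambda>\<omega>. P.act \<omega> t * p \<omega> $ i) * \<rho> $ i" .
  qed
  moreover have "mean (\<lambda>\<omega>. P.act \<omega> t) * (\<integral>a. fst a \<bullet> y a \<partial>F) \<ge> mean (\<lambda>\<omega>. P.act \<omega> t) * v"
    using v by (intro mult_left_mono integral_nonneg_AE) auto
  ultimately have 2: "mean (\<lambda>\<omega>. P.act \<omega> t * (wt \<omega> t \<bullet> P.z \<omega> t)) \<ge> mean (\<lambda>\<omega>. P.act \<omega> t) * v
      - (\<Sum>i\<in>UNIV. mean (\<lambda>\<omega>. P.act \<omega> t * p \<omega> $ i) * \<rho> $ i)
      + (\<Sum>i\<in>UNIV. mean (\<lambda>\<omega>. P.act \<omega> t * p \<omega> $ i * P.z \<omega> t $ i))" using 1 by linarith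
  have "mean (\<lambda>\<omega>. P.act \<omega> t * (duals \<omega> t \<bullet> (P.z \<omega> t - \<rho>))) + \<zeta> * mean (\<lambda>\<omega>. P.act \<omega> t * (bl \<omega> t \<bullet> (P.z \<omega> t - \<rho>)))
      = mean (\<lambda>\<omega>. P.act \<omega> t * (duals \<omega> t \<bullet> (P.z \<omega> t - \<rho>)) + \<zeta> * (P.act \<omega> t * (bl \<omega> t \<bullet> (P.z \<omega> t - \<rho>))))"
    using integrable_active_inner[OF t past_duals[OF t]] integrable_active_inner[OF t past_state(5)[OF t]] by simp
  also have "\<dots> = mean (\<lambda>\<omega>. \<Sum>i\<in>UNIV. P.act \<omega> t * p \<omega> $ i * P.z \<omega> t $ i - P.act \<omega> t * p \<omega> $ i * \<rho> $ i)"
  proof -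
    have "P.act \<omega> t * (duals \<omega> t \<bullet> (P.z \<omega> t - \<rho>)) + \<zeta> * (P.act \<omega> t * (bl \<omega> t \<bullet> (P.z \<omega> t - \<rho>)))
        = P.act \<omega> t * (p \<omega> \<bullet> (P.z \<omega> t - \<rho>))" for \<omega>
      unfolding p_def by (simp only: inner_add_left[of _ "\<zeta> *\<^sub>R bl \<omega> t"] inner_scaleR_left distrib_left mult.left_commute)
    then show ?thesis by (simp add: inner_vec_def sum_distrib_left right_diff_distrib mult.assoc)
  qed
  also have "\<dots> = (\<Sum>i\<in>UNIV. mean (\<lambda>\<omega>. P.act \<omega> t * p \<omega> $ i * P.z \<omega> t $ i))
      - (\<Sum>i\<in>UNIV. mean (\<lambda>\<omega>. P.act \<omega> t * p \<omega> $ i) * \<rho> $ i)"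
    using int3 past_integrable[OF actp] by (simp add: sum_subtractf)
  finally show ?thesis using 2 by (simp add: mult.commute)
qed

text \<open>Weak duality in one period: an action earns at most \<open>profit\<close> plus the price
  of what it uses, and activity is decided before the case arrives.\<close>

lemma mean_active_reward_le:
  assumes t: "t \<in> {1..T}" and \<mu>: "(\<integral>a. profit \<mu> a \<partial>F) \<le> v"
  shows "mean (\<lambda>\<omega>. P.act \<omega> t * (wt \<omega> t \<bullet> P.z \<omega> t))
    \<le> v * mean (\<lambda>\<omega>. P.act \<omega> t) + (\<Sum>i\<in>UNIV. \<mu> $ i * mean (\<lambda>\<omega>. P.act \<omega> t * P.z \<omega> t $ i))"
proof -
  note act = past_state(1)[OF t]
  note int1 = case_independent(2)[OF t act integrable_profit_best]
  note int3 = integrable_match_mult[OF t act]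
  have path: "P.act \<omega> t * (wt \<omega> t \<bullet> P.z \<omega> t)
      \<le> P.act \<omega> t * profit \<mu> (arrivals \<omega> t) + (\<Sum>i\<in>UNIV. \<mu> $ i * (P.act \<omega> t * P.z \<omega> t $ i))" for \<omega>
  proof -
    have "P.act \<omega> t * ((wt \<omega> t - \<mu>) \<bullet> P.z \<omega> t) \<le> P.act \<omega> t * profit \<mu> (arrivals \<omega> t)"
      by (intro mult_left_mono profit_ge P.match_action) simp
    moreover have "(\<Sum>i\<in>UNIV. \<mu> $ i * (P.act \<omega> t * P.z \<omega> t $ i)) = P.act \<omega> t * (\<mu> \<bullet> P.z \<omega> t)"
      by (simp only: inner_vec_def inner_real_def sum_distrib_left mult.left_commute)
    ultimately show ?thesis by (simp add: inner_diff_left right_diff_distrib)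
  qed
  have "mean (\<lambda>\<omega>. P.act \<omega> t * (wt \<omega> t \<bullet> P.z \<omega> t))
      \<le> mean (\<lambda>\<omega>. P.act \<omega> t * profit \<mu> (arrivals \<omega> t) + (\<Sum>i\<in>UNIV. \<mu> $ i * (P.act \<omega> t * P.z \<omega> t $ i)))"
    using int1 int3 by (intro integral_mono integrable_active_reward t path) auto
  also have "\<dots> = mean (\<lambda>\<omega>. P.act \<omega> t) * (\<integral>a. profit \<mu> a \<partial>F) + (\<Sum>i\<in>UNIV. \<mu> $ i * mean (\<lambda>\<omega>. P.act \<omega> t * P.z \<omega> t $ i))"
    using int1 int3 case_independent(1)[OF t act integrable_profit_best] by simp
  also have "mean (\<lambda>\<omega>. P.act \<omega> t) * (\<integral>a. profit \<mu> a \<partial>F) \<le> mean (\<lambda>\<omega>. P.act \<omega> t) * v"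
    using \<mu> by (intro mult_left_mono integral_nonneg_AE) auto
  finally show ?thesis by (simp add: mult.commute)
qed

text \<open>Outside the active periods only tied cases are matched, at a rate below \<open>\<rho>\<close>; hence adding
  these periods to the drift of the backlog can only decrease it.\<close>

lemma mean_backlog_drift:
  assumes t: "t \<in> {1..T}"
  shows "mean (\<lambda>\<omega>. P.act \<omega> t * (bl \<omega> t $ i * (P.z \<omega> t $ i - \<rho> $ i)))
    \<ge> \<epsilon> * mean (\<lambda>\<omega>. bl \<omega> t $ i) + mean (\<lambda>\<omega>. bl \<omega> t $ i * (P.z \<omega> t $ i - of_bool (services \<omega> t i)))"
proof -
  note b = past_state(5)[OF t, of i]
  note ib = past_mult[OF past_state(2)[OF t] b]
  have int: "integrable runs (\<lambda>\<omega>. bl \<omega> t $ i)" "integrable runs (\<lambda>\<omega>. (1 - P.act \<omega> t) * bl \<omega> t $ i)"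
    using b ib by (auto intro: past_integrable)
  note s = service_independent[OF t b, of i]
  note c = case_independent[OF t ib tied_integrable[of i]]
  note z = integrable_match_mult[OF t b, of i]
  \<comment> \<open>The service is subtracted and added back: the bracket reproduces the drift with
    actual services, and the remaining terms factor in the mean. In inactive periods the match is
    the indicator of a tied case.\<close>
  have path: "P.act \<omega> t * (bl \<omega> t $ i * (P.z \<omega> t $ i - \<rho> $ i))
      = (bl \<omega> t $ i * P.z \<omega> t $ i - bl \<omega> t $ i * of_bool (services \<omega> t i)) + bl \<omega> t $ i * of_bool (services \<omega> t i)
        - bl \<omega> t $ i * \<rho> $ i - (1 - P.act \<omega> t) * bl \<omega> t $ i * of_bool (snd (arrivals \<omega> t) = Some i)
        + (1 - P.act \<omega> t) * bl \<omega> t $ i * \<rho> $ i" for \<omega>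
  proof (cases "P.active \<omega> t")
    case False
    have "P.z \<omega> t $ i = of_bool (snd (arrivals \<omega> t) = Some i)"
      using P.match_inactive[OF _ False] P.match_tied[where t = t and \<omega> = \<omega>]
      by (cases "snd (arrivals \<omega> t)") (auto simp: axis_def)
    with False show ?thesis by (simp add: algebra_simps)
  qed (simp add: algebra_simps)
  have "mean (\<lambda>\<omega>. P.act \<omega> t * (bl \<omega> t $ i * (P.z \<omega> t $ i - \<rho> $ i)))
      = (mean (\<lambda>\<omega>. bl \<omega> t $ i * P.z \<omega> t $ i) - mean (\<lambda>\<omega>. bl \<omega> t $ i) * r $ i) + mean (\<lambda>\<omega>. bl \<omega> t $ i) * r $ i
        - mean (\<lambda>\<omega>. bl \<omega> t $ i) * \<rho> $ i - mean (\<lambda>\<omega>. (1 - P.act \<omega> t) * bl \<omega> t $ i) * tied i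
        + mean (\<lambda>\<omega>. (1 - P.act \<omega> t) * bl \<omega> t $ i) * \<rho> $ i"
    unfolding path using int s c z by (simp add: tied_eq)
  moreover have "mean (\<lambda>\<omega>. bl \<omega> t $ i * (P.z \<omega> t $ i - of_bool (services \<omega> t i)))
      = mean (\<lambda>\<omega>. bl \<omega> t $ i * P.z \<omega> t $ i) - mean (\<lambda>\<omega>. bl \<omega> t $ i) * r $ i"
    unfolding right_diff_distrib using z s by simp
  \<comment> \<open>Here the service slack enters: services outpace \<rho> by at least
    \<epsilon>.\<close>
  moreover have "\<epsilon> * mean (\<lambda>\<omega>. bl \<omega> t $ i) \<le> (r $ i - \<rho> $ i) * mean (\<lambda>\<omega>. bl \<omega> t $ i)"
    using r(3)[of i] P.backlog_bounds by (intro mult_right_mono integral_nonneg_AE) auto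
  moreover have "0 \<le> (\<rho> $ i - tied i) * mean (\<lambda>\<omega>. (1 - P.act \<omega> t) * bl \<omega> t $ i)"
    using tied_bounds[of i] d_pos P.backlog_bounds
    by (intro mult_nonneg_nonneg integral_nonneg_AE) auto
  ultimately show ?thesis by (simp add: algebra_simps)
qed

section \<open>The offline benchmark\<close>

lemma offline_feasible_exists:
  obtains z b where "offline_feasible T \<rho> A s z b"
proof -
  define z where "z t = (case snd (A t) of None \<Rightarrow> 0 | Some i \<Rightarrow> (axis i 1 :: real^'n))" for t
  \<comment> \<open>At most one unit joins each backlog per period, so \<open>b t = t\<close> is
    always large enough. A plan must exist because the supremum of an empty set of reals is
    unspecified.\<close>
  define b :: "nat \<Rightarrow> real^'n" where "b t = (\<chi> i. real t)" for t
  have act: "z t \<in> actions (snd (A t))" for t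
    using vertices_subset_simplex by (auto simp: z_def actions_def split: option.splits)
  have "offline_feasible T \<rho> A s z b"
    unfolding offline_feasible_def
  proof (intro conjI ballI allI)
    fix i
    have "(\<Sum>t=1..T. of_bool (snd (A t) = None) * z t $ i) = 0"
      by (intro sum.neutral) (auto simp: z_def split: option.splits)
    then show "(\<Sum>t=1..T. of_bool (snd (A t) = None) * z t $ i)
        \<le> max 0 (\<rho> $ i * real T - (\<Sum>t=1..T. of_bool (snd (A t) = Some i) * z t $ i))" by simp
  next
    fix t i assume t: "t \<in> {1..T}"
    show "b (t - 1) $ i + z t $ i - of_bool (s t i) \<le> b t $ i"
      using actions_component(2)[OF act, of t i] t by (simp add: b_def of_nat_diff)
  qed (use act in \<open>auto simp: b_def vec_eq_iff\<close>)
  then show ?thesis by (rule that)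
qed

text \<open>Weak duality on each path: both penalties are dropped, and a feasible plan uses
  affiliate \<open>i\<close> for all its tied cases plus at most the capacity they leave, if
  any.\<close>

lemma OPT_le_dual:
  assumes \<mu>: "\<And>i. 0 \<le> \<mu> $ i"
  shows "OPT T \<rho> \<alpha> \<gamma> A s
    \<le> (\<Sum>t=1..T. profit \<mu> (A t)) + (\<Sum>i\<in>UNIV. \<mu> $ i * (\<Sum>t=1..T. of_bool (snd (A t) = Some i)))
      + (\<Sum>i\<in>UNIV. \<mu> $ i * max 0 (\<rho> $ i * real T - (\<Sum>t=1..T. of_bool (snd (A t) = Some i))))"
  unfolding OPT_def
proof (rule cSUP_least)
  show "{(z, b). offline_feasible T \<rho> A s z b} \<noteq> {}" by (rule offline_feasible_exists[of A s]) auto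
next
  fix zb :: "(nat \<Rightarrow> real^'n) \<times> (nat \<Rightarrow> real^'n)"
  assume "zb \<in> {(z, b). offline_feasible T \<rho> A s z b}"
  then obtain z b where zb: "zb = (z, b)" and f: "offline_feasible T \<rho> A s z b" by auto
  have act: "z t \<in> actions (snd (A t))" if "t \<in> {1..T}" for t
    using f that by (simp add: offline_feasible_def)
  have b: "0 \<le> b t $ i" if "t \<in> {1..T}" for t i
    using f that by (simp add: offline_feasible_def)
  have tied: "of_bool (snd (A t) = Some i) * z t $ i = of_bool (snd (A t) = Some i)" if "t \<in> {1..T}" for t i
    using act[OF that] by (auto simp: actions_def)
  have free: "(\<Sum>t=1..T. of_bool (snd (A t) = None) * z t $ i)
      \<le> max 0 (\<rho> $ i * real T - (\<Sum>t=1..T. of_bool (snd (A t) = Some i)))" for i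
  proof -
    have "(\<Sum>t=1..T. of_bool (snd (A t) = Some i) * z t $ i) = (\<Sum>t=1..T. (of_bool (snd (A t) = Some i) :: real))"
      by (intro sum.cong refl tied)
    moreover have "(\<Sum>t=1..T. of_bool (snd (A t) = None) * z t $ i)
        \<le> max 0 (\<rho> $ i * real T - (\<Sum>t=1..T. of_bool (snd (A t) = Some i) * z t $ i))"
      using f unfolding offline_feasible_def by blast
    ultimately show ?thesis by (simp only:)
  qed
  have split: "z t $ i = of_bool (snd (A t) = Some i) + of_bool (snd (A t) = None) * z t $ i" if "t \<in> {1..T}" for t i
    using act[OF that] by (cases "snd (A t)") (auto simp: actions_def axis_def)
  have "payoff T \<rho> \<alpha> \<gamma> A z b \<le> (\<Sum>t=1..T. fst (A t) \<bullet> z t)"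
  proof -
    have "0 \<le> \<alpha> * (\<Sum>i\<in>UNIV. max 0 ((\<Sum>t=1..T. z t $ i) - \<rho> $ i * real T))"
      using \<alpha>_nonneg by (intro mult_nonneg_nonneg sum_nonneg) auto
    moreover have "0 \<le> \<gamma> / real T * (\<Sum>t=1..T. \<Sum>i\<in>UNIV. b t $ i)"
      using \<gamma>_nonneg b by (intro mult_nonneg_nonneg sum_nonneg) auto
    ultimately show ?thesis by (simp add: payoff_def inner_vec_def)
  qed
  also have "\<dots> \<le> (\<Sum>t=1..T. profit \<mu> (A t) + (\<Sum>i\<in>UNIV. \<mu> $ i * z t $ i))"
  proof (rule sum_mono)
    fix t assume "t \<in> {1..T}"
    from profit_ge[OF act[OF this], of \<mu>]
    show "fst (A t) \<bullet> z t \<le> profit \<mu> (A t) + (\<Sum>i\<in>UNIV. \<mu> $ i * z t $ i)"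
      by (simp only: inner_diff_left inner_vec_def[of \<mu>] inner_real_def)
  qed
  also have "\<dots> = (\<Sum>t=1..T. profit \<mu> (A t)) + (\<Sum>i\<in>UNIV. \<mu> $ i * (\<Sum>t=1..T. z t $ i))"
    unfolding sum.distrib sum_distrib_left by (intro arg_cong2[where f = plus] refl sum.swap)
  also have "(\<Sum>i\<in>UNIV. \<mu> $ i * (\<Sum>t=1..T. z t $ i))
      \<le> (\<Sum>i\<in>UNIV. \<mu> $ i * ((\<Sum>t=1..T. of_bool (snd (A t) = Some i))
          + max 0 (\<rho> $ i * real T - (\<Sum>t=1..T. of_bool (snd (A t) = Some i)))))"
  proof (intro sum_mono mult_left_mono \<mu>)
    fix i
    have "(\<Sum>t=1..T. z t $ i) = (\<Sum>t=1..T. of_bool (snd (A t) = Some i) + of_bool (snd (A t) = None) * z t $ i)"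
      by (intro sum.cong refl split)
    also have "\<dots> = (\<Sum>t=1..T. of_bool (snd (A t) = Some i)) + (\<Sum>t=1..T. of_bool (snd (A t) = None) * z t $ i)"
      by (rule sum.distrib)
    finally show "(\<Sum>t=1..T. z t $ i) \<le> (\<Sum>t=1..T. of_bool (snd (A t) = Some i))
        + max 0 (\<rho> $ i * real T - (\<Sum>t=1..T. of_bool (snd (A t) = Some i)))"
      using free[of i] by linarith
  qed
  finally show "(case zb of (z, b) \<Rightarrow> payoff T \<rho> \<alpha> \<gamma> A z b)
    \<le> (\<Sum>t=1..T. profit \<mu> (A t)) + (\<Sum>i\<in>UNIV. \<mu> $ i * (\<Sum>t=1..T. of_bool (snd (A t) = Some i)))
      + (\<Sum>i\<in>UNIV. \<mu> $ i * max 0 (\<rho> $ i * real T - (\<Sum>t=1..T. of_bool (snd (A t) = Some i))))"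
    by (simp add: zb distrib_left sum.distrib)
qed

text \<open>The increments are centred and independent of the past, so the cross term vanishes and
  each period adds at most 1 to the second moment.\<close>

lemma mean_tied_deviation_square:
  fixes i :: 'n
  defines "dev \<equiv> \<lambda>n \<omega>. \<Sum>t=1..n. of_bool (snd (arrivals \<omega> t) = Some i) - tied i"
  assumes "n \<le> T"
  shows "integrable runs (\<lambda>\<omega>. (dev n \<omega>)\<^sup>2) \<and> mean (\<lambda>\<omega>. (dev n \<omega>)\<^sup>2) \<le> real n"
  using assms(2)
proof (induction n)
  case (Suc n)
  then have IH: "integrable runs (\<lambda>\<omega>. (dev n \<omega>)\<^sup>2)" "mean (\<lambda>\<omega>. (dev n \<omega>)\<^sup>2) \<le> real n" by auto
  have t: "Suc n \<in> {1..T}" using Suc.prems by auto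
  define h where "h a = of_bool (snd a = Some i) - tied i" for a :: "'n case_type"
  have tied1: "tied i \<le> 1" by (simp add: tied_def)
  have h: "\<bar>h a\<bar> \<le> 1" for a using tied1 tied_bounds(1)[of i] by (auto simp: h_def)
  have h_meas: "h \<in> borel_measurable F" unfolding h_def by measurable
  have h_int: "integrable F h" using h h_meas by (intro integrable_const_bound[where B = 1]) auto
  have h_mean: "(\<integral>a. h a \<partial>F) = 0" unfolding h_def using tied_integrable by (simp add: tied_eq prob_space)
  have dev_Suc: "dev (Suc n) \<omega> = dev n \<omega> + h (arrivals \<omega> (Suc n))" for \<omega>
    by (simp add: dev_def h_def)
  have past: "past (Suc n) (dev n)"
  proof (rule pastI[where B = "real n"])
    show "dev n \<in> borel_measurable runs"
      unfolding dev_def h_def[symmetric] using Suc.prems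
      by (intro borel_measurable_sum measurable_compose[OF case_measurable h_meas]) auto
    show "\<bar>dev n \<omega>\<bar> \<le> real n" for \<omega>
    proof -
      have "\<bar>dev n \<omega>\<bar> \<le> (\<Sum>t=1..n. \<bar>h (arrivals \<omega> t)\<bar>)" unfolding dev_def h_def by (rule sum_abs)
      also have "\<dots> \<le> (\<Sum>t=1..n. 1)" by (intro sum_mono h)
      finally show ?thesis by simp
    qed
    show "dev n \<omega> = dev n \<omega>'" if "\<And>\<tau>. \<tau> \<in> {1..<Suc n} \<Longrightarrow> arrivals \<omega> \<tau> = arrivals \<omega>' \<tau>" for \<omega> \<omega>'
      unfolding dev_def using that by (intro sum.cong) auto
  qed
  note cross = case_independent[OF t past h_int]
  have hm: "(\<lambda>\<omega>. (h (arrivals \<omega> (Suc n)))\<^sup>2) \<in> borel_measurable runs"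
    by (intro borel_measurable_power measurable_compose[OF case_measurable[OF t] h_meas])
  have h2: "(h a)\<^sup>2 \<le> 1" for a using h[of a] by (simp add: abs_square_le_1)
  have sq: "integrable runs (\<lambda>\<omega>. (h (arrivals \<omega> (Suc n)))\<^sup>2)"
    using hm h2 by (intro integrable_bounded[where B = 1]) auto
  have "mean (\<lambda>\<omega>. (h (arrivals \<omega> (Suc n)))\<^sup>2) \<le> mean (\<lambda>\<omega>. 1)"
    using sq h2 by (intro integral_mono) auto
  then have sq1: "mean (\<lambda>\<omega>. (h (arrivals \<omega> (Suc n)))\<^sup>2) \<le> 1" by (simp add: O.prob_space)
  have expand: "(dev (Suc n) \<omega>)\<^sup>2
      = (dev n \<omega>)\<^sup>2 + 2 * (dev n \<omega> * h (arrivals \<omega> (Suc n))) + (h (arrivals \<omega> (Suc n)))\<^sup>2" for \<omega>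
    by (simp add: dev_Suc power2_eq_square algebra_simps)
  show ?case unfolding expand using IH cross sq sq1 h_mean by simp
qed (simp add: dev_def)

text \<open>The source of \<open>sqrt T\<close> in the benchmark: the number of tied cases
  fluctuates around its mean by at most this order, and the positive part makes the fluctuations
  count.\<close>

lemma mean_remaining_capacity_le:
  fixes i :: 'n
  defines "free \<equiv> \<lambda>\<omega>. max 0 (\<rho> $ i * real T - (\<Sum>t=1..T. of_bool (snd (arrivals \<omega> t) = Some i)))"
  shows "integrable runs free" "mean free \<le> (\<rho> $ i - tied i) * real T + sqrt (real T)"
proof -
  define dev where "dev \<omega> = (\<Sum>t=1..T. of_bool (snd (arrivals \<omega> t) = Some i) - tied i)" for \<omega>
  have dev2: "integrable runs (\<lambda>\<omega>. (dev \<omega>)\<^sup>2)" "mean (\<lambda>\<omega>. (dev \<omega>)\<^sup>2) \<le> real T"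
    using mean_tied_deviation_square[of T i] by (auto simp: dev_def)
  have h: "integrable F (\<lambda>a. of_bool (snd a = Some i) - tied i)" using tied_integrable by auto
  have pconst: "past t (\<lambda>_. 1)" for t by (rule pastI[where B = 1]) auto
  have each: "integrable runs (\<lambda>\<omega>. of_bool (snd (arrivals \<omega> t) = Some i) - tied i)"
    "mean (\<lambda>\<omega>. of_bool (snd (arrivals \<omega> t) = Some i) - tied i) = 0" if "t \<in> {1..T}" for t
    using case_independent[OF that pconst h] tied_integrable
    by (auto simp: tied_eq prob_space O.prob_space)
  have dev_int: "integrable runs dev" unfolding dev_def by (intro Bochner_Integration.integrable_sum each)
  have dev_mean: "mean dev = 0" unfolding dev_def using each by (subst Bochner_Integration.integral_sum) auto
  have rT: "0 < sqrt (real T)" using T_pos by simp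
  have free_dev: "free \<omega> = max 0 ((\<rho> $ i - tied i) * real T - dev \<omega>)" for \<omega>
    by (simp add: free_def dev_def sum_subtractf algebra_simps)
  have bound: "free \<omega> \<le> (\<rho> $ i - tied i) * real T - dev \<omega> + ((dev \<omega>)\<^sup>2 / sqrt (real T) + sqrt (real T)) / 2" for \<omega>
  proof -
    \<comment> \<open>Arithmetic-geometric mean inequality; the weight \<open>sqrt T\<close> turns
      the second moment bound \<open>T\<close> into a first moment bound.\<close>
    have "0 \<le> (\<bar>dev \<omega>\<bar> - sqrt (real T))\<^sup>2" by simp
    then have "2 * \<bar>dev \<omega>\<bar> * sqrt (real T) \<le> (dev \<omega>)\<^sup>2 + real T"
      by (simp add: power2_eq_square algebra_simps)
    then have "\<bar>dev \<omega>\<bar> \<le> ((dev \<omega>)\<^sup>2 / sqrt (real T) + sqrt (real T)) / 2"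
      using rT by (simp add: field_simps)
    moreover have "0 \<le> (\<rho> $ i - tied i) * real T" using tied_bounds[of i] d_pos by (intro mult_nonneg_nonneg) auto
    then have "free \<omega> \<le> (\<rho> $ i - tied i) * real T - dev \<omega> + \<bar>dev \<omega>\<bar>"
      unfolding free_dev by (simp add: max_def)
    ultimately show ?thesis by linarith
  qed
  show int: "integrable runs free"
    unfolding free_dev using dev_int by (intro Bochner_Integration.integrable_max) auto
  have "mean free \<le> mean (\<lambda>\<omega>. (\<rho> $ i - tied i) * real T - dev \<omega> + ((dev \<omega>)\<^sup>2 / sqrt (real T) + sqrt (real T)) / 2)"
    using int dev_int dev2(1) bound by (intro integral_mono) auto
  also have "\<dots> = (\<rho> $ i - tied i) * real T + (mean (\<lambda>\<omega>. (dev \<omega>)\<^sup>2) / sqrt (real T) + sqrt (real T)) / 2"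
    using dev_int dev2(1) by (simp add: dev_mean O.prob_space)
  also have "\<dots> \<le> (\<rho> $ i - tied i) * real T + (real T / sqrt (real T) + sqrt (real T)) / 2"
    using dev2(2) rT by (intro add_left_mono divide_right_mono add_right_mono) auto
  also have "\<dots> = (\<rho> $ i - tied i) * real T + sqrt (real T)" by (simp add: real_div_sqrt)
  finally show "mean free \<le> (\<rho> $ i - tied i) * real T + sqrt (real T)" .
qed

section \<open>Totals over the horizon\<close>

text \<open>The error separating the two bounds on the reward: \<open>CARD('n)\<close> for the
  overshoot of active periods at prices up to 1, then 1 for the near-optimality of the static
  policy, the error of the dual variables, and the squared increments of the backlog.\<close>

definition slackness :: real where
  "slackness = real CARD('n) + 1 + cadl_path.dual_const \<rho> \<alpha> * (1 / \<eta> + \<eta> * real T)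
     + \<zeta> * real CARD('n) * real T / 2"

lemma mean_ALG_bounds:
  fixes V :: real and \<mu> :: "real^'n"
  assumes V: "V \<le> 1" and \<mu>: "\<And>i. 0 \<le> \<mu> $ i" "\<And>i. \<mu> $ i \<le> 1"
    and dual: "(\<integral>a. profit \<mu> a \<partial>F) \<le> V - \<mu> \<bullet> \<rho>"
    and primal: "\<And>\<delta>. 0 < \<delta> \<Longrightarrow> \<exists>y\<in>policies. (\<forall>i. (\<integral>a. y a $ i \<partial>F) \<le> \<rho> $ i) \<and> V - \<delta> < (\<integral>a. fst a \<bullet> y a \<partial>F)"
  defines "m \<equiv> real CARD('n)"
    and "reward \<equiv> \<Sum>t=1..T. mean (\<lambda>\<omega>. P.act \<omega> t * (wt \<omega> t \<bullet> P.z \<omega> t))"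
    and "backlogs \<equiv> \<Sum>t=1..T. \<Sum>i\<in>UNIV. mean (\<lambda>\<omega>. bl \<omega> t $ i)"
  shows "V * real T + \<alpha> * mean (\<lambda>\<omega>. P.idle \<omega>) - slackness + m \<le> reward"
    and "\<zeta> * \<epsilon> * backlogs \<le> slackness"
proof -
  define N where "N = mean (\<lambda>\<omega>. P.idle \<omega>)"
  define R where "R = cadl_path.dual_const \<rho> \<alpha> * (1 / \<eta> + \<eta> * real T)"
  have act_int: "integrable runs (\<lambda>\<omega>. P.act \<omega> t)" if "t \<in> {1..T}" for t
    by (rule past_integrable[OF past_state(1)[OF that]])
  have N_eq: "(\<Sum>t=1..T. mean (\<lambda>\<omega>. P.act \<omega> t)) = real T - N"
  proof -
    have "N = (\<Sum>t=1..T. mean (\<lambda>\<omega>. 1 - P.act \<omega> t))"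
      unfolding N_def P.idle_def using act_int by (intro Bochner_Integration.integral_sum) auto
    also have "\<dots> = (\<Sum>t=1..T. 1 - mean (\<lambda>\<omega>. P.act \<omega> t))"
      using act_int by (intro sum.cong) (auto simp: O.prob_space)
    finally show ?thesis by (simp add: sum_subtractf)
  qed
  have idle_int: "integrable runs (\<lambda>\<omega>. P.idle \<omega>)"
    unfolding P.idle_def using act_int by (intro Bochner_Integration.integrable_sum) auto
  have N0: "0 \<le> N" unfolding N_def using P.idle_nonneg by (intro integral_nonneg_AE) auto
  \<comment> \<open>A loss of \<open>1 / T\<close> per period sums to at most 1.\<close>
  obtain y where y: "y \<in> policies" "\<And>i. (\<integral>a. y a $ i \<partial>F) \<le> \<rho> $ i" "V - 1 / real T \<le> (\<integral>a. fst a \<bullet> y a \<partial>F)"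
    using primal[of "1 / real T"] T_pos by force
  have duals: "(\<Sum>t=1..T. mean (\<lambda>\<omega>. P.act \<omega> t * (duals \<omega> t \<bullet> (P.z \<omega> t - \<rho>)))) \<ge> (1 + 2 * \<alpha>) * N - R"
  proof -
    have int: "integrable runs (\<lambda>\<omega>. P.act \<omega> t * (duals \<omega> t \<bullet> (P.z \<omega> t - \<rho>)))" if "t \<in> {1..T}" for t
      using that by (intro integrable_active_inner past_duals)
    have "(1 + 2 * \<alpha>) * N - R = mean (\<lambda>\<omega>. (1 + 2 * \<alpha>) * P.idle \<omega> - R)"
      using idle_int by (simp add: N_def O.prob_space)
    also have "\<dots> \<le> mean (\<lambda>\<omega>. \<Sum>t=1..T. P.act \<omega> t * (duals \<omega> t \<bullet> (P.z \<omega> t - \<rho>)))"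
      using idle_int int P.dual_regret
      by (intro integral_mono Bochner_Integration.integrable_sum) (auto simp: R_def)
    also have "\<dots> = (\<Sum>t=1..T. mean (\<lambda>\<omega>. P.act \<omega> t * (duals \<omega> t \<bullet> (P.z \<omega> t - \<rho>))))"
      using int by (intro Bochner_Integration.integral_sum) auto
    finally show ?thesis .
  qed
  have drift: "(\<Sum>t=1..T. mean (\<lambda>\<omega>. P.act \<omega> t * (bl \<omega> t \<bullet> (P.z \<omega> t - \<rho>)))) \<ge> \<epsilon> * backlogs - m * real T / 2"
  proof -
    have int: "integrable runs (\<lambda>\<omega>. bl \<omega> t $ i * (P.z \<omega> t $ i - of_bool (services \<omega> t i)))" if t: "t \<in> {1..T}" for t i
      unfolding right_diff_distrib
      using integrable_match_mult[OF t past_state(5)[OF t]] service_independent(2)[OF t past_state(5)[OF t]]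
      by (intro Bochner_Integration.integrable_diff)
    have int': "integrable runs (\<lambda>\<omega>. P.act \<omega> t * (bl \<omega> t $ i * (P.z \<omega> t $ i - \<rho> $ i)))" if t: "t \<in> {1..T}" for t i
    proof -
      note ab = past_mult[OF past_state(1)[OF t] past_state(5)[OF t, of i]]
      have "integrable runs (\<lambda>\<omega>. P.act \<omega> t * bl \<omega> t $ i * P.z \<omega> t $ i - P.act \<omega> t * bl \<omega> t $ i * \<rho> $ i)"
        using integrable_match_mult[OF t ab] past_integrable[OF ab]
        by (intro Bochner_Integration.integrable_diff integrable_mult_left)
      then show ?thesis by (simp only: right_diff_distrib mult.assoc)
    qed
    have each: "(\<Sum>t=1..T. mean (\<lambda>\<omega>. bl \<omega> t $ i * (P.z \<omega> t $ i - of_bool (services \<omega> t i)))) \<ge> - real T / 2" for i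
    proof -
      have "- real T / 2 = mean (\<lambda>\<omega>. - real T / 2)" by (simp add: O.prob_space)
      also have "\<dots> \<le> mean (\<lambda>\<omega>. \<Sum>t=1..T. bl \<omega> t $ i * (P.z \<omega> t $ i - of_bool (services \<omega> t i)))"
        using int P.backlog_drift by (intro integral_mono Bochner_Integration.integrable_sum) auto
      also have "\<dots> = (\<Sum>t=1..T. mean (\<lambda>\<omega>. bl \<omega> t $ i * (P.z \<omega> t $ i - of_bool (services \<omega> t i))))"
        using int by (intro Bochner_Integration.integral_sum) auto
      finally show ?thesis .
    qed
    have "\<epsilon> * backlogs - m * real T / 2 = \<epsilon> * backlogs + (\<Sum>i\<in>(UNIV :: 'n set). - real T / 2)" by (simp add: m_def)
    also have "\<dots> \<le> \<epsilon> * backlogs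
        + (\<Sum>i\<in>UNIV. \<Sum>t=1..T. mean (\<lambda>\<omega>. bl \<omega> t $ i * (P.z \<omega> t $ i - of_bool (services \<omega> t i))))"
      by (intro add_left_mono sum_mono each)
    also have "\<dots> = (\<Sum>t=1..T. \<Sum>i\<in>UNIV. \<epsilon> * mean (\<lambda>\<omega>. bl \<omega> t $ i)
        + mean (\<lambda>\<omega>. bl \<omega> t $ i * (P.z \<omega> t $ i - of_bool (services \<omega> t i))))"
      unfolding backlogs_def sum.distrib sum_distrib_left
      by (intro arg_cong2[where f = plus] refl sum.swap)
    also have "\<dots> \<le> (\<Sum>t=1..T. \<Sum>i\<in>UNIV. mean (\<lambda>\<omega>. P.act \<omega> t * (bl \<omega> t $ i * (P.z \<omega> t $ i - \<rho> $ i))))"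
      by (intro sum_mono mean_backlog_drift)
    also have "\<dots> = (\<Sum>t=1..T. mean (\<lambda>\<omega>. P.act \<omega> t * (bl \<omega> t \<bullet> (P.z \<omega> t - \<rho>))))"
    proof (intro sum.cong refl)
      fix t assume t: "t \<in> {1..T}"
      show "(\<Sum>i\<in>UNIV. mean (\<lambda>\<omega>. P.act \<omega> t * (bl \<omega> t $ i * (P.z \<omega> t $ i - \<rho> $ i))))
          = mean (\<lambda>\<omega>. P.act \<omega> t * (bl \<omega> t \<bullet> (P.z \<omega> t - \<rho>)))"
        unfolding inner_vec_def inner_real_def sum_distrib_left vector_minus_component
        using int'[OF t] by (subst Bochner_Integration.integral_sum) auto
    qed
    finally show ?thesis .
  qed
  have lower: "reward \<ge> (V - 1 / real T) * (real T - N) + ((1 + 2 * \<alpha>) * N - R) + \<zeta> * (\<epsilon> * backlogs - m * real T / 2)"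
  proof -
    have "(V - 1 / real T) * (real T - N) + ((1 + 2 * \<alpha>) * N - R) + \<zeta> * (\<epsilon> * backlogs - m * real T / 2)
        \<le> (V - 1 / real T) * (real T - N) + (\<Sum>t=1..T. mean (\<lambda>\<omega>. P.act \<omega> t * (duals \<omega> t \<bullet> (P.z \<omega> t - \<rho>))))
          + \<zeta> * (\<Sum>t=1..T. mean (\<lambda>\<omega>. P.act \<omega> t * (bl \<omega> t \<bullet> (P.z \<omega> t - \<rho>))))"
      using duals mult_left_mono[OF drift less_imp_le[OF \<zeta>_pos]] by linarith
    also have "\<dots> = (\<Sum>t=1..T. (V - 1 / real T) * mean (\<lambda>\<omega>. P.act \<omega> t)
        + mean (\<lambda>\<omega>. P.act \<omega> t * (duals \<omega> t \<bullet> (P.z \<omega> t - \<rho>)))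
        + \<zeta> * mean (\<lambda>\<omega>. P.act \<omega> t * (bl \<omega> t \<bullet> (P.z \<omega> t - \<rho>))))"
      unfolding sum.distrib sum_distrib_left[symmetric] N_eq ..
    also have "\<dots> \<le> reward"
      unfolding reward_def using y by (intro sum_mono mean_active_reward_ge) auto
    finally show ?thesis .
  qed
  have upper: "reward \<le> V * (real T - N) + N + m"
  proof -
    have "reward \<le> (\<Sum>t=1..T. (V - \<mu> \<bullet> \<rho>) * mean (\<lambda>\<omega>. P.act \<omega> t)
        + (\<Sum>i\<in>UNIV. \<mu> $ i * mean (\<lambda>\<omega>. P.act \<omega> t * P.z \<omega> t $ i)))"
      unfolding reward_def by (intro sum_mono mean_active_reward_le dual)
    also have "\<dots> = (V - \<mu> \<bullet> \<rho>) * (real T - N)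
        + (\<Sum>t=1..T. \<Sum>i\<in>UNIV. \<mu> $ i * mean (\<lambda>\<omega>. P.act \<omega> t * P.z \<omega> t $ i))"
      unfolding sum.distrib sum_distrib_left[symmetric] N_eq ..
    also have "(\<Sum>t=1..T. \<Sum>i\<in>UNIV. \<mu> $ i * mean (\<lambda>\<omega>. P.act \<omega> t * P.z \<omega> t $ i))
        = (\<Sum>i\<in>UNIV. \<mu> $ i * (\<Sum>t=1..T. mean (\<lambda>\<omega>. P.act \<omega> t * P.z \<omega> t $ i)))"
      unfolding sum_distrib_left by (rule sum.swap)
    also have "\<dots> \<le> (\<Sum>i\<in>UNIV. \<mu> $ i * (\<rho> $ i * real T + 1))"
    proof (intro sum_mono mult_left_mono \<mu>)
      fix i
      have int: "integrable runs (\<lambda>\<omega>. P.act \<omega> t * P.z \<omega> t $ i)" if "t \<in> {1..T}" for t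
        by (rule integrable_match_mult[OF that past_state(1)[OF that]])
      have "(\<Sum>t=1..T. mean (\<lambda>\<omega>. P.act \<omega> t * P.z \<omega> t $ i)) = mean (\<lambda>\<omega>. \<Sum>t=1..T. P.act \<omega> t * P.z \<omega> t $ i)"
        using int by (intro Bochner_Integration.integral_sum[symmetric]) auto
      also have "\<dots> \<le> mean (\<lambda>\<omega>. \<rho> $ i * real T + 1)"
        using int by (intro integral_mono Bochner_Integration.integrable_sum P.active_consumption) auto
      finally show "(\<Sum>t=1..T. mean (\<lambda>\<omega>. P.act \<omega> t * P.z \<omega> t $ i)) \<le> \<rho> $ i * real T + 1" by (simp add: O.prob_space)
    qed
    also have "(\<Sum>i\<in>UNIV. \<mu> $ i * (\<rho> $ i * real T + 1)) = \<mu> \<bullet> \<rho> * real T + (\<Sum>i\<in>UNIV. \<mu> $ i)"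
      by (simp add: inner_vec_def distrib_left sum.distrib sum_distrib_right mult.assoc)
    also have "(\<Sum>i\<in>UNIV. \<mu> $ i) \<le> m" using sum_mono[of UNIV "\<lambda>i. \<mu> $ i" "\<lambda>_. 1"] \<mu>(2) by (simp add: m_def)
    finally have "reward \<le> V * (real T - N) + \<mu> \<bullet> \<rho> * N + m" by (simp add: algebra_simps)
    \<comment> \<open>The full capacity is priced although only active periods are counted; the
      surplus is at most \<open>N\<close>, as prices are at most 1 and the ratios sum to at most
      1.\<close>
    moreover have "\<mu> \<bullet> \<rho> \<le> 1"
    proof -
      have "\<mu> \<bullet> \<rho> \<le> (\<Sum>i\<in>UNIV. 1 * \<rho> $ i)"
        unfolding inner_vec_def inner_real_def using \<mu>(2) \<rho>_pos by (intro sum_mono mult_right_mono) (auto intro: less_imp_le)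
      then show ?thesis using sum_\<rho> by simp
    qed
    then have "\<mu> \<bullet> \<rho> * N \<le> N" using N0 mult_right_mono[of "\<mu> \<bullet> \<rho>" 1 N] by simp
    ultimately show ?thesis by linarith
  qed
  have VN: "(V - 1 / real T) * (real T - N) \<ge> V * (real T - N) - 1"
  proof -
    have "1 / real T * (real T - N) \<le> 1" using N0 T_pos by (simp add: field_simps)
    then show ?thesis by (simp add: left_diff_distrib)
  qed
  have slack_eq: "slackness = m + 1 + R + \<zeta> * (m * real T / 2)" by (simp add: slackness_def m_def R_def)
  have \<alpha>N: "0 \<le> \<alpha> * N" using \<alpha>_nonneg N0 by simp
  have backlogs0: "0 \<le> \<zeta> * (\<epsilon> * backlogs)"
    unfolding backlogs_def using \<zeta>_pos \<epsilon>_pos P.backlog_bounds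
    by (intro mult_nonneg_nonneg sum_nonneg integral_nonneg_AE) auto
  \<comment> \<open>One \<open>N\<close> out of \<open>(1 + 2 * \<alpha>) N\<close> makes up for the
    value lost in inactive periods.\<close>
  have "V * N \<le> N" using mult_right_mono[OF V N0] by simp
  then show "V * real T + \<alpha> * mean (\<lambda>\<omega>. P.idle \<omega>) - slackness + m \<le> reward"
    unfolding N_def[symmetric] using lower VN backlogs0 \<alpha>N by (simp add: slack_eq algebra_simps)
  \<comment> \<open>\<open>V (T - N)\<close> occurs in both bounds, and the \<open>N\<close> of the
    upper one is covered by \<open>(1 + 2 * \<alpha>) N\<close> in the lower one.\<close>
  show "\<zeta> * \<epsilon> * backlogs \<le> slackness"
    using lower upper VN \<alpha>N by (simp add: slack_eq algebra_simps)
qed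

text \<open>If the regret is not integrable, its integral is the junk value \<open>0\<close>, which the nonnegative
  bound dominates.\<close>

lemma regret_le:
  "(\<integral>(u, A, s). OPT T \<rho> \<alpha> \<gamma> A s - ALG T \<rho> \<alpha> \<eta> \<zeta> (\<kappa> u) A s \<gamma> \<partial>sample_space T U F r)
     \<le> real CARD('n) * (sqrt (real T) + \<alpha> + \<gamma>) + slackness + \<gamma> * (slackness / (\<zeta> * \<epsilon> * real T))"
proof -
  define m where "m = real CARD('n)"
  define gap where "gap \<omega> = OPT T \<rho> \<alpha> \<gamma> (arrivals \<omega>) (services \<omega>)
      - ALG T \<rho> \<alpha> \<eta> \<zeta> (\<kappa> (fst \<omega>)) (arrivals \<omega>) (services \<omega>) \<gamma>" for \<omega>
  obtain V \<mu> where V: "V \<le> 1" and \<mu>: "\<And>i. 0 \<le> \<mu> $ i" "\<And>i. \<mu> $ i \<le> 1"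
    and dual: "(\<integral>a. profit \<mu> a \<partial>F) \<le> V - \<mu> \<bullet> \<rho>"
    and primal: "\<And>\<delta>. 0 < \<delta> \<Longrightarrow> \<exists>y\<in>policies. (\<forall>i. (\<integral>a. y a $ i \<partial>F) \<le> \<rho> $ i) \<and> V - \<delta> < (\<integral>a. fst a \<bullet> y a \<partial>F)"
    using fluid_duality by blast
  note bounds = mean_ALG_bounds[OF V \<mu> dual primal]
  define reward where "reward = (\<Sum>t=1..T. mean (\<lambda>\<omega>. P.act \<omega> t * (wt \<omega> t \<bullet> P.z \<omega> t)))"
  define backlogs where "backlogs = (\<Sum>t=1..T. \<Sum>i\<in>UNIV. mean (\<lambda>\<omega>. bl \<omega> t $ i))"
  define N where "N = mean (\<lambda>\<omega>. P.idle \<omega>)"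
  have lower: "V * real T + \<alpha> * N - slackness + m \<le> reward"
    using bounds(1) by (simp add: N_def m_def reward_def)
  have bls: "\<zeta> * \<epsilon> * backlogs \<le> slackness" using bounds(2) by (simp add: backlogs_def)
  define count where "count \<omega> i = (\<Sum>t=1..T. of_bool (snd (arrivals \<omega> t) = Some i) :: real)" for \<omega> i
  \<comment> \<open>\<open>G\<close> majorizes the benchmark on every path, \<open>S\<close> is the
    reward of active periods, and \<open>B\<close> is the backlog with its one-step margin.
    \<open>H\<close> combines them into an integrable almost-everywhere bound on \<open>gap\<close>,
    whose own integrability is left open.\<close>
  define G where "G \<omega> = (\<Sum>t=1..T. profit \<mu> (arrivals \<omega> t)) + (\<Sum>i\<in>UNIV. \<mu> $ i * count \<omega> i)
      + (\<Sum>i\<in>UNIV. \<mu> $ i * max 0 (\<rho> $ i * real T - count \<omega> i))" for \<omega>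
  define S where "S \<omega> = (\<Sum>t=1..T. P.act \<omega> t * (wt \<omega> t \<bullet> P.z \<omega> t))" for \<omega>
  define B where "B \<omega> = (\<Sum>t=1..T. \<Sum>i\<in>UNIV. bl \<omega> t $ i + 1)" for \<omega>
  define H where "H \<omega> = G \<omega> - S \<omega> + \<alpha> * (m + P.idle \<omega>) + \<gamma> / real T * B \<omega>" for \<omega>
  have pconst: "past t (\<lambda>_. 1)" for t by (rule pastI[where B = 1]) auto
  have profit_int: "integrable runs (\<lambda>\<omega>. profit \<mu> (arrivals \<omega> t))"
    "mean (\<lambda>\<omega>. profit \<mu> (arrivals \<omega> t)) = (\<integral>a. profit \<mu> a \<partial>F)" if "t \<in> {1..T}" for t
    using case_independent[OF that pconst integrable_profit_best] by (simp_all add: O.prob_space)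
  have count_int: "integrable runs (\<lambda>\<omega>. count \<omega> i)" "mean (\<lambda>\<omega>. count \<omega> i) = tied i * real T" for i
  proof -
    have *: "integrable runs (\<lambda>\<omega>. of_bool (snd (arrivals \<omega> t) = Some i) :: real)"
      "mean (\<lambda>\<omega>. of_bool (snd (arrivals \<omega> t) = Some i)) = tied i" if "t \<in> {1..T}" for t
      using case_independent[OF that pconst tied_integrable] by (simp_all add: O.prob_space tied_eq)
    show "integrable runs (\<lambda>\<omega>. count \<omega> i)" unfolding count_def using * by (intro Bochner_Integration.integrable_sum)
    show "mean (\<lambda>\<omega>. count \<omega> i) = tied i * real T"
      unfolding count_def using * by (subst Bochner_Integration.integral_sum) auto
  qed
  have free_int: "integrable runs (\<lambda>\<omega>. max 0 (\<rho> $ i * real T - count \<omega> i))"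
    "mean (\<lambda>\<omega>. max 0 (\<rho> $ i * real T - count \<omega> i)) \<le> (\<rho> $ i - tied i) * real T + sqrt (real T)" for i
    using mean_remaining_capacity_le[of i] by (simp_all add: count_def)
  have idle_int: "integrable runs (\<lambda>\<omega>. P.idle \<omega>)"
    unfolding P.idle_def by (intro Bochner_Integration.integrable_sum past_integrable[OF past_state(2)])
  have bl_int: "integrable runs (\<lambda>\<omega>. bl \<omega> t $ i)" if "t \<in> {1..T}" for t i
    by (rule past_integrable[OF past_state(5)[OF that]])
  note reward_int = integrable_active_reward
  have G_parts_int: "integrable runs (\<lambda>\<omega>. \<Sum>t=1..T. profit \<mu> (arrivals \<omega> t))"
    "integrable runs (\<lambda>\<omega>. \<Sum>i\<in>UNIV. \<mu> $ i * count \<omega> i)"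
    "integrable runs (\<lambda>\<omega>. \<Sum>i\<in>UNIV. \<mu> $ i * max 0 (\<rho> $ i * real T - count \<omega> i))"
    by (intro Bochner_Integration.integrable_sum integrable_mult_right profit_int count_int free_int; assumption)+
  then have G_int: "integrable runs G"
    unfolding G_def by (intro Bochner_Integration.integrable_add)
  have G_mean: "mean G \<le> V * real T + m * sqrt (real T)"
  proof -
    have "mean G = (\<Sum>t=1..T. mean (\<lambda>\<omega>. profit \<mu> (arrivals \<omega> t))) + (\<Sum>i\<in>UNIV. \<mu> $ i * mean (\<lambda>\<omega>. count \<omega> i))
        + (\<Sum>i\<in>UNIV. \<mu> $ i * mean (\<lambda>\<omega>. max 0 (\<rho> $ i * real T - count \<omega> i)))"
    proof -
      have "mean (\<lambda>\<omega>. \<Sum>t=1..T. profit \<mu> (arrivals \<omega> t)) = (\<Sum>t=1..T. mean (\<lambda>\<omega>. profit \<mu> (arrivals \<omega> t)))"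
        by (intro Bochner_Integration.integral_sum profit_int)
      moreover have "mean (\<lambda>\<omega>. \<Sum>i\<in>UNIV. \<mu> $ i * count \<omega> i) = (\<Sum>i\<in>UNIV. \<mu> $ i * mean (\<lambda>\<omega>. count \<omega> i))"
        using count_int by (subst Bochner_Integration.integral_sum) auto
      moreover have "mean (\<lambda>\<omega>. \<Sum>i\<in>UNIV. \<mu> $ i * max 0 (\<rho> $ i * real T - count \<omega> i))
          = (\<Sum>i\<in>UNIV. \<mu> $ i * mean (\<lambda>\<omega>. max 0 (\<rho> $ i * real T - count \<omega> i)))"
        using free_int by (subst Bochner_Integration.integral_sum) auto
      ultimately show ?thesis
        unfolding G_def using G_parts_int
        by (simp only: Bochner_Integration.integral_add Bochner_Integration.integrable_add)
    qed
    also have "\<dots> \<le> (\<Sum>t=1..T. V - \<mu> \<bullet> \<rho>) + (\<Sum>i\<in>UNIV. \<mu> $ i * (tied i * real T))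
        + (\<Sum>i\<in>UNIV. \<mu> $ i * ((\<rho> $ i - tied i) * real T + sqrt (real T)))"
      using profit_int dual count_int free_int \<mu> by (intro add_mono sum_mono mult_left_mono) auto
    \<comment> \<open>The terms with \<open>tied i\<close> cancel, and
      \<open>\<mu> \<bullet> \<rho> T\<close> cancels against the profit.\<close>
    also have "\<dots> = V * real T + (\<Sum>i\<in>UNIV. \<mu> $ i) * sqrt (real T)"
      by (simp add: inner_vec_def algebra_simps sum.distrib sum_subtractf sum_distrib_left sum_distrib_right)
    also have "(\<Sum>i\<in>UNIV. \<mu> $ i) * sqrt (real T) \<le> m * sqrt (real T)"
      using sum_mono[of UNIV "\<lambda>i. \<mu> $ i" "\<lambda>_. 1"] \<mu>(2) by (intro mult_right_mono) (auto simp: m_def)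
    finally show ?thesis by simp
  qed
  have sums_int: "integrable runs S" "integrable runs B"
    unfolding S_def B_def
    by (intro Bochner_Integration.integrable_sum Bochner_Integration.integrable_add reward_int bl_int
        O.integrable_const; assumption)+
  have H_int: "integrable runs H"
    unfolding H_def using G_int sums_int idle_int
    by (intro Bochner_Integration.integrable_add Bochner_Integration.integrable_diff integrable_mult_right) auto
  have sums_mean: "mean S = reward" "mean B = backlogs + m * real T"
  proof -
    show "mean S = reward"
      unfolding reward_def S_def by (intro Bochner_Integration.integral_sum reward_int)
    have "mean B = (\<Sum>t=1..T. mean (\<lambda>\<omega>. \<Sum>i\<in>UNIV. bl \<omega> t $ i + 1))"
      unfolding B_def
      by (intro Bochner_Integration.integral_sum Bochner_Integration.integrable_sum
          Bochner_Integration.integrable_add bl_int O.integrable_const)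
    also have "\<dots> = (\<Sum>t=1..T. \<Sum>i\<in>UNIV. mean (\<lambda>\<omega>. bl \<omega> t $ i) + 1)"
    proof (intro sum.cong refl)
      fix t assume t: "t \<in> {1..T}"
      show "mean (\<lambda>\<omega>. \<Sum>i\<in>UNIV. bl \<omega> t $ i + 1) = (\<Sum>i\<in>UNIV. mean (\<lambda>\<omega>. bl \<omega> t $ i) + 1)"
        using bl_int[OF t] by (subst Bochner_Integration.integral_sum) (auto simp: O.prob_space)
    qed
    also have "\<dots> = backlogs + m * real T" by (simp add: backlogs_def m_def sum.distrib)
    finally show "mean B = backlogs + m * real T" .
  qed
  have H_mean: "mean H = mean G - reward + \<alpha> * (m + N) + \<gamma> / real T * (backlogs + m * real T)"
    unfolding H_def using G_int sums_int idle_int sums_mean by (simp add: N_def O.prob_space)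
  have slack0: "0 \<le> slackness"
  proof -
    have "0 \<le> P.lam_max" using P.lam_max_ge_1 by linarith
    then have "0 \<le> cadl_path.dual_const \<rho> \<alpha>" unfolding P.dual_const_def
      using \<alpha>_nonneg by (intro mult_nonneg_nonneg add_nonneg_nonneg) auto
    then show ?thesis using \<eta> \<zeta>_pos by (simp add: slackness_def)
  qed
  have \<gamma>_bls: "\<gamma> / real T * backlogs \<le> \<gamma> * (slackness / (\<zeta> * \<epsilon> * real T))"
  proof -
    have "backlogs \<le> slackness / (\<zeta> * \<epsilon>)" using bls \<zeta>_pos \<epsilon>_pos by (simp add: pos_le_divide_eq mult.commute)
    then have "\<gamma> / real T * backlogs \<le> \<gamma> / real T * (slackness / (\<zeta> * \<epsilon>))"
      using \<gamma>_nonneg by (intro mult_left_mono) auto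
    then show ?thesis by (simp add: field_simps)
  qed
  have "mean H \<le> m * (sqrt (real T) + \<alpha> + \<gamma>) + slackness + \<gamma> * (slackness / (\<zeta> * \<epsilon> * real T))"
  proof -
    have "\<gamma> / real T * (backlogs + m * real T) = \<gamma> / real T * backlogs + \<gamma> * m"
      using T_pos by (simp add: distrib_left)
    moreover have "0 \<le> m" by (simp add: m_def)
    ultimately show ?thesis using H_mean G_mean lower \<gamma>_bls by (simp add: algebra_simps)
  qed
  moreover have "mean gap \<le> mean H" if "integrable runs gap"
  proof (intro integral_mono_AE that H_int)
    show "AE \<omega> in runs. gap \<omega> \<le> H \<omega>"
      using AE_rewards
    proof eventually_elim
      case (elim \<omega>)
      have "OPT T \<rho> \<alpha> \<gamma> (arrivals \<omega>) (services \<omega>) \<le> G \<omega>"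
        unfolding G_def count_def by (rule OPT_le_dual[OF \<mu>(1)])
      moreover have "ALG T \<rho> \<alpha> \<eta> \<zeta> (\<kappa> (fst \<omega>)) (arrivals \<omega>) (services \<omega>) \<gamma>
          \<ge> (\<Sum>t=1..T. P.act \<omega> t * (wt \<omega> t \<bullet> P.z \<omega> t)) - \<alpha> * (m + P.idle \<omega>)
            - \<gamma> / real T * (\<Sum>t=1..T. \<Sum>i\<in>UNIV. bl \<omega> t $ i + 1)"
        unfolding ALG_def payoff_def
      proof (intro diff_mono)
        \<comment> \<open>Rewards in inactive periods are dropped; they are nonnegative almost
          everywhere.\<close>
        show "(\<Sum>t=1..T. P.act \<omega> t * (wt \<omega> t \<bullet> P.z \<omega> t)) \<le> (\<Sum>t=1..T. \<Sum>i\<in>UNIV. wt \<omega> t $ i * P.z \<omega> t $ i)"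
        proof (rule sum_mono)
          fix t assume "t \<in> {1..T}"
          then have "0 \<le> (\<Sum>i\<in>UNIV. wt \<omega> t $ i * P.z \<omega> t $ i)"
            using elim P.match_bounds by (intro sum_nonneg mult_nonneg_nonneg) auto
          then show "P.act \<omega> t * (wt \<omega> t \<bullet> P.z \<omega> t) \<le> (\<Sum>i\<in>UNIV. wt \<omega> t $ i * P.z \<omega> t $ i)"
            by (simp add: inner_vec_def)
        qed
        show "\<alpha> * (\<Sum>i\<in>UNIV. max 0 ((\<Sum>t=1..T. P.z \<omega> t $ i) - \<rho> $ i * real T)) \<le> \<alpha> * (m + P.idle \<omega>)"
          unfolding m_def by (intro mult_left_mono P.overallocation_le \<alpha>_nonneg)
        show "\<gamma> / real T * (\<Sum>t=1..T. \<Sum>i\<in>UNIV. backlog (P.st \<omega> t) $ i)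
            \<le> \<gamma> / real T * (\<Sum>t=1..T. \<Sum>i\<in>UNIV. bl \<omega> t $ i + 1)"
          using \<gamma>_nonneg by (intro mult_left_mono sum_mono P.backlog_step) auto
      qed
      ultimately show ?case unfolding gap_def H_def S_def B_def by linarith
    qed
  qed
  moreover have "mean gap = 0" if "\<not> integrable runs gap"
    by (rule not_integrable_integral_eq[OF that])
  moreover have "0 \<le> m * (sqrt (real T) + \<alpha> + \<gamma>) + slackness + \<gamma> * (slackness / (\<zeta> * \<epsilon> * real T))"
    using slack0 \<alpha>_nonneg \<gamma>_nonneg \<zeta>_pos \<epsilon>_pos by (simp add: m_def)
  ultimately have "mean gap \<le> m * (sqrt (real T) + \<alpha> + \<gamma>) + slackness + \<gamma> * (slackness / (\<zeta> * \<epsilon> * real T))"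
    by (cases "integrable runs gap") auto
  then show ?thesis unfolding gap_def[abs_def] runs_def m_def by (simp add: case_prod_unfold)
qed

end

section \<open>From fixed horizons to asymptotics\<close>

lemma inverse_sqrt_rate_bounds:
  fixes f :: "nat \<Rightarrow> real"
  assumes pos: "\<forall>\<^sub>F T in sequentially. 0 < f T" and \<Theta>: "f \<in> \<Theta>(\<lambda>T. 1 / sqrt (real T))"
  obtains c1 c2 where "0 < c1" "0 < c2"
    "\<forall>\<^sub>F T in sequentially. c1 / sqrt (real T) \<le> f T \<and> f T \<le> c2 / sqrt (real T)"
proof -
  obtain c2 where c2: "0 < c2" "\<forall>\<^sub>F T in sequentially. norm (f T) \<le> c2 * norm (1 / sqrt (real T))"
    using landau_o.bigE[OF bigthetaD1[OF \<Theta>]] by blast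
  obtain c1 where c1: "0 < c1" "\<forall>\<^sub>F T in sequentially. norm (f T) \<ge> c1 * norm (1 / sqrt (real T))"
    using landau_omega.bigE[OF bigthetaD2[OF \<Theta>]] by blast
  have "\<forall>\<^sub>F T in sequentially. c1 / sqrt (real T) \<le> f T \<and> f T \<le> c2 / sqrt (real T)"
    using pos c1(2) c2(2) by eventually_elim simp
  with c1(1) c2(1) show ?thesis by (rule that)
qed

text \<open>A bound for a single horizon. Its constant is free of \<open>T\<close>, \<gamma>,
  \<epsilon> and \<open>F\<close>, so it survives the supremum over distributions and holds along
  sequences of parameters.\<close>

lemma regret_bound:
  fixes \<rho> r :: "real^'n::finite" and d \<alpha> \<gamma> \<epsilon> \<eta> \<zeta> :: real and U :: "'u measure" and \<kappa> :: "'u \<Rightarrow> 'n tie_rule"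
  assumes "(\<Sum>i\<in>UNIV. \<rho> $ i) \<le> 1" "0 < d" "0 \<le> \<alpha>" "0 \<le> \<gamma>" "0 < \<epsilon>"
    and service: "\<And>i. 0 < r $ i \<and> r $ i < 1 \<and> \<rho> $ i + \<epsilon> \<le> r $ i"
    and "tie_breaking U \<kappa>"
    and T: "0 < T" and c: "0 < c1" "0 < e1"
    and \<eta>_rate: "c1 / sqrt (real T) \<le> \<eta>" "\<eta> \<le> c2 / sqrt (real T)" "\<eta> \<le> 1"
    and \<zeta>_rate: "e1 / sqrt (real T) \<le> \<zeta>" "\<zeta> \<le> e2 / sqrt (real T)"
  defines "m \<equiv> real CARD('n)"
  defines "K \<equiv> m + 1 + \<bar>cadl_path.dual_const \<rho> \<alpha>\<bar> * (1 / c1 + c2) + m * e2 / 2"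
  shows "regret T \<rho> d r \<alpha> \<gamma> \<eta> \<zeta> U \<kappa>
    \<le> ereal ((m * (1 + \<alpha>) + K + m + K / e1) * (sqrt (real T) + \<gamma> / \<epsilon>))"
  unfolding regret_def
proof (rule SUP_least)
  fix F assume F: "F \<in> admissible \<rho> d"
  define s where "s = sqrt (real T)"
  have s: "0 < s" "1 \<le> s" "real T = s * s" using T by (auto simp: s_def)
  have \<eta>_pos: "0 < \<eta>" and \<zeta>_pos: "0 < \<zeta>"
    using less_le_trans[OF _ \<eta>_rate(1)] less_le_trans[OF _ \<zeta>_rate(1)] c T by auto
  interpret prob_space F using F by (simp add: admissible_def)
  interpret cadl_instance F \<rho> d T \<alpha> \<gamma> \<eta> \<zeta> \<epsilon> r U \<kappa>
    by unfold_locales (use F assms(1-7) T \<eta>_rate(3) \<eta>_pos \<zeta>_pos in \<open>auto simp: admissible_def\<close>)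
  define D where "D = \<bar>cadl_path.dual_const \<rho> \<alpha>\<bar>"
  have m: "1 \<le> m" by (simp add: m_def Suc_le_eq)
  have c2: "0 < c2" "0 < e2" 
    using less_le_trans[OF \<eta>_pos \<eta>_rate(2)] less_le_trans[OF \<zeta>_pos \<zeta>_rate(2)] T
    by (auto simp: zero_less_divide_iff)
  have K: "0 \<le> K" unfolding K_def using m c c2 by (intro add_nonneg_nonneg mult_nonneg_nonneg) auto
  have slack: "slackness \<le> K * s"
  proof -
    have "1 / \<eta> \<le> 1 / (c1 / s)" using \<eta>_rate(1) c s(1) by (intro divide_left_mono) (auto simp: s_def[symmetric] \<eta>_pos)
    then have "1 / \<eta> \<le> s / c1" by simp
    moreover have "\<eta> * real T \<le> c2 / s * real T" using \<eta>_rate(2) by (intro mult_right_mono) (auto simp: s_def)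
    then have "\<eta> * real T \<le> c2 * s" using s by simp
    ultimately have "1 / \<eta> + \<eta> * real T \<le> (1 / c1 + c2) * s" by (simp add: distrib_right)
    moreover have "0 \<le> 1 / \<eta> + \<eta> * real T" using \<eta>_pos by simp
    ultimately have "cadl_path.dual_const \<rho> \<alpha> * (1 / \<eta> + \<eta> * real T) \<le> D * ((1 / c1 + c2) * s)"
      unfolding D_def by (intro mult_mono) auto
    moreover have "\<zeta> * m * real T / 2 \<le> m * e2 / 2 * s"
    proof -
      have "\<zeta> * real T \<le> e2 / s * real T" using \<zeta>_rate(2) by (intro mult_right_mono) (auto simp: s_def)
      then have "\<zeta> * real T \<le> e2 * s" using s by simp
      then have "(m / 2) * (\<zeta> * real T) \<le> (m / 2) * (e2 * s)" using m by (intro mult_left_mono) auto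
      then show ?thesis by (simp add: algebra_simps)
    qed
    moreover have "(m + 1) * 1 \<le> (m + 1) * s" using m s by (intro mult_left_mono) auto
    ultimately show ?thesis
      unfolding slackness_def m_def[symmetric] K_def D_def[symmetric] by (simp add: algebra_simps)
  qed
  \<comment> \<open>\<open>slackness\<close> is at most, and \<open>\<zeta> T\<close> at least, a
    multiple of \<open>sqrt T\<close>; their quotient is bounded, which leaves a constant over
    \<epsilon>.\<close>
  have ratio: "slackness / (\<zeta> * \<epsilon> * real T) \<le> K / e1 / \<epsilon>"
  proof -
    have "e1 / s * real T \<le> \<zeta> * real T" using \<zeta>_rate(1) by (intro mult_right_mono) (auto simp: s_def)
    then have "e1 * s \<le> \<zeta> * real T" using s by simp
    then have "(e1 * s) * \<epsilon> \<le> (\<zeta> * real T) * \<epsilon>" using \<epsilon>_pos by (intro mult_right_mono) auto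
    then have le: "e1 * s * \<epsilon> \<le> \<zeta> * \<epsilon> * real T" by (simp add: algebra_simps)
    have "slackness / (\<zeta> * \<epsilon> * real T) \<le> K * s / (\<zeta> * \<epsilon> * real T)"
      using slack \<zeta>_pos \<epsilon>_pos by (intro divide_right_mono) auto
    also have "\<dots> \<le> K * s / (e1 * s * \<epsilon>)"
      using le K s c \<epsilon>_pos \<zeta>_pos T by (intro divide_left_mono) auto
    also have "\<dots> = K / e1 / \<epsilon>" using s by simp
    finally show ?thesis .
  qed
  \<comment> \<open>\<open>\<rho> $ i\<close> is positive and \<open>r $ i\<close> is below 1, so
    \<epsilon> is below 1 and \<gamma> is absorbed by \<open>\<gamma> / \<epsilon>\<close>.\<close>
  have "\<epsilon> \<le> 1"
  proof -
    fix i have "\<epsilon> < 1" using service[of i] \<rho>_pos[of i] by linarith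
    then show ?thesis by simp
  qed
  then have \<gamma>_le: "\<gamma> \<le> \<gamma> / \<epsilon>" using \<gamma>_nonneg \<epsilon>_pos by (simp add: pos_le_divide_eq mult_left_le)
  have "(\<integral>(u, A, s). OPT T \<rho> \<alpha> \<gamma> A s - ALG T \<rho> \<alpha> \<eta> \<zeta> (\<kappa> u) A s \<gamma> \<partial>sample_space T U F r)
      \<le> m * (s + \<alpha> + \<gamma>) + slackness + \<gamma> * (slackness / (\<zeta> * \<epsilon> * real T))"
    using regret_le by (simp only: m_def s_def)
  also have "\<dots> \<le> m * (s + \<alpha> * s + \<gamma> / \<epsilon>) + K * s + \<gamma> * (K / e1 / \<epsilon>)"
    using slack ratio \<gamma>_le m s \<alpha>_nonneg \<gamma>_nonneg mult_left_mono[OF s(2) \<alpha>_nonneg]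
    by (intro add_mono mult_left_mono) auto
  also have "\<dots> = (m * (1 + \<alpha>) + K) * s + (m + K / e1) * (\<gamma> / \<epsilon>)" by (simp add: algebra_simps)
  also have "\<dots> \<le> (m * (1 + \<alpha>) + K + m + K / e1) * s + (m * (1 + \<alpha>) + K + m + K / e1) * (\<gamma> / \<epsilon>)"
  proof -
    have "0 \<le> K / e1" "0 \<le> m * (1 + \<alpha>)" using m K c \<alpha>_nonneg by auto
    then show ?thesis
      using m K s \<gamma>_nonneg \<epsilon>_pos by (intro add_mono[OF mult_right_mono mult_right_mono]) auto
  qed
  finally show "ereal (\<integral>(u, A, s). OPT T \<rho> \<alpha> \<gamma> A s - ALG T \<rho> \<alpha> \<eta> \<zeta> (\<kappa> u) A s \<gamma> \<partial>sample_space T U F r)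
      \<le> ereal ((m * (1 + \<alpha>) + K + m + K / e1) * (sqrt (real T) + \<gamma> / \<epsilon>))"
    by (simp add: distrib_left s_def)
qed

theorem theorem3p1:
  fixes \<rho> :: "real^'n::finite" and d \<alpha> :: real
    and \<gamma> \<epsilon> \<eta> \<zeta> :: "nat \<Rightarrow> real" and r :: "nat \<Rightarrow> real^'n"
    and U :: "nat \<Rightarrow> 'u measure" and \<kappa> :: "nat \<Rightarrow> 'u \<Rightarrow> 'n tie_rule"
  assumes "(\<Sum>i\<in>UNIV. \<rho> $ i) \<le> 1" and "0 < d" and "0 \<le> \<alpha>"
    and "\<And>T. 0 \<le> \<gamma> T"
    and "\<And>T. 0 < \<epsilon> T"
    and "\<And>T i. 0 < r T $ i \<and> r T $ i < 1 \<and> \<rho> $ i + \<epsilon> T \<le> r T $ i"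
    and "\<forall>\<^sub>F T in sequentially. 0 < \<eta> T" and "\<eta> \<in> \<Theta>(\<lambda>T. 1 / sqrt (real T))"
    and "\<forall>\<^sub>F T in sequentially. 0 < \<zeta> T" and "\<zeta> \<in> \<Theta>(\<lambda>T. 1 / sqrt (real T))"
    and "\<And>T. tie_breaking (U T) (\<kappa> T)"
  shows "(\<exists>C. \<forall>\<^sub>F T in sequentially.
            regret T \<rho> d (r T) \<alpha> (\<gamma> T) (\<eta> T) (\<zeta> T) (U T) (\<kappa> T)
              \<le> ereal (C * (sqrt (real T) + \<gamma> T / \<epsilon> T)))
       \<and> (\<epsilon> \<in> \<Omega>(\<lambda>_. 1) \<longrightarrow>
          (\<exists>C. \<forall>\<^sub>F T in sequentially.
            regret T \<rho> d (r T) \<alpha> (\<gamma> T) (\<eta> T) (\<zeta> T) (U T) (\<kappa> T)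
              \<le> ereal (C * (sqrt (real T) + \<gamma> T))))"
proof -
  obtain c1 c2 where c: "0 < c1" "0 < c2"
    and \<eta>: "\<forall>\<^sub>F T in sequentially. c1 / sqrt (real T) \<le> \<eta> T \<and> \<eta> T \<le> c2 / sqrt (real T)"
    by (rule inverse_sqrt_rate_bounds[OF assms(7,8)])
  obtain e1 e2 where e: "0 < e1" "0 < e2"
    and \<zeta>: "\<forall>\<^sub>F T in sequentially. e1 / sqrt (real T) \<le> \<zeta> T \<and> \<zeta> T \<le> e2 / sqrt (real T)"
    by (rule inverse_sqrt_rate_bounds[OF assms(9,10)])
  define m where "m = real CARD('n)"
  define K where "K = m + 1 + \<bar>cadl_path.dual_const \<rho> \<alpha>\<bar> * (1 / c1 + c2) + m * e2 / 2"
  define C where "C = m * (1 + \<alpha>) + K + m + K / e1"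
  have "0 \<le> K" unfolding K_def m_def using c e by (intro add_nonneg_nonneg mult_nonneg_nonneg) auto
  then have C: "0 \<le> C" unfolding C_def using e assms(3) by (simp add: m_def)
  \<comment> \<open>This gives \<open>\<eta> \<le> 1\<close> eventually, as the quadratic bound on
    the exponential requires.\<close>
  have small: "\<forall>\<^sub>F T in sequentially. c2 / sqrt (real T) \<le> 1"
    using eventually_ge_at_top[of "nat \<lceil>c2\<^sup>2\<rceil>"] eventually_gt_at_top[of 0]
  proof eventually_elim
    case (elim T)
    then have "c2\<^sup>2 \<le> real T" by linarith
    then have "c2 \<le> sqrt (real T)" by (rule real_le_rsqrt)
    with elim show ?case by simp
  qed
  have bound: "\<forall>\<^sub>F T in sequentially. regret T \<rho> d (r T) \<alpha> (\<gamma> T) (\<eta> T) (\<zeta> T) (U T) (\<kappa> T)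
      \<le> ereal (C * (sqrt (real T) + \<gamma> T / \<epsilon> T))"
    using \<eta> \<zeta> small eventually_gt_at_top[of 0]
  proof eventually_elim
    case (elim T)
    then have "\<eta> T \<le> 1" by linarith
    with elim show ?case unfolding C_def K_def m_def
      by (intro regret_bound assms(1-6,11) c(1) e(1)) auto
  qed
  moreover have "\<exists>C. \<forall>\<^sub>F T in sequentially. regret T \<rho> d (r T) \<alpha> (\<gamma> T) (\<eta> T) (\<zeta> T) (U T) (\<kappa> T)
      \<le> ereal (C * (sqrt (real T) + \<gamma> T))" if \<Omega>: "\<epsilon> \<in> \<Omega>(\<lambda>_. 1)"
  proof -
    obtain e0 where e0: "0 < e0" "\<forall>\<^sub>F T in sequentially. norm (\<epsilon> T) \<ge> e0 * norm (1 :: real)"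
      using landau_omega.bigE[OF \<Omega>] by blast
    \<comment> \<open>In the factor \<open>1 + 1 / e0\<close>, the 1 covers \<open>sqrt T\<close>
      and the other summand covers \<open>\<gamma> / \<epsilon> \<le> \<gamma> / e0\<close>.\<close>
    have "\<forall>\<^sub>F T in sequentially. regret T \<rho> d (r T) \<alpha> (\<gamma> T) (\<eta> T) (\<zeta> T) (U T) (\<kappa> T)
        \<le> ereal (C * (1 + 1 / e0) * (sqrt (real T) + \<gamma> T))"
      using bound e0(2)
    proof eventually_elim
      case (elim T)
      have \<gamma>: "0 \<le> \<gamma> T" and "0 < \<epsilon> T" using assms(4,5) by auto
      with elim have "e0 \<le> \<epsilon> T" by simp
      then have "\<gamma> T / \<epsilon> T \<le> \<gamma> T / e0" using \<gamma> e0 by (intro divide_left_mono) auto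
      moreover have "(1 + 1 / e0) * (sqrt (real T) + \<gamma> T) = sqrt (real T) + \<gamma> T / e0 + (sqrt (real T) / e0 + \<gamma> T)"
        by (simp add: algebra_simps)
      moreover have "0 \<le> sqrt (real T) / e0 + \<gamma> T" using \<gamma> e0 by simp
      ultimately have "sqrt (real T) + \<gamma> T / \<epsilon> T \<le> (1 + 1 / e0) * (sqrt (real T) + \<gamma> T)" by linarith
      from mult_left_mono[OF this C]
      have "ereal (C * (sqrt (real T) + \<gamma> T / \<epsilon> T)) \<le> ereal (C * (1 + 1 / e0) * (sqrt (real T) + \<gamma> T))"
        by (simp add: mult.assoc)
      with elim(1) show ?case by (rule order_trans)
    qed
    then show ?thesis by blast
  qed
  ultimately show ?thesis by blast
qed

end
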